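(* Let $K$ be an algebraically closed field of characteristic zero. Let $E_{f,q}=(V,\nabla)$ be an irreducible $K(\!(x)\!)$-connection, where $f\in K(\!(x^{1/q})\!)$ has class in $R_q^{o}(x)\setminus\{0\}$, with $\operatorname{ord}(f)=-p/q$. Then the Milnor number $\mu$ of the associated curve $C_{f,q}$ is $$\mu=(2p-1)(q-1)-\mathrm{Irr}\left(\mathrm{End}_{K(\!(x)\!)}(V)\right).$$
   Context: Connections: a $K(\!(x)\!)$-connection $(V,\nabla)$ is a finite dimensional $K(\!(x)\!)$-vector space $V$ with a $K$-linear map $\nabla:V\to V$ satisfying $\nabla(hv)=h\nabla(v)+\frac{dh}{dx}v$ for $h\in K(\!(x)\!)$, $v\in V$. It is irreducible if it has no proper nonzero $\nabla$-stable $K(\!(x)\!)$-subspace. $\mathrm{End}_{K(\!(x)\!)}(V)$ carries the connection $\nabla''(\phi)(v)=\nabla(\phi(v))-\phi(\nabla(v))$. For $q\in\mathbb{Z}_{>0}$ and $f\in K(\!(x^{1/q})\!)$, $E_{f,q}=(V,\nabla)$ is the connection with $V=K(\!(x^{1/q})\!)$ regarded as a $K(\!(x)\!)$-vector space and $\nabla(v)=(\frac{d}{dx}+x^{-1}f)v$. The order $\operatorname{ord}(f)\in\frac1q\mathbb{Z}$ is the lowest exponent of $x$ occurring in $f$ with nonzero coefficient. Put $R_q(x)=K(\!(x^{1/q})\!)/\left(x^{1/q}K[\![x^{1/q}]\!]+\frac1q\mathbb{Z}\right)$, and let $R_q^{o}(x)$ be the set of elements of $R_q(x)$ that cannot be represented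 by elements of $K(\!(x^{1/r})\!)$ for any $0<r<q$. It is known that $E_{f,q}$ is irreducible if and only if the class of $f$ lies in $R_q^{o}(x)$. Associated curve: for $f$ with class in $R_q^{o}(x)\setminus\{0\}$, $C_{f,q}(x,y)=\prod_{i=1}^{q}\left(y-\frac{1}{f_i(x^{1/q})}\right)\in K[\![x,y]\!]$, where $f_i(x^{1/q})=f(\zeta_q^i x^{1/q})$ and $\zeta_q$ is a primitive $q$-th root of unity. Milnor number: for $F\in K[\![x,y]\!]$, $\mu=I\left(\frac{\partial F}{\partial x},\frac{\partial F}{\partial y}\right)$, where $I(G,H)=\dim_K K[\![x,y]\!]/\langle G,H\rangle$. Irregularity: every connection decomposes as $\bigoplus_i (E_{f_i,q_i}\otimes J_{m_i})$ with $f_i$ having class in $R_{q_i}^{o}(x)$ and $J_m=(K(\!(x)\!)^{\oplus m},\frac{d}{dx}+x^{-1}N_m)$, $N_m$ the nilpotent Jordan block of size $m$ (Hukuhara–Turrittin–Levelt). Then $\mathrm{Irr}=\sum_i m_i q_i\max(0,-\operatorname{ord}(f_i))$ (with $\operatorname{ord}(0)=+\infty$); this is independent of the decomposition. *)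

theory Defs
  imports
    "HOL-Computational_Algebra.Computational_Algebra"
    "HOL-Library.Function_Algebras"
    "HOL-Library.Extended_Real"
begin

text \<open>
  An element of $K((x^{1/q}))$ is represented by a formal Laurent series in the variable
  $t = x^{1/q}$; the number q is always passed separately.  The inclusion of $K((x))$ into
  $K((x^{1/q}))$, that is $h(x) \mapsto h(t^q)$, is \<^term>\<open>\<lambda>h. fls_compose_power h q\<close>.
\<close>

text \<open>
  The carrier is a subset of an ambient abelian group, which makes it possible to treat
  spaces of linear maps and direct sums of varying size; \<open>scal\<close> and \<open>nabla\<close> only matter on it.
\<close>

record (overloaded) ('a, 'v) conn =
  carr :: "'v set"
  scal :: "'a fls \<Rightarrow> 'v \<Rightarrow> 'v"
  nabla :: "'v \<Rightarrow> 'v"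

definition is_subspace :: "('a::field, 'v::ab_group_add) conn \<Rightarrow> 'v set \<Rightarrow> bool" where
  "is_subspace C W \<longleftrightarrow> W \<subseteq> carr C \<and> 0 \<in> W \<and> (\<forall>u\<in>W. \<forall>v\<in>W. u + v \<in> W)
     \<and> (\<forall>h. \<forall>v\<in>W. scal C h v \<in> W)"

definition is_fin_dim_space :: "('a::field, 'v::ab_group_add) conn \<Rightarrow> bool" where
  "is_fin_dim_space C \<longleftrightarrow> is_subspace C (carr C)
     \<and> (\<forall>h. \<forall>u\<in>carr C. \<forall>v\<in>carr C. scal C h (u + v) = scal C h u + scal C h v)
     \<and> (\<forall>g h. \<forall>v\<in>carr C. scal C (g + h) v = scal C g v + scal C h v)
     \<and> (\<forall>g h. \<forall>v\<in>carr C. scal C (g * h) v = scal C g (scal C h v))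
     \<and> (\<forall>v\<in>carr C. scal C 1 v = v)
     \<and> (\<exists>B. finite B \<and> B \<subseteq> carr C \<and> (\<forall>v\<in>carr C. \<exists>c. v = (\<Sum>b\<in>B. scal C (c b) b)))"

definition is_connection :: "('a::field, 'v::ab_group_add) conn \<Rightarrow> bool" where
  "is_connection C \<longleftrightarrow> is_fin_dim_space C
     \<and> (\<forall>v\<in>carr C. nabla C v \<in> carr C)
     \<and> (\<forall>u\<in>carr C. \<forall>v\<in>carr C. nabla C (u + v) = nabla C u + nabla C v)
     \<and> (\<forall>c. \<forall>v\<in>carr C. nabla C (scal C (fls_const c) v) = scal C (fls_const c) (nabla C v))
     \<and> (\<forall>h. \<forall>v\<in>carr C. nabla C (scal C h v) = scal C h (nabla C v) + scal C (fls_deriv h) v)"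

definition irreducible_connection :: "('a::field, 'v::ab_group_add) conn \<Rightarrow> bool" where
  "irreducible_connection C \<longleftrightarrow> is_connection C
     \<and> (\<forall>W. is_subspace C W \<and> nabla C ` W \<subseteq> W \<longrightarrow> W = {0} \<or> W = carr C)"

definition conn_iso :: "('a::field, 'v::ab_group_add) conn \<Rightarrow> ('a, 'w::ab_group_add) conn \<Rightarrow> bool" where
  "conn_iso C D \<longleftrightarrow> (\<exists>T. bij_betw T (carr C) (carr D)
     \<and> (\<forall>u\<in>carr C. \<forall>v\<in>carr C. T (u + v) = T u + T v)
     \<and> (\<forall>h. \<forall>v\<in>carr C. T (scal C h v) = scal D h (T v))
     \<and> (\<forall>v\<in>carr C. T (nabla C v) = nabla D (T v)))"

text \<open>Linear maps are extended by 0 outside the carrier, so that they are determined by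
  their values on it.\<close>

definition End_conn :: "('a::field, 'v::ab_group_add) conn \<Rightarrow> ('a, 'v \<Rightarrow> 'v) conn" where
  "End_conn C = \<lparr>
     carr = {\<phi>. (\<forall>v\<in>carr C. \<phi> v \<in> carr C) \<and> (\<forall>v. v \<notin> carr C \<longrightarrow> \<phi> v = 0)
       \<and> (\<forall>u\<in>carr C. \<forall>v\<in>carr C. \<phi> (u + v) = \<phi> u + \<phi> v)
       \<and> (\<forall>h. \<forall>v\<in>carr C. \<phi> (scal C h v) = scal C h (\<phi> v))},
     scal = (\<lambda>h \<phi> v. if v \<in> carr C then scal C h (\<phi> v) else 0),
     nabla = (\<lambda>\<phi> v. if v \<in> carr C then nabla C (\<phi> v) - \<phi> (nabla C v) else 0)\<rparr>"

definition direct_sum :: "('a::field, 'v::ab_group_add) conn list \<Rightarrow> ('a, nat \<Rightarrow> 'v) conn" where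
  "direct_sum Cs = \<lparr>
     carr = {u. \<forall>i. if i < length Cs then u i \<in> carr (Cs ! i) else u i = 0},
     scal = (\<lambda>h u i. if i < length Cs then scal (Cs ! i) h (u i) else 0),
     nabla = (\<lambda>u i. if i < length Cs then nabla (Cs ! i) (u i) else 0)\<rparr>"

text \<open>
  The tensor product over $K((x))$ of $(V,\nabla)$ with the connection
  $(K((x))^m, d/dx + A)$.  The element $\sum_{i<m} u_i \otimes e_i$ is represented by the
  tuple u, and $\nabla(v \otimes e_j) = \nabla v \otimes e_j + \sum_i A_{ij} v \otimes e_i$.
\<close>

definition tensor_matrix_conn ::
    "('a::field, 'v::ab_group_add) conn \<Rightarrow> nat \<Rightarrow> (nat \<Rightarrow> nat \<Rightarrow> 'a fls) \<Rightarrow> ('a, nat \<Rightarrow> 'v) conn" where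
  "tensor_matrix_conn C m A = \<lparr>
     carr = {u. \<forall>i. if i < m then u i \<in> carr C else u i = 0},
     scal = (\<lambda>h u i. if i < m then scal C h (u i) else 0),
     nabla = (\<lambda>u i. if i < m then nabla C (u i) + (\<Sum>j<m. scal C (A i j) (u j)) else 0)\<rparr>"

text \<open>The matrix $x^{-1} N_m$ of $J_m$ (indices are restricted to $i, j < m$ by its use).\<close>

definition jordan_matrix :: "nat \<Rightarrow> nat \<Rightarrow> 'a::field fls" where
  "jordan_matrix i j = (if j = Suc i then inverse fls_X else 0)"

text \<open>The extension of $d/dx$ to $K((t))$ for $t = x^{1/q}$: there $dt/dx = (1/q)\, t^{1-q}$.\<close>

definition ddx :: "nat \<Rightarrow> 'a::field_char_0 fls \<Rightarrow> 'a fls" where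
  "ddx q v = fls_const (1 / of_nat q) * fls_X powi (1 - int q) * fls_deriv v"

definition E_conn :: "'a::field_char_0 fls \<Rightarrow> nat \<Rightarrow> ('a, 'a fls) conn" where
  "E_conn f q = \<lparr>
     carr = UNIV,
     scal = (\<lambda>h v. fls_compose_power h q * v),
     nabla = (\<lambda>v. ddx q v + fls_X powi (- int q) * f * v)\<rparr>"

definition puiseux_ord :: "nat \<Rightarrow> 'a::zero fls \<Rightarrow> ereal" where
  "puiseux_ord q f = (if f = 0 then \<infinity> else ereal (real_of_int (fls_subdegree f) / real q))"

definition R_kernel :: "nat \<Rightarrow> 'a::field_char_0 fls set" where
  "R_kernel q = {fps_to_fls (fps_X * g) + fls_const (of_int k / of_nat q) | g k. True}"

definition R_class :: "nat \<Rightarrow> 'a::field_char_0 fls \<Rightarrow> 'a fls set" where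
  "R_class q f = (\<lambda>h. f + h) ` R_kernel q"

text \<open>
  A series $g \in K((x^{1/r}))$ equals $f \in K((x^{1/q}))$ iff they agree in
  $K((x^{1/(qr)}))$, i.e. iff $f(s^r) = g(s^q)$ for $s = x^{1/(qr)}$.
\<close>

definition R_circ :: "nat \<Rightarrow> 'a::field_char_0 fls set set" where
  "R_circ q = {c \<in> range (R_class q).
     \<not> (\<exists>r. 0 < r \<and> r < q \<and> (\<exists>f\<in>c. \<exists>g. fls_compose_power f r = fls_compose_power g q))}"

text \<open>The data of a decomposition is the list of the triples $(f_i, q_i, m_i)$.\<close>

definition HTL_decomposition ::
    "('a::field_char_0, 'v::ab_group_add) conn \<Rightarrow> ('a fls \<times> nat \<times> nat) list \<Rightarrow> bool" where
  "HTL_decomposition C ds \<longleftrightarrow>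
     (\<forall>(f, q, m)\<in>set ds. 0 < q \<and> 0 < m \<and> R_class q f \<in> R_circ q)
     \<and> conn_iso C (direct_sum (map (\<lambda>(f, q, m). tensor_matrix_conn (E_conn f q) m jordan_matrix) ds))"

definition irregularity :: "('a::field_char_0, 'v::ab_group_add) conn \<Rightarrow> real" where
  "irregularity C = (THE r. \<exists>ds. HTL_decomposition C ds
     \<and> r = (\<Sum>(f, q, m)\<leftarrow>ds. real m * real q * real_of_ereal (max 0 (- puiseux_ord q f))))"

text \<open>
  The ring $K[[x,y]]$ is rendered as $K[[x]][[y]]$: for \<open>F :: 'a fps fps\<close>, the coefficient of
  $x^k y^n$ is \<open>fps_nth (fps_nth F n) k\<close>.
\<close>

definition fls_conjugate :: "'a::field \<Rightarrow> nat \<Rightarrow> 'a fls \<Rightarrow> 'a fls" where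
  "fls_conjugate \<zeta> i f = fls_compose_fps f (fps_const (\<zeta> ^ i) * fps_X)"

text \<open>The product is formed in $K((t))[y]$ for $t = x^{1/q}$; the curve is the series $C(x,y)$
  such that $C(t^q, y)$ is this product.\<close>

definition assoc_curve :: "'a::field \<Rightarrow> 'a fls \<Rightarrow> nat \<Rightarrow> 'a fps fps" where
  "assoc_curve \<zeta> f q = (THE C. \<forall>n. fls_compose_power (fps_to_fls (fps_nth C n)) q =
     coeff (\<Prod>i=1..q. [:- (1 / fls_conjugate \<zeta> i f), 1:]) n)"

definition deriv_x :: "'a::field fps fps \<Rightarrow> 'a fps fps" where
  "deriv_x F = Abs_fps (\<lambda>n. fps_deriv (fps_nth F n))"

definition deriv_y :: "'a::field fps fps \<Rightarrow> 'a fps fps" where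
  "deriv_y F = fps_deriv F"

definition K_lincomb :: "'a::field fps fps set \<Rightarrow> ('a fps fps \<Rightarrow> 'a) \<Rightarrow> 'a fps fps" where
  "K_lincomb B c = (\<Sum>b\<in>B. fps_const (fps_const (c b)) * b)"

text \<open>B is a finite set of representatives of a K-basis of $K[[x,y]]/W$.\<close>

definition quotient_basis :: "'a::field fps fps set \<Rightarrow> 'a fps fps set \<Rightarrow> bool" where
  "quotient_basis W B \<longleftrightarrow> finite B
     \<and> (\<forall>F. \<exists>c. F - K_lincomb B c \<in> W)
     \<and> (\<forall>c. K_lincomb B c \<in> W \<longrightarrow> (\<forall>b\<in>B. c b = 0))"

definition quotient_dim :: "'a::field fps fps set \<Rightarrow> enat" where
  "quotient_dim W = (if \<exists>B. quotient_basis W B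
     then enat (THE n. \<exists>B. quotient_basis W B \<and> card B = n) else \<infinity>)"

definition intersection_number :: "'a::field fps fps \<Rightarrow> 'a fps fps \<Rightarrow> enat" where
  "intersection_number G H = quotient_dim {A * G + B * H | A B. True}"

definition milnor_number :: "'a::field fps fps \<Rightarrow> enat" where
  "milnor_number F = intersection_number (deriv_x F) (deriv_y F)"

definition primitive_root_of_unity :: "nat \<Rightarrow> 'a::field \<Rightarrow> bool" where
  "primitive_root_of_unity q \<zeta> \<longleftrightarrow> \<zeta> ^ q = 1 \<and> (\<forall>k. 0 < k \<and> k < q \<longrightarrow> \<zeta> ^ k \<noteq> 1)"

end

theory Submission
  imports Defs
begin

text \<open>
  Put $t = x^{1/q}$, let $\sigma_i$ be the conjugation $t \mapsto \zeta^i t$ and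
  $a_i = 1 / \sigma_i f$.  A $K((x))$-linear endomorphism of $K((t))$ is uniquely of the form
  $\sum_i b_i \sigma_i$ with $b_i \in K((t))$, which identifies the endomorphism connection with the sum
  of the $E_{f - \sigma_i f, q}$.  After removal of the part of positive order of
  $f - \sigma_i f$ by a gauge transformation, such a summand splits into the irreducible
  connections obtained from the powers of $t$ modulo a smaller ramification index, so that
  $\mathrm{Irr} = - \sum_{i \neq 0} \mathrm{ord}_t (f - \sigma_i f)$.  The irregularity does
  not depend on the decomposition because, by the growth of poles under iteration of
  $x \nabla$, there is no nonzero morphism from a summand to one of smaller slope.

  On the other side, write $\partial C / \partial y = q \prod_j (y - b_j)$ over $K[[s]]$ with
  $x = s^M$ (Newton-Puiseux).  The chain rule along the branch $(s^M, b_j(s))$ of the polar curve gives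
  $\mathrm{ord}_s\, C = \mathrm{ord}_s\, \partial C / \partial x + M$, hence
  $\mu = I(C, \partial C / \partial y) - (q - 1)$.  Finally $I(C, \partial C / \partial y)$ is the order of the discriminant of $C$, and
  $\mathrm{ord}_t (a_i - a_k) = \mathrm{ord}_t (\sigma_i f - \sigma_k f) + 2p$.
\<close>

text \<open>The Milnor number is a K-dimension in K[[x]][[y]], whereas the roots of the y-derivative
  of C exist only after replacing \<open>x\<close> by \<open>s^M\<close>. Two transfers bridge this.
  Up to the unit \<open>q\<close> the y-derivative is a Weierstrass polynomial, so dividing by it
  gives K[[x]][[y]] and K[[x]][y] the same quotient. And K[[s]][y] is free of rank \<open>M\<close>
  over K[[x]][y], so the base change multiplies codimensions by \<open>M\<close>; there the
  y-derivative is a product of linear factors and the codimension is a sum of orders.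

  Membership of the class of \<open>f\<close> in \<open>R_circ q\<close> is used in the form that
  \<open>q\<close> and the pole exponents of \<open>f\<close> have gcd 1. This makes
  \<open>f - \<sigma>_i f\<close> have a pole for \<open>0 < i < q\<close>, so that the roots of the
  curve are distinct and the orders in question are finite.

  In the factor \<open>2p - 1\<close>, the \<open>2p\<close> comes from the difference of two
  reciprocals, and the 1 from each of the \<open>q - 1\<close> polar branches. If
  \<open>p = 0\<close>, the gcd condition forces \<open>q = 1\<close>, and both sides are 0.\<close>

unbundle fps_syntax

section \<open>Ring homomorphisms and substitutions\<close>

text \<open>Its instances are the substitution \<open>x = s^N\<close>, the embedding of power series
  into Laurent series, the constant coefficient, the conjugation by \<zeta>, and
  \<open>map_poly\<close> of such maps.\<close>

locale comm_ring_hom_map =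
  fixes h :: "'a::idom \<Rightarrow> 'b::idom"
  assumes hom_one [simp]: "h 1 = 1"
    and hom_add: "h (x + y) = h x + h y"
    and hom_mult: "h (x * y) = h x * h y"
begin

lemma hom_zero [simp]: "h 0 = 0"
  using hom_add[of 0 0] by (metis add_0_right add_left_cancel)

lemma hom_uminus: "h (- x) = - h x"
  using hom_add[of x "- x"] by (simp add: eq_neg_iff_add_eq_0 add.commute)

lemma hom_diff: "h (x - y) = h x - h y"
  using hom_add[of x "- y"] by (simp add: hom_uminus)

lemma hom_sum: "h (sum f A) = (\<Sum>x\<in>A. h (f x))"
  by (induction A rule: infinite_finite_induct) (simp_all add: hom_add)

lemma hom_prod: "h (prod f A) = (\<Prod>x\<in>A. h (f x))"
  by (induction A rule: infinite_finite_induct) (simp_all add: hom_mult)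

lemma hom_power: "h (x ^ n) = h x ^ n"
  by (induction n) (simp_all add: hom_mult)

lemma hom_of_nat: "h (of_nat n) = of_nat n"
  by (induction n) (simp_all add: hom_add)

lemma map_poly_add: "map_poly h (p + q) = map_poly h p + map_poly h q"
  by (intro poly_eqI) (simp add: coeff_map_poly hom_add)

lemma map_poly_mult: "map_poly h (p * q) = map_poly h p * map_poly h q"
  by (intro poly_eqI) (simp add: coeff_map_poly coeff_mult hom_sum hom_mult)

lemma map_poly_hom: "comm_ring_hom_map (map_poly h)"
  by unfold_locales (simp_all add: map_poly_add map_poly_mult map_poly_1')

lemma map_poly_linear: "map_poly h [:a, b:] = [:h a, h b:]"
  by (simp add: map_poly_pCons)

lemma map_poly_linear_factors:
  "map_poly h (\<Prod>b\<leftarrow>bs. [:- b, 1:]) = (\<Prod>b\<leftarrow>bs. [:- h b, 1:])"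
  by (induction bs) (simp_all add: map_poly_mult map_poly_linear hom_uminus map_poly_1' del: mult_pCons_left)

lemma poly_map_poly: "poly (map_poly h p) (h x) = h (poly p x)"
  by (induction p) (simp_all add: map_poly_pCons hom_add hom_mult)

lemma map_poly_pcompose: "map_poly h (pcompose p q) = pcompose (map_poly h p) (map_poly h q)"
  by (induction p) (simp_all add: pcompose_pCons map_poly_add map_poly_mult map_poly_pCons)

lemma map_poly_pderiv: "map_poly h (pderiv p) = pderiv (map_poly h p)"
  by (intro poly_eqI) (simp add: coeff_map_poly coeff_pderiv hom_mult hom_add hom_of_nat)

end

text \<open>Base change: rewrites a series in \<open>x\<close> as a series in a root
  \<open>s\<close> of \<open>x\<close>, where \<open>x = s^N\<close>.\<close>

abbreviation pow_subst :: "nat \<Rightarrow> 'a::idom fps \<Rightarrow> 'a fps" where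
  "pow_subst N c \<equiv> c oo fps_X ^ N"

lemma pow_subst_hom: "0 < N \<Longrightarrow> comm_ring_hom_map (pow_subst N :: 'a::idom fps \<Rightarrow> _)"
  by unfold_locales (simp_all add: fps_compose_add_distrib fps_compose_mult_distrib)

lemma pow_subst_nth: "pow_subst N c $ n = (if N dvd n then c $ (n div N) else 0)"
  by (rule fps_nth_compose_X_power)

lemma pow_subst_pow_subst:
  assumes "0 < N" "0 < M"
  shows "pow_subst N (pow_subst M c) = pow_subst (N * M) c"
proof -
  have "pow_subst N (pow_subst M c) = c oo (fps_X ^ M oo fps_X ^ N)"
    using assms by (intro fps_compose_assoc[symmetric]) auto
  also have "fps_X ^ M oo fps_X ^ N = (fps_X ^ (N * M) :: 'a fps)"
    using assms by (simp add: power_mult flip: fps_compose_power)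
  finally show ?thesis .
qed

lemma pow_subst_eq_0_iff:
  assumes "0 < N"
  shows "pow_subst N c = 0 \<longleftrightarrow> c = 0"
proof
  assume "pow_subst N c = 0"
  then have "pow_subst N c $ (N * n) = 0" for n by simp
  then show "c = 0" using assms by (intro fps_ext) (simp add: pow_subst_nth)
qed simp

lemma subdegree_pow_subst: "0 < N \<Longrightarrow> subdegree (pow_subst N c) = N * subdegree c"
proof (cases "c = 0")
  case False
  assume N: "0 < N"
  show ?thesis
  proof (rule subdegreeI)
    show "pow_subst N c $ (N * subdegree c) \<noteq> 0" using False N by (simp add: pow_subst_nth)
    show "pow_subst N c $ i = 0" if "i < N * subdegree c" for i
      using that N by (auto simp: pow_subst_nth elim!: dvdE)
  qed
qed simp

section \<open>Codimension and intersection ideals\<close>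

text \<open>Gaussian elimination by induction on the equations. The index types are arbitrary
  because the lemma serves numbered families as well as coordinates indexed by triples.\<close>

lemma homogeneous_system_solution:
  fixes c :: "'i \<Rightarrow> 'j \<Rightarrow> 'a::field"
  assumes "finite J" "finite I" "card J < card I"
  shows "\<exists>l. (\<exists>i\<in>I. l i \<noteq> 0) \<and> (\<forall>j\<in>J. (\<Sum>i\<in>I. l i * c i j) = 0)"
  using assms
proof (induction J arbitrary: I c rule: finite_induct)
  case empty
  then have "I \<noteq> {}" by auto
  then show ?case by (intro exI[of _ "\<lambda>_. 1"]) auto
next
  case (insert n J)
  show ?case
  proof (cases "\<forall>i\<in>I. c i n = 0")
    case True
    have "\<exists>l. (\<exists>i\<in>I. l i \<noteq> 0) \<and> (\<forall>j\<in>J. (\<Sum>i\<in>I. l i * c i j) = 0)"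
      using insert.prems insert.hyps by (intro insert.IH) auto
    then show ?thesis using True by auto
  next
    case False
    then obtain k where k: "k \<in> I" "c k n \<noteq> 0" by auto
    let ?J = "I - {k}"
    let ?c = "\<lambda>i j. c i j - c i n / c k n * c k j"
    have "\<exists>l. (\<exists>i\<in>?J. l i \<noteq> 0) \<and> (\<forall>j\<in>J. (\<Sum>i\<in>?J. l i * ?c i j) = 0)"
      using insert.prems insert.hyps k by (intro insert.IH) auto
    then obtain l where l: "\<exists>i\<in>?J. l i \<noteq> 0" "\<forall>j\<in>J. (\<Sum>i\<in>?J. l i * ?c i j) = 0" by blast
    \<comment> \<open>The value at \<open>k\<close> is the one forced by the equation
      \<open>n\<close>.\<close>
    define l' where "l' = l(k := - (\<Sum>i\<in>?J. l i * c i n) / c k n)"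
    have eq: "(\<Sum>i\<in>I. l' i * c i j) = (\<Sum>i\<in>?J. l i * ?c i j)" for j
    proof -
      have "(\<Sum>i\<in>I. l' i * c i j) = l' k * c k j + (\<Sum>i\<in>?J. l' i * c i j)"
        using k insert.prems by (simp add: sum.remove)
      also have "(\<Sum>i\<in>?J. l' i * c i j) = (\<Sum>i\<in>?J. l i * c i j)"
        by (rule sum.cong) (auto simp: l'_def)
      also have "l' k * c k j = (\<Sum>i\<in>?J. - (l i * (c i n / c k n * c k j)))"
        by (simp add: l'_def sum_distrib_right sum_divide_distrib sum_negf) (simp add: mult_ac)
      finally show ?thesis
        by (simp add: algebra_simps sum_subtractf sum_negf)
    qed
    have "\<forall>j\<in>insert n J. (\<Sum>i\<in>I. l' i * c i j) = 0"
      using l(2) k(2) by (auto simp: eq)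
    moreover have "\<exists>i\<in>I. l' i \<noteq> 0" using l(1) by (auto simp: l'_def)
    ultimately show ?thesis by blast
  qed
qed

lemma sum_lessThan_add:
  "(\<Sum>i<m+n. f i) = (\<Sum>i<m. f i) + (\<Sum>i<n. f (m + i))"
  for f :: "nat \<Rightarrow> 'a::comm_monoid_add"
  by (induction n) (simp_all add: add.assoc)

locale quotient_space = vector_space scale
  for scale :: "'a::field \<Rightarrow> 'b::ab_group_add \<Rightarrow> 'b" (infixr "*s" 75)
begin

text \<open>Representatives stand for their classes modulo \<open>W\<close>, so that dimensions of
  quotients are handled without a quotient type.\<close>

definition spans_modulo :: "'b set \<Rightarrow> nat \<Rightarrow> (nat \<Rightarrow> 'b) \<Rightarrow> bool" where
  "spans_modulo W n b \<longleftrightarrow> (\<forall>v. \<exists>c. v - (\<Sum>i<n. c i *s b i) \<in> W)"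

definition independent_modulo :: "'b set \<Rightarrow> nat \<Rightarrow> (nat \<Rightarrow> 'b) \<Rightarrow> bool" where
  "independent_modulo W n b \<longleftrightarrow> (\<forall>c. (\<Sum>i<n. c i *s b i) \<in> W \<longrightarrow> (\<forall>i<n. c i = 0))"

definition has_codim :: "'b set \<Rightarrow> nat \<Rightarrow> bool" where
  "has_codim W n \<longleftrightarrow> (\<exists>b. spans_modulo W n b \<and> independent_modulo W n b)"

text \<open>Expressing the \<open>m\<close> vectors through the \<open>n\<close> spanning ones gives
  \<open>n\<close> homogeneous equations in \<open>m\<close> unknowns; a nontrivial solution would
  be a relation modulo \<open>W\<close>.\<close>

lemma independent_modulo_le:
  assumes W: "subspace W" and b: "spans_modulo W n b" and b': "independent_modulo W m b'"
  shows "m \<le> n"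
proof (rule ccontr)
  assume "\<not> m \<le> n"
  obtain c where c: "b' i - (\<Sum>j<n. c i j *s b j) \<in> W" for i
    using b unfolding spans_modulo_def by meson
  obtain l where l: "\<exists>i<m. l i \<noteq> 0" "\<forall>j<n. (\<Sum>i<m. l i * c i j) = 0"
    using homogeneous_system_solution[of "{..<n}" "{..<m}" c] \<open>\<not> m \<le> n\<close> by auto
  have "(\<Sum>i<m. l i *s (b' i - (\<Sum>j<n. c i j *s b j))) \<in> W"
    by (intro subspace_sum subspace_scale W c)
  also have "(\<Sum>i<m. l i *s (b' i - (\<Sum>j<n. c i j *s b j)))
      = (\<Sum>i<m. l i *s b' i) - (\<Sum>i<m. \<Sum>j<n. (l i * c i j) *s b j)"
    by (simp add: scale_right_diff_distrib sum_subtractf scale_sum_right)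
  also have "(\<Sum>i<m. \<Sum>j<n. (l i * c i j) *s b j) = (\<Sum>j<n. (\<Sum>i<m. l i * c i j) *s b j)"
    by (subst sum.swap) (simp add: scale_sum_left)
  also have "\<dots> = 0" using l(2) by simp
  finally show False using b' l(1) unfolding independent_modulo_def by auto
qed

lemma has_codim_unique:
  assumes "subspace W" "has_codim W n" "has_codim W m"
  shows "n = m"
  using assms unfolding has_codim_def by (auto intro!: order_antisym independent_modulo_le)

text \<open>An independent family of maximal length spans: adjoining \<open>v\<close> creates a
  relation, and the coefficient of \<open>v\<close> in it cannot vanish.\<close>

lemma has_codim_exists:
  assumes W: "subspace W" and bd: "\<And>m b. independent_modulo W m b \<Longrightarrow> m \<le> D"
  shows "\<exists>d. has_codim W d"
proof -
  let ?P = "\<lambda>m. \<exists>b. independent_modulo W m b"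
  have "?P 0" by (simp add: independent_modulo_def)
  then obtain m where m: "?P m" and max: "\<And>k. ?P k \<Longrightarrow> k \<le> m"
    using bd ex_has_greatest_nat[of ?P 0 id "Suc D"] by (auto simp: less_Suc_eq_le)
  then obtain b where b: "independent_modulo W m b" by auto
  have "\<exists>c. v - (\<Sum>i<m. c i *s b i) \<in> W" for v
  proof -
    define b' where "b' = b(m := v)"
    have "\<not> independent_modulo W (Suc m) b'" using max[of "Suc m"] by auto
    then obtain c where c: "(\<Sum>i<Suc m. c i *s b' i) \<in> W" "\<exists>i<Suc m. c i \<noteq> 0"
      unfolding independent_modulo_def by blast
    have s: "(\<Sum>i<Suc m. c i *s b' i) = (\<Sum>i<m. c i *s b i) + c m *s v"
      by (simp add: b'_def)
    have cm: "c m \<noteq> 0"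
    proof
      assume "c m = 0"
      then have "(\<Sum>i<m. c i *s b i) \<in> W" using c(1) s by simp
      then show False using b c(2) \<open>c m = 0\<close> unfolding independent_modulo_def
        by (auto simp: less_Suc_eq)
    qed
    have "inverse (c m) *s (\<Sum>i<Suc m. c i *s b' i) \<in> W" using c W by (intro subspace_scale)
    also have "inverse (c m) *s (\<Sum>i<Suc m. c i *s b' i) =
        v - (\<Sum>i<m. (- (inverse (c m) * c i)) *s b i)"
      unfolding s using cm by (simp add: scale_right_distrib scale_sum_right sum_negf)
    finally show ?thesis by (intro exI[of _ "\<lambda>i. - (inverse (c m) * c i)"])
  qed
  then show ?thesis using b unfolding has_codim_def spans_modulo_def by auto
qed

lemma has_codim_UNIV: "has_codim UNIV 0"
  by (auto simp: has_codim_def spans_modulo_def independent_modulo_def)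

text \<open>Applied to the exact sequence
  $0 \to V/W_1 \to V/W \to V/W_2 \to 0$ whose first map is induced by \<open>m\<close>.\<close>

lemma has_codim_exact:
  assumes lin: "module_hom scale scale m"
    and sub: "subspace W" "subspace W2"
    and codim: "has_codim W1 d1" "has_codim W2 d2"
    and W: "W \<subseteq> W2" "range m \<subseteq> W2" "\<And>v. m v \<in> W \<longleftrightarrow> v \<in> W1"
    and surj: "\<And>v. v \<in> W2 \<Longrightarrow> \<exists>u. v - m u \<in> W"
  shows "has_codim W (d2 + d1)"
proof -
  interpret m: module_hom scale scale m by (rule lin)
  obtain b1 where b1: "spans_modulo W1 d1 b1" "independent_modulo W1 d1 b1"
    using codim unfolding has_codim_def by auto
  obtain b2 where b2: "spans_modulo W2 d2 b2" "independent_modulo W2 d2 b2"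
    using codim unfolding has_codim_def by auto
  define b where "b = (\<lambda>i. if i < d2 then b2 i else m (b1 (i - d2)))"
  have split: "(\<Sum>i<d2+d1. c i *s b i) = (\<Sum>i<d2. c i *s b2 i) + m (\<Sum>i<d1. c (d2 + i) *s b1 i)" for c
    by (simp add: sum_lessThan_add b_def m.sum m.scale)
  have "spans_modulo W (d2 + d1) b"
    unfolding spans_modulo_def
  proof
    fix v
    obtain c2 where c2: "v - (\<Sum>i<d2. c2 i *s b2 i) \<in> W2"
      using b2 unfolding spans_modulo_def by blast
    then obtain u where u: "v - (\<Sum>i<d2. c2 i *s b2 i) - m u \<in> W" using surj by blast
    obtain c1 where c1: "u - (\<Sum>i<d1. c1 i *s b1 i) \<in> W1"
      using b1 unfolding spans_modulo_def by blast
    then have "m (u - (\<Sum>i<d1. c1 i *s b1 i)) \<in> W" using W by auto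
    with u have "(v - (\<Sum>i<d2. c2 i *s b2 i) - m u) + m (u - (\<Sum>i<d1. c1 i *s b1 i)) \<in> W"
      by (intro subspace_add sub)
    also have "(v - (\<Sum>i<d2. c2 i *s b2 i) - m u) + m (u - (\<Sum>i<d1. c1 i *s b1 i)) =
      v - (\<Sum>i<d2+d1. (if i < d2 then c2 i else c1 (i - d2)) *s b i)"
      unfolding split by (simp add: m.diff)
    finally show "\<exists>c. v - (\<Sum>i<d2+d1. c i *s b i) \<in> W"
      by (intro exI[of _ "\<lambda>i. if i < d2 then c2 i else c1 (i - d2)"])
  qed
  moreover have "independent_modulo W (d2 + d1) b"
    unfolding independent_modulo_def
  proof (intro allI impI)
    fix c i assume c: "(\<Sum>i<d2+d1. c i *s b i) \<in> W" and i: "i < d2 + d1"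
    let ?u = "\<Sum>i<d1. c (d2 + i) *s b1 i"
    have "(\<Sum>i<d2+d1. c i *s b i) - m ?u \<in> W2"
      using c W by (intro subspace_diff sub) auto
    then have "(\<Sum>i<d2. c i *s b2 i) \<in> W2" unfolding split by simp
    then have c2: "\<forall>i<d2. c i = 0" using b2 unfolding independent_modulo_def by auto
    then have "m ?u \<in> W" using c unfolding split by simp
    then have "?u \<in> W1" using W by auto
    then have "\<forall>i<d1. c (d2 + i) = 0"
      using b1 unfolding independent_modulo_def by (auto dest: spec[of _ "\<lambda>i. c (d2 + i)"])
    then show "c i = 0" using c2 i
      by (metis add_diff_inverse_nat nat_add_left_cancel_less)
  qed
  ultimately show ?thesis unfolding has_codim_def by auto
qed

end

lemma quotient_space_fps_fps:
  "quotient_space (\<lambda>c F :: 'a::field fps fps. fps_const (fps_const c) * F)"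
proof
  fix a b :: 'a and x y :: "'a fps fps"
  have "fps_const (fps_const (a + b)) = (fps_const (fps_const a) + fps_const (fps_const b))"
    by simp
  then show "fps_const (fps_const (a + b)) * x = fps_const (fps_const a) * x + fps_const (fps_const b) * x"
    by (simp only: distrib_right)
  have "fps_const (fps_const (a * b)) = (fps_const (fps_const a) * fps_const (fps_const b))"
    by simp
  then show "fps_const (fps_const a) * (fps_const (fps_const b) * x) = fps_const (fps_const (a * b)) * x"
    by (simp only: mult.assoc)
qed (simp_all add: distrib_left)

lemma quotient_space_fps_poly:
  "quotient_space (\<lambda>c F :: 'a::field fps poly. smult (fps_const c) F)"
proof
  fix a b :: 'a and x y :: "'a fps poly"
  have "fps_const (a + b) = fps_const a + fps_const b" by simp
  then show "smult (fps_const (a + b)) x = smult (fps_const a) x + smult (fps_const b) x"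
    by (simp only: smult_add_left)
qed (simp_all add: smult_add_right)

interpretation fps2: quotient_space "\<lambda>c F :: 'a::field fps fps. fps_const (fps_const c) * F"
  by (rule quotient_space_fps_fps)

interpretation fpsp: quotient_space "\<lambda>c F :: 'a::field fps poly. smult (fps_const c) F"
  by (rule quotient_space_fps_poly)

text \<open>Passes from numbered families to the finite sets of \<open>quotient_dim\<close>. Every
  basis set can be enumerated, so uniqueness of the codimension determines the
  \<open>THE\<close>.\<close>

lemma quotient_dim_eqI:
  assumes W: "fps2.subspace W" and d: "fps2.has_codim W d"
  shows "quotient_dim W = enat d"
proof -
  obtain b where b: "fps2.spans_modulo W d b" "fps2.independent_modulo W d b"
    using d unfolding fps2.has_codim_def by auto
  have inj: "inj_on b {..<d}"
  proof (rule inj_onI, rule ccontr)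
    fix i j assume ij: "i \<in> {..<d}" "j \<in> {..<d}" "b i = b j" "i \<noteq> j"
    \<comment> \<open>A repetition in the family would give the nontrivial relation
      \<open>b i - b j = 0\<close>.\<close>
    define c :: "nat \<Rightarrow> 'a" where "c = (\<lambda>k. if k = i then 1 else if k = j then -1 else 0)"
    have "(\<Sum>k<d. fps_const (fps_const (c k)) * b k) = (\<Sum>k\<in>{i,j}. fps_const (fps_const (c k)) * b k)"
      using ij by (intro sum.mono_neutral_right) (auto simp: c_def)
    also have "\<dots> = 0" using ij by (simp add: c_def)
    finally have "(\<Sum>k<d. fps_const (fps_const (c k)) * b k) \<in> W"
      using fps2.subspace_0[OF W] by simp
    then have "c i = 0" using b(2) ij unfolding fps2.independent_modulo_def by blast
    then show False by (simp add: c_def)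
  qed
  have lin: "K_lincomb (b ` {..<d}) c = (\<Sum>i<d. fps_const (fps_const (c (b i))) * b i)" for c
    unfolding K_lincomb_def using inj by (subst sum.reindex) auto
  have qb: "quotient_basis W (b ` {..<d})"
    unfolding quotient_basis_def lin
  proof (intro conjI allI impI)
    fix F
    obtain c where c: "F - (\<Sum>i<d. fps_const (fps_const (c i)) * b i) \<in> W"
      using b(1) unfolding fps2.spans_modulo_def by blast
    have "(\<Sum>i<d. fps_const (fps_const ((c \<circ> inv_into {..<d} b) (b i))) * b i)
      = (\<Sum>i<d. fps_const (fps_const (c i)) * b i)"
      by (rule sum.cong) (auto simp: inv_into_f_f[OF inj])
    then show "\<exists>c. F - (\<Sum>i<d. fps_const (fps_const (c (b i))) * b i) \<in> W"
      using c by (intro exI[of _ "c \<circ> inv_into {..<d} b"]) simp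
  next
    fix c assume "(\<Sum>i<d. fps_const (fps_const (c (b i))) * b i) \<in> W"
    then show "\<forall>v\<in>b ` {..<d}. c v = 0"
      using b(2) unfolding fps2.independent_modulo_def by (auto dest: spec[of _ "\<lambda>i. c (b i)"])
  qed simp
  have "card B = d" if B: "quotient_basis W B" for B
  proof -
    have fin: "finite B" using B by (simp add: quotient_basis_def)
    then obtain h where h: "bij_betw h {..<card B} B"
      using ex_bij_betw_nat_finite[of B] by (auto simp: atLeast0LessThan)
    have lin': "K_lincomb B c = (\<Sum>i<card B. fps_const (fps_const (c (h i))) * h i)" for c
      unfolding K_lincomb_def by (rule sum.reindex_bij_betw[OF h, symmetric])
    have "fps2.spans_modulo W (card B) h"
      unfolding fps2.spans_modulo_def
    proof
      fix F
      obtain c where "F - K_lincomb B c \<in> W" using B unfolding quotient_basis_def by blast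
      then show "\<exists>c. F - (\<Sum>i<card B. fps_const (fps_const (c i)) * h i) \<in> W"
        unfolding lin' by (intro exI)
    qed
    moreover have "fps2.independent_modulo W (card B) h"
      unfolding fps2.independent_modulo_def
    proof (intro allI impI)
      fix c i assume c: "(\<Sum>i<card B. fps_const (fps_const (c i)) * h i) \<in> W" "i < card B"
      let ?c = "c \<circ> inv_into {..<card B} h"
      have e: "?c (h i) = c i" if "i < card B" for i
        using h that by (auto simp: bij_betw_def)
      have "K_lincomb B ?c = (\<Sum>i<card B. fps_const (fps_const (c i)) * h i)"
        unfolding lin' by (rule sum.cong) (use e in auto)
      then have "K_lincomb B ?c \<in> W" using c by simp
      then have "\<forall>b\<in>B. ?c b = 0" using B unfolding quotient_basis_def by blast
      moreover have "h i \<in> B" using h c by (auto simp: bij_betw_def)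
      ultimately show "c i = 0" using e[OF c(2)] by auto
    qed
    ultimately have "fps2.has_codim W (card B)" unfolding fps2.has_codim_def by blast
    then show ?thesis using fps2.has_codim_unique[OF W d] by simp
  qed
  then have "(THE n. \<exists>B. quotient_basis W B \<and> card B = n) = d"
    using qb by (intro the_equality) auto
  then show ?thesis unfolding quotient_dim_def using qb by auto
qed

section \<open>Laurent series sorted by exponents modulo q\<close>

lemma fps_to_fls_hom: "comm_ring_hom_map (fps_to_fls :: 'a::idom fps \<Rightarrow> 'a fls)"
  by unfold_locales (simp_all add: fls_times_fps_to_fls)

text \<open>The coordinate of \<open>h\<close> at \<open>t^r\<close> for the basis
  \<open>1, t, ..., t^(q-1)\<close> of K((t)) over K((t^q)).\<close>

definition fls_part :: "nat \<Rightarrow> nat \<Rightarrow> 'a::zero fls \<Rightarrow> 'a fls" where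
  "fls_part q r h = Abs_fls (\<lambda>n. h $$ (int q * n + int r))"

lemma fls_part_nth:
  assumes "0 < q"
  shows "fls_part q r h $$ n = h $$ (int q * n + int r)"
proof -
  \<comment> \<open>\<open>Abs_fls\<close> needs a bound below which all coefficients vanish. Since
    \<open>q * k \<le> k\<close> for negative \<open>k\<close>, this crude bound serves every
    \<open>q\<close>.\<close>
  have "h $$ (int q * k + int r) = 0" if "k < - \<bar>fls_subdegree h\<bar> - int r" for k
  proof (rule fls_eq0_below_subdegree)
    have "int q * k \<le> k" using that assms mult_right_mono_neg[of 1 "int q" k] by simp
    then show "int q * k + int r < fls_subdegree h" using that by linarith
  qed
  then show ?thesis
    unfolding fls_part_def by (intro nth_Abs_fls_lower_bound[where N = "- \<bar>fls_subdegree h\<bar> - int r"]) auto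
qed

lemma fls_part_0 [simp]: "0 < q \<Longrightarrow> fls_part q r 0 = 0"
  by (rule fls_eqI) (simp add: fls_part_nth)

lemma fls_part_sum: "0 < q \<Longrightarrow> fls_part q r (sum g A) = (\<Sum>x\<in>A. fls_part q r (g x))"
  for g :: "'b \<Rightarrow> 'a::comm_ring_1 fls"
  by (rule fls_eqI) (simp add: fls_part_nth fls_nth_sum)

lemma fls_X_power_mult_nth: "(fls_X ^ r * h) $$ n = h $$ (n - int r)"
  for h :: "'a::comm_ring_1 fls"
  by (simp add: fls_X_power_times_conv_shift)

lemma fls_part_monomial_mult:
  fixes h :: "'a::idom fls"
  assumes "r < q" "r' < q"
  shows "fls_part q r (fls_X ^ r' * fls_compose_power h q) = (if r = r' then h else 0)"
proof (rule fls_eqI)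
  fix n
  have q: "0 < q" using assms by simp
  show "fls_part q r (fls_X ^ r' * fls_compose_power h q) $$ n = (if r = r' then h else 0) $$ n"
  proof (cases "r = r'")
    case True
    then show ?thesis using q by (simp add: fls_part_nth fls_X_power_mult_nth fls_nth_compose_power)
  next
    case False
    have "\<not> int q dvd int q * n + int r - int r'"
    proof
      assume "int q dvd int q * n + int r - int r'"
      then have "int q dvd int r - int r'"
        by (metis add_diff_eq dvd_add_right_iff dvd_triv_left)
      then have "int r mod int q = int r' mod int q" by (simp add: mod_eq_dvd_iff)
      then show False using assms False by simp
    qed
    then show ?thesis using q False by (simp add: fls_part_nth fls_X_power_mult_nth fls_nth_compose_power)
  qed
qed

lemma fls_decompose:
  fixes h :: "'a::idom fls"
  assumes q: "0 < q"
  shows "h = (\<Sum>r<q. fls_X ^ r * fls_compose_power (fls_part q r h) q)"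
proof (rule fls_eqI)
  fix n :: int
  define r0 where "r0 = nat (n mod int q)"
  have r0: "r0 < q" "int r0 = n mod int q" using q by (auto simp: r0_def nat_less_iff)
  have "(\<Sum>r<q. fls_X ^ r * fls_compose_power (fls_part q r h) q) $$ n = (\<Sum>r<q. if r = r0 then h $$ n else 0)"
    unfolding fls_nth_sum
  proof (rule sum.cong)
    fix r assume "r \<in> {..<q}"
    then have r: "r < q" by simp
    show "(fls_X ^ r * fls_compose_power (fls_part q r h) q) $$ n = (if r = r0 then h $$ n else 0)"
    proof (cases "r = r0")
      case True
      then have "n - int r = int q * (n div int q)" using r0 by (simp add: minus_mod_eq_mult_div)
      then have "int q dvd n - int r" "(n - int r) div int q = n div int q" using q by simp_all
      moreover have "int q * (n div int q) + int r = n" using True r0 by simp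
      ultimately show ?thesis using True q
        by (simp add: fls_X_power_mult_nth fls_nth_compose_power fls_part_nth)
    next
      case False
      have "\<not> int q dvd n - int r"
      proof
        assume "int q dvd n - int r"
        then have "n mod int q = int r mod int q" by (simp add: mod_eq_dvd_iff)
        then show False using r r0 False by simp
      qed
      then show ?thesis using False q by (simp add: fls_X_power_mult_nth fls_nth_compose_power)
    qed
  qed simp
  then show "h $$ n = (\<Sum>r<q. fls_X ^ r * fls_compose_power (fls_part q r h) q) $$ n"
    using r0 by simp
qed

text \<open>Multiplication by an element of K((x)) acts on each term of \<open>fls_decompose\<close>
  separately, so the coordinates are K((x))-linear.\<close>

lemma fls_part_compose_power_mult:
  fixes g h :: "'a::idom fls"
  assumes r: "r < q"
  shows "fls_part q r (fls_compose_power g q * h) = g * fls_part q r h"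
proof -
  have q: "0 < q" using r by simp
  have "fls_compose_power g q * h
      = (\<Sum>r'<q. fls_X ^ r' * fls_compose_power (g * fls_part q r' h) q)"
    by (subst fls_decompose[OF q, of h]) (simp add: sum_distrib_left mult_ac)
  then have "fls_part q r (fls_compose_power g q * h)
      = (\<Sum>r'<q. fls_part q r (fls_X ^ r' * fls_compose_power (g * fls_part q r' h) q))"
    using fls_part_sum[OF q] by (simp only:)
  also have "\<dots> = (\<Sum>r'<q. if r = r' then g * fls_part q r' h else 0)"
    using r by (intro sum.cong fls_part_monomial_mult) auto
  finally show ?thesis using r by simp
qed

text \<open>Over an arbitrary commutative ring, since the same two generators are studied in
  K[[x]][y] and in K[[x]][[y]].\<close>

definition ideal2 :: "'a::comm_ring_1 \<Rightarrow> 'a \<Rightarrow> 'a set" where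
  "ideal2 G H = {A * G + B * H | A B. True}"

lemma ideal2I: "A * G + B * H \<in> ideal2 G H"
  by (auto simp: ideal2_def)

lemma ideal2_add: "x \<in> ideal2 G H \<Longrightarrow> y \<in> ideal2 G H \<Longrightarrow> x + y \<in> ideal2 G H"
proof -
  assume "x \<in> ideal2 G H" "y \<in> ideal2 G H"
  then obtain A B A' B' where "x = A * G + B * H" "y = A' * G + B' * H" by (auto simp: ideal2_def)
  then have "x + y = (A + A') * G + (B + B') * H" by (simp add: algebra_simps)
  then show ?thesis using ideal2I by metis
qed

lemma ideal2_mult: "x \<in> ideal2 G H \<Longrightarrow> c * x \<in> ideal2 G H"
proof -
  assume "x \<in> ideal2 G H"
  then obtain A B where "x = A * G + B * H" by (auto simp: ideal2_def)
  then have "c * x = (c * A) * G + (c * B) * H" by (simp add: algebra_simps)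
  then show ?thesis using ideal2I by metis
qed

lemma ideal2_0: "0 \<in> ideal2 G H"
  using ideal2I[of 0 G 0 H] by simp

lemma ideal2_unit_mult: "c * d = 1 \<Longrightarrow> ideal2 G (c * H) = ideal2 G H"
proof (intro equalityI subsetI)
  assume cd: "c * d = 1"
  fix x assume "x \<in> ideal2 G H"
  then obtain A B where "x = A * G + B * H" by (auto simp: ideal2_def)
  moreover have "B * H = (B * d) * (c * H)"
    using cd by (metis mult.assoc mult.commute mult.right_neutral)
  ultimately show "x \<in> ideal2 G (c * H)" using ideal2I by metis
next
  fix x assume "x \<in> ideal2 G (c * H)"
  then obtain A B where "x = A * G + B * (c * H)" by (auto simp: ideal2_def)
  moreover have "B * (c * H) = (B * c) * H" by (simp only: mult.assoc)
  ultimately show "x \<in> ideal2 G H" using ideal2I by metis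
qed

lemma subspace_ideal2_fps2: "fps2.subspace (ideal2 G H)"
  unfolding fps2.subspace_def using ideal2_0 ideal2_add ideal2_mult by blast

lemma subspace_ideal2_fpsp: "fpsp.subspace (ideal2 G H)"
  unfolding fpsp.subspace_def
proof (intro conjI ballI allI ideal2_0 ideal2_add)
  fix c and x assume "x \<in> ideal2 G H"
  then have "[:fps_const c:] * x \<in> ideal2 G H" by (rule ideal2_mult)
  then show "smult (fps_const c) x \<in> ideal2 G H" by simp
qed

section \<open>Weierstrass division\<close>

text \<open>Congruence modulo \<open>x^k\<close>: the inner series is the one in \<open>x\<close>,
  and the power \<open>j\<close> of \<open>y\<close> is unrestricted.\<close>

definition agree_upto :: "nat \<Rightarrow> 'a::comm_ring_1 fps fps \<Rightarrow> 'a fps fps \<Rightarrow> bool" where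
  "agree_upto k F G \<longleftrightarrow> (\<forall>j. \<forall>i<k. F $ j $ i = G $ j $ i)"

lemma agree_upto_antisym: "(\<And>k. agree_upto k F G) \<Longrightarrow> F = G"
  unfolding agree_upto_def by (intro fps_ext) (meson lessI)

lemma contraction_unique:
  assumes "\<And>k F G. agree_upto k F G \<Longrightarrow> agree_upto (Suc k) (\<Phi> F) (\<Phi> G)"
    and "\<Phi> F = F" "\<Phi> G = G"
  shows "F = G"
proof (rule agree_upto_antisym)
  show "agree_upto k F G" for k
  proof (induction k)
    case (Suc k)
    then show ?case using assms(1)[OF Suc] assms(2,3) by simp
  qed (simp add: agree_upto_def)
qed

text \<open>Fixed point theorem for the \<open>x\<close>-adic topology: the iterates of 0 are
  constant modulo \<open>x^k\<close> from the \<open>k\<close>-th on, and the limit collects the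
  stable coefficients.\<close>

lemma contraction_fixpoint:
  assumes contr: "\<And>k F G. agree_upto k F G \<Longrightarrow> agree_upto (Suc k) (\<Phi> F) (\<Phi> G)"
  shows "\<exists>F. \<Phi> F = F"
proof -
  define A where "A k = (\<Phi> ^^ k) 0" for k
  have A_Suc: "A (Suc k) = \<Phi> (A k)" for k by (simp add: A_def)
  have step: "agree_upto k (A (Suc k)) (A k)" for k
  proof (induction k)
    case (Suc k)
    then show ?case using contr unfolding A_Suc by blast
  qed (simp add: agree_upto_def)
  have A: "agree_upto k (A (k + m)) (A k)" for k m
  proof (induction m)
    case (Suc m)
    then show ?case using step[of "k + m"] by (auto simp: agree_upto_def)
  qed (simp add: agree_upto_def)
  \<comment> \<open>\<open>agree_upto k\<close> concerns exponents below \<open>k\<close>, so the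
    coefficient of \<open>x^i\<close> is settled only at the iterate \<open>Suc i\<close>.\<close>
  define F where "F = Abs_fps (\<lambda>j. Abs_fps (\<lambda>i. A (Suc i) $ j $ i))"
  have F: "agree_upto k F (A k)" for k
    unfolding agree_upto_def
  proof (intro allI impI)
    fix j i assume "i < k"
    then have "agree_upto (Suc i) (A k) (A (Suc i))" using A[of "Suc i" "k - Suc i"] by simp
    then show "F $ j $ i = A k $ j $ i" by (simp add: F_def agree_upto_def)
  qed
  have "agree_upto k (\<Phi> F) F" for k
  proof (cases k)
    case (Suc l)
    have "agree_upto (Suc l) (\<Phi> F) (A (Suc l))" using contr[OF F[of l]] by (simp add: A_Suc)
    then show ?thesis using F[of k] Suc by (simp add: agree_upto_def)
  qed (simp add: agree_upto_def)
  then show ?thesis using agree_upto_antisym by blast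
qed

text \<open>The series \<open>h\<close> is divisible by \<open>x\<close>, so multiplying by it gains
  one power of \<open>x\<close>, and the shift acts on \<open>y\<close> alone.\<close>

lemma Weierstrass_contraction:
  fixes h :: "'a::field fps fps"
  assumes h: "\<And>j. h $ j $ 0 = 0" and "agree_upto k F G"
  shows "agree_upto (Suc k) (fps_shift n (A - F * h)) (fps_shift n (A - G * h))"
  unfolding agree_upto_def
proof (intro allI impI)
  fix j i assume i: "i < Suc k"
  have "F $ l $ m * h $ (j + n - l) $ (i - m) = G $ l $ m * h $ (j + n - l) $ (i - m)"
    if "m \<le> i" for l m
  proof (cases "m < k")
    case True
    then show ?thesis using assms(2) by (simp add: agree_upto_def)
  next
    case False
    then have "i - m = 0" using i by simp
    then show ?thesis using h by simp
  qed
  then show "fps_shift n (A - F * h) $ j $ i = fps_shift n (A - G * h) $ j $ i"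
    unfolding fps_shift_nth fps_sub_nth fps_mult_nth fps_sum_nth
    by (intro arg_cong2[where f = minus] refl sum.cong) auto
qed

text \<open>A Weierstrass polynomial: monic in \<open>y\<close>, and equal to \<open>y^n\<close>
  modulo \<open>x\<close>. Hence its \<open>tail\<close> is divisible by \<open>x\<close>.\<close>

locale distinguished =
  fixes H :: "'a::field fps poly" and n
  assumes degree: "degree H = n" and monic: "lead_coeff H = 1"
    and low: "i < n \<Longrightarrow> coeff H i $ 0 = 0"
begin

definition tail :: "'a fps fps" where "tail = fps_of_poly H - fps_X ^ n"

lemma tail_nth: "tail $ j $ 0 = 0"
  using degree monic low[of j] coeff_eq_0[of H j]
  by (cases j n rule: linorder_cases) (auto simp: tail_def)

text \<open>Turns division into a fixed point problem: \<open>F - Q * H\<close> has degree below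
  \<open>n\<close> in \<open>y\<close> exactly when its shift by \<open>n\<close> vanishes, that is,
  when \<open>Q\<close> equals \<open>fps_shift n (F - Q * tail)\<close>.\<close>

lemma shift_eq: "fps_shift n (F - Q * fps_of_poly H) = fps_shift n (F - Q * tail) - Q"
proof -
  have "F - Q * fps_of_poly H = (F - Q * tail) - Q * fps_X ^ n"
    by (simp add: tail_def algebra_simps)
  then show ?thesis by (simp only: fps_shift_diff fps_shift_times_fps_X_power')
qed

text \<open>The quotient is the fixed point of the contraction; the vanishing shift then leaves only
  powers of \<open>y\<close> below \<open>n\<close> in the remainder.\<close>

lemma division: "\<exists>Q r. F = Q * fps_of_poly H + fps_of_poly r"
proof -
  obtain Q where Q: "fps_shift n (F - Q * tail) = Q"
    using contraction_fixpoint[of "\<lambda>Q. fps_shift n (F - Q * tail)"]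
      Weierstrass_contraction[OF tail_nth] by blast
  define R where "R = F - Q * fps_of_poly H"
  have "fps_shift n R = 0" unfolding R_def shift_eq Q by simp
  then have R: "R $ j = 0" if "n \<le> j" for j
    using that by (metis fps_shift_nth fps_zero_nth le_add_diff_inverse2)
  have "R = fps_of_poly (\<Sum>j<n. monom (R $ j) j)"
    by (rule fps_ext) (use R in \<open>auto simp: coeff_sum not_less\<close>)
  then have "F = Q * fps_of_poly H + fps_of_poly (\<Sum>j<n. monom (R $ j) j)"
    by (simp add: R_def algebra_simps)
  then show ?thesis by blast
qed

text \<open>Both \<open>S\<close> and 0 are fixed points of the contraction for dividend 0, because
  \<open>r\<close> has no terms from \<open>y^n\<close> on.\<close>

lemma unique:
  assumes "S * fps_of_poly H = fps_of_poly r" and "\<And>j. n \<le> j \<Longrightarrow> coeff r j = 0"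
  shows "S = 0"
proof (rule contraction_unique[of "\<lambda>Q. fps_shift n (0 - Q * tail)"])
  have "fps_shift n (S * fps_of_poly H) = 0"
    using assms by (intro fps_ext) simp
  then show "fps_shift n (0 - S * tail) = S"
    using shift_eq[of 0 S] by (simp add: fps_shift_uminus)
  show "agree_upto (Suc k) (fps_shift n (0 - F * tail)) (fps_shift n (0 - G * tail))"
    if "agree_upto k F G" for k F G
    by (rule Weierstrass_contraction[OF tail_nth that])
qed simp

text \<open>Pseudo-division is available over any domain, and for a monic divisor its scaling factor
  is 1.\<close>

lemma poly_division: "\<exists>T r. P = T * H + r \<and> (\<forall>j\<ge>n. coeff r j = 0)"
proof -
  obtain T r where Tr: "pseudo_divmod P H = (T, r)" by fastforce
  have "H \<noteq> 0" using monic by auto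
  from pseudo_divmod[OF this Tr] have "P = T * H + r" "r = 0 \<or> degree r < n"
    using monic degree by (auto simp: mult.commute)
  moreover have "\<forall>j\<ge>n. coeff r j = 0"
    using \<open>r = 0 \<or> degree r < n\<close> by (auto intro: coeff_eq_0)
  ultimately show ?thesis by blast
qed

text \<open>The remainder of polynomial division is a power series multiple of \<open>H\<close> of
  degree below \<open>n\<close>, so uniqueness makes the two quotients equal.\<close>

lemma fps_dvd_imp_poly_dvd:
  assumes "fps_of_poly P = S * fps_of_poly H"
  shows "\<exists>T. P = T * H"
proof -
  obtain T r where Tr: "P = T * H + r" "\<forall>j\<ge>n. coeff r j = 0" using poly_division by blast
  have "(S - fps_of_poly T) * fps_of_poly H = fps_of_poly r"
    using assms Tr(1) by (simp add: fps_of_poly_add fps_of_poly_mult algebra_simps)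
  then have "S - fps_of_poly T = 0" by (rule unique) (use Tr in auto)
  then show ?thesis using assms by (auto simp: fps_of_poly_eq_iff simp flip: fps_of_poly_mult)
qed

text \<open>The same representatives form a basis in both rings: division makes every series a
  polynomial modulo \<open>H\<close>, and descent of divisibility shows that the larger ideal
  contains no further polynomials.\<close>

lemma has_codim_fps_of_poly:
  assumes "fpsp.has_codim (ideal2 G H) d"
  shows "fps2.has_codim (ideal2 (fps_of_poly G) (fps_of_poly H)) d"
proof -
  let ?W = "ideal2 (fps_of_poly G) (fps_of_poly H)"
  obtain b where b: "fpsp.spans_modulo (ideal2 G H) d b" "fpsp.independent_modulo (ideal2 G H) d b"
    using assms unfolding fpsp.has_codim_def by auto
  have sum: "(\<Sum>i<d. fps_const (fps_const (c i)) * fps_of_poly (b i))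
      = fps_of_poly (\<Sum>i<d. smult (fps_const (c i)) (b i))" for c
    by (simp add: fps_of_poly_sum fps_of_poly_smult)
  have "fps2.spans_modulo ?W d (fps_of_poly \<circ> b)"
    unfolding fps2.spans_modulo_def
  proof
    fix F
    obtain Q r where F: "F = Q * fps_of_poly H + fps_of_poly r" using division by blast
    obtain c where "r - (\<Sum>i<d. smult (fps_const (c i)) (b i)) \<in> ideal2 G H"
      using b unfolding fpsp.spans_modulo_def by blast
    then obtain A B where AB: "r - (\<Sum>i<d. smult (fps_const (c i)) (b i)) = A * G + B * H"
      by (auto simp: ideal2_def)
    have "F - fps_of_poly (\<Sum>i<d. smult (fps_const (c i)) (b i))
      = Q * fps_of_poly H + fps_of_poly (r - (\<Sum>i<d. smult (fps_const (c i)) (b i)))"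
      by (simp add: F fps_of_poly_diff)
    also have "\<dots> = fps_of_poly A * fps_of_poly G + (Q + fps_of_poly B) * fps_of_poly H"
      unfolding AB by (simp add: fps_of_poly_add fps_of_poly_mult algebra_simps)
    finally have "F - (\<Sum>i<d. fps_const (fps_const (c i)) * (fps_of_poly \<circ> b) i) \<in> ?W"
      unfolding o_def sum using ideal2I by metis
    then show "\<exists>c. F - (\<Sum>i<d. fps_const (fps_const (c i)) * (fps_of_poly \<circ> b) i) \<in> ?W" by blast
  qed
  moreover have "fps2.independent_modulo ?W d (fps_of_poly \<circ> b)"
    unfolding fps2.independent_modulo_def o_def sum
  proof (intro allI impI)
    fix c i
    let ?P = "\<Sum>i<d. smult (fps_const (c i)) (b i)"
    assume P: "fps_of_poly ?P \<in> ?W" and i: "i < d"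
    obtain A B where AB: "fps_of_poly ?P = A * fps_of_poly G + B * fps_of_poly H"
      using P by (auto simp: ideal2_def)
    \<comment> \<open>Reducing the coefficient of \<open>G\<close> modulo \<open>H\<close> makes it
      a polynomial; what remains is then a polynomial divisible by \<open>H\<close> among the power
      series.\<close>
    obtain Q a where A: "A = Q * fps_of_poly H + fps_of_poly a" using division by blast
    have "fps_of_poly (?P - a * G) = (Q * fps_of_poly G + B) * fps_of_poly H"
      unfolding fps_of_poly_diff fps_of_poly_mult AB A by (simp add: algebra_simps)
    then obtain T where "?P - a * G = T * H" using fps_dvd_imp_poly_dvd by blast
    then have "?P = a * G + T * H" by (simp add: algebra_simps)
    then have "?P \<in> ideal2 G H" using ideal2I by metis
    then show "c i = 0" using b i unfolding fpsp.independent_modulo_def by blast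
  qed
  ultimately show ?thesis unfolding fps2.has_codim_def by blast
qed

end

section \<open>Codimension when the second generator is a product of linear factors\<close>

text \<open>Evaluation at \<open>y = \<beta>\<close> identifies the quotient with K[[x]] modulo
  \<open>poly G \<beta>\<close>, for which the powers of \<open>x\<close> below the order of that
  series form a basis.\<close>

lemma has_codim_linear:
  fixes G :: "'a::field fps poly"
  assumes "poly G \<beta> \<noteq> 0"
  shows "fpsp.has_codim (ideal2 G [:- \<beta>, 1:]) (subdegree (poly G \<beta>))"
proof -
  let ?e = "poly G \<beta>" let ?m = "subdegree ?e" let ?W = "ideal2 G [:- \<beta>, 1:]"
  let ?b = "\<lambda>i. [:fps_X ^ i:] :: 'a fps poly"
  have W: "F \<in> ?W \<longleftrightarrow> ?e dvd poly F \<beta>" for F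
  proof
    assume "F \<in> ?W"
    then obtain A B where "F = A * G + B * [:- \<beta>, 1:]" unfolding ideal2_def by blast
    then have "poly F \<beta> = poly A \<beta> * ?e" by (simp only: poly_add poly_mult) simp
    then show "?e dvd poly F \<beta>" by (rule dvdI[OF trans[OF _ mult.commute]])
  next
    assume "?e dvd poly F \<beta>"
    then obtain u where "poly F \<beta> = ?e * u" by (elim dvdE)
    then have "poly (F - [:u:] * G) \<beta> = 0" by (simp only: poly_diff poly_mult) simp
    then obtain B where "F - [:u:] * G = [:- \<beta>, 1:] * B"
      unfolding poly_eq_0_iff_dvd by (elim dvdE)
    then have "F = [:u:] * G + B * [:- \<beta>, 1:]"
      by (simp only: diff_eq_eq mult.commute[of B] add.commute)
    then show "F \<in> ?W" using ideal2I by metis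
  qed
  have ev: "poly (\<Sum>i<?m. smult (fps_const (c i)) (?b i)) \<beta> $ k = (if k < ?m then c k else 0)" for c k
  proof -
    have "poly (\<Sum>i<?m. smult (fps_const (c i)) (?b i)) \<beta> $ k = (\<Sum>i<?m. if i = k then c k else 0)"
      unfolding poly_sum fps_sum_nth by (rule sum.cong) auto
    then show ?thesis by simp
  qed
  have dvd: "?e dvd x \<longleftrightarrow> (\<forall>k<?m. x $ k = 0)" for x
  proof (cases "x = 0")
    case False
    then have "?e dvd x \<longleftrightarrow> ?m \<le> subdegree x" using assms by (simp add: fps_dvd_iff)
    also have "\<dots> \<longleftrightarrow> (\<forall>k<?m. x $ k = 0)"
      using False by (auto intro: subdegree_geI nth_less_subdegree_zero)
    finally show ?thesis .
  qed simp
  have "fpsp.spans_modulo ?W ?m ?b"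
    unfolding fpsp.spans_modulo_def W dvd
  proof
    fix v
    show "\<exists>c. \<forall>k<?m. poly (v - (\<Sum>i<?m. smult (fps_const (c i)) (?b i))) \<beta> $ k = 0"
      by (rule exI[of _ "\<lambda>i. poly v \<beta> $ i"]) (unfold poly_diff fps_sub_nth ev, simp)
  qed
  moreover have "fpsp.independent_modulo ?W ?m ?b"
    unfolding fpsp.independent_modulo_def W dvd ev by auto
  ultimately show ?thesis unfolding fpsp.has_codim_def by blast
qed

text \<open>Multiplication by \<open>y - \<beta>\<close> gives an exact sequence with the quotient
  by the remaining factors on the left and that by \<open>y - \<beta>\<close> on the right, so the
  orders add up.\<close>

lemma has_codim_linear_factors:
  fixes G :: "'a::field fps poly"
  assumes "\<And>\<beta>. \<beta> \<in> set bs \<Longrightarrow> poly G \<beta> \<noteq> 0"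
  shows "fpsp.has_codim (ideal2 G (\<Prod>\<beta>\<leftarrow>bs. [:- \<beta>, 1:])) (\<Sum>\<beta>\<leftarrow>bs. subdegree (poly G \<beta>))"
  using assms
proof (induction bs)
  case Nil
  have "x \<in> ideal2 G 1" for x using ideal2I[of 0 G x 1] by simp
  then have "ideal2 G 1 = UNIV" by auto
  then show ?case using fpsp.has_codim_UNIV by simp
next
  case (Cons \<beta> bs)
  let ?H1 = "\<Prod>\<beta>\<leftarrow>bs. [:- \<beta>, 1:]" let ?H2 = "[:- \<beta>, 1:]"
  have "fpsp.has_codim (ideal2 G (?H2 * ?H1))
      (subdegree (poly G \<beta>) + (\<Sum>\<beta>\<leftarrow>bs. subdegree (poly G \<beta>)))"
  proof (rule fpsp.has_codim_exact[where m = "\<lambda>u. ?H2 * u" and ?W1.0 = "ideal2 G ?H1" and ?W2.0 = "ideal2 G ?H2"])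
    show "module_hom (\<lambda>c. smult (fps_const c)) (\<lambda>c. smult (fps_const c)) (\<lambda>u. ?H2 * u)"
      by (intro module_hom.intro module_hom_axioms.intro fpsp.module_axioms)
        (simp_all only: distrib_left mult_smult_right)
    show "ideal2 G (?H2 * ?H1) \<subseteq> ideal2 G ?H2"
    proof
      fix x assume "x \<in> ideal2 G (?H2 * ?H1)"
      then obtain A B where "x = A * G + B * (?H2 * ?H1)" unfolding ideal2_def by blast
      then have "x = A * G + (B * ?H1) * ?H2" by (simp only: mult_ac)
      then show "x \<in> ideal2 G ?H2" using ideal2I by metis
    qed
    show "range (\<lambda>u. ?H2 * u) \<subseteq> ideal2 G ?H2"
    proof
      fix x assume "x \<in> range (\<lambda>u. ?H2 * u)"
      then obtain u where "x = ?H2 * u" by blast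
      then have "x = 0 * G + u * ?H2" by (simp only: mult_zero_left add_0_left mult.commute[of u])
      then show "x \<in> ideal2 G ?H2" using ideal2I by metis
    qed
    show "?H2 * v \<in> ideal2 G (?H2 * ?H1) \<longleftrightarrow> v \<in> ideal2 G ?H1" for v
    proof
      assume "?H2 * v \<in> ideal2 G (?H2 * ?H1)"
      then obtain A B where AB: "?H2 * v = A * G + B * (?H2 * ?H1)" unfolding ideal2_def by blast
      then have "poly (?H2 * v) \<beta> = poly (A * G + B * (?H2 * ?H1)) \<beta>" by (simp only:)
      \<comment> \<open>Injectivity of the first map: \<open>G\<close> does not vanish at \<beta>,
        so evaluation there forces \<open>y - \<beta>\<close> to divide \<open>A\<close>, and the
        factor can be cancelled.\<close>
      then have "poly A \<beta> = 0" using Cons.prems[of \<beta>] by simp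
      then obtain A' where A': "A = ?H2 * A'" unfolding poly_eq_0_iff_dvd by (elim dvdE)
      have "?H2 * v = ?H2 * (A' * G + B * ?H1)" unfolding AB A' by (simp only: algebra_simps)
      then have "v = A' * G + B * ?H1" by (subst (asm) mult_cancel_left) simp
      then show "v \<in> ideal2 G ?H1" using ideal2I by metis
    next
      assume "v \<in> ideal2 G ?H1"
      then obtain A B where "v = A * G + B * ?H1" unfolding ideal2_def by blast
      then have "?H2 * v = (?H2 * A) * G + B * (?H2 * ?H1)" by (simp only: algebra_simps)
      then show "?H2 * v \<in> ideal2 G (?H2 * ?H1)" using ideal2I by metis
    qed
    show "\<exists>u. v - ?H2 * u \<in> ideal2 G (?H2 * ?H1)" if v: "v \<in> ideal2 G ?H2" for v
    proof -
      obtain A B where "v = A * G + B * ?H2" using v unfolding ideal2_def by blast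
      then have "v - ?H2 * B = A * G + 0 * (?H2 * ?H1)"
        by (simp only: mult_zero_left add_0_right mult.commute[of B] add_diff_cancel_right')
      then show ?thesis using ideal2I by metis
    qed
  qed (use Cons has_codim_linear[of G \<beta>] subspace_ideal2_fpsp in auto)
  then show ?case by simp
qed

section \<open>Base change along \<open>x = s^N\<close>\<close>

text \<open>The power series counterpart of \<open>fls_part\<close>: coordinates of K[[s]] over
  K[[s^N]] for the basis \<open>1, s, ..., s^(N-1)\<close>.\<close>

definition residue_part :: "nat \<Rightarrow> nat \<Rightarrow> 'a::idom fps \<Rightarrow> 'a fps" where
  "residue_part N i c = Abs_fps (\<lambda>k. c $ (N * k + i))"

lemma residue_part_nth: "residue_part N i c $ k = c $ (N * k + i)"
  by (simp add: residue_part_def)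

lemma residue_part_0 [simp]: "residue_part N i 0 = 0"
  by (rule fps_ext) (simp add: residue_part_nth)

lemma residue_part_add: "residue_part N i (c + d) = residue_part N i c + residue_part N i d"
  by (rule fps_ext) (simp add: residue_part_nth)

lemma residue_part_sum: "residue_part N i (sum f A) = (\<Sum>x\<in>A. residue_part N i (f x))"
  by (rule fps_ext) (simp add: residue_part_nth fps_sum_nth)

lemma residue_part_fls:
  assumes "i < N"
  shows "fps_to_fls (residue_part N i c) = fls_part N i (fps_to_fls c)"
proof (rule fls_eqI)
  fix n
  have N: "0 < N" using assms by simp
  show "fps_to_fls (residue_part N i c) $$ n = fls_part N i (fps_to_fls c) $$ n"
  proof (cases "n < 0")
    case True
    then have "int N * n \<le> int N * (- 1)" by (intro mult_left_mono) auto
    then have "int N * n + int i < 0" using assms by simp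
    then show ?thesis using True N by (simp add: fls_part_nth)
  next
    case False
    then obtain k where k: "n = int k" by (metis nonneg_int_cases not_less)
    then have "int N * n + int i = int (N * k + i)" by simp
    then have "fls_part N i (fps_to_fls c) $$ n = fps_to_fls c $$ int (N * k + i)"
      by (simp only: fls_part_nth[OF N])
    also have "\<dots> = c $ (N * k + i)" by (simp del: of_nat_add of_nat_mult)
    finally show ?thesis by (simp add: k residue_part_nth)
  qed
qed

lemma residue_decompose:
  fixes c :: "'a::idom fps"
  assumes "0 < N"
  shows "c = (\<Sum>i<N. fps_X ^ i * pow_subst N (residue_part N i c))"
proof -
  interpret h: comm_ring_hom_map "fps_to_fls :: 'a fps \<Rightarrow> 'a fls" by (rule fps_to_fls_hom)
  have "fps_to_fls (\<Sum>i<N. fps_X ^ i * pow_subst N (residue_part N i c))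
      = (\<Sum>i<N. fls_X ^ i * fls_compose_power (fls_part N i (fps_to_fls c)) N)"
    unfolding h.hom_sum
    by (intro sum.cong) (use assms in \<open>simp_all add: h.hom_mult h.hom_power fls_compose_power_fps_to_fls
      flip: residue_part_fls\<close>)
  also have "\<dots> = fps_to_fls c" by (rule fls_decompose[OF assms, symmetric])
  finally show ?thesis by simp
qed

lemma residue_part_mult:
  assumes "i < N"
  shows "residue_part N i (a * pow_subst N g) = residue_part N i a * g"
proof -
  have "fps_to_fls (residue_part N i (a * pow_subst N g)) = fps_to_fls (residue_part N i a * g)"
    using assms fls_part_compose_power_mult[OF assms, of "fps_to_fls g" "fps_to_fls a"]
    by (simp add: residue_part_fls fls_times_fps_to_fls fls_compose_power_fps_to_fls mult.commute)
  then show ?thesis by simp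
qed

lemma residue_part_pow_subst:
  assumes "j < N" "i < N"
  shows "residue_part N i (fps_X ^ j * pow_subst N c) = (if i = j then c else 0)"
proof -
  have "residue_part N i (fps_X ^ j) = (if i = j then 1 else 0 :: 'a fps)"
  proof (rule fps_ext)
    fix k
    have "N * k + i = j \<longleftrightarrow> k = 0 \<and> i = j" using assms by (cases k) auto
    then show "residue_part N i (fps_X ^ j) $ k = (if i = j then 1 else 0 :: 'a fps) $ k"
      by (auto simp: residue_part_nth)
  qed
  then show ?thesis using assms by (subst residue_part_mult) auto
qed

abbreviation residue_poly :: "nat \<Rightarrow> nat \<Rightarrow> 'a::idom fps poly \<Rightarrow> 'a fps poly" where
  "residue_poly N i \<equiv> map_poly (residue_part N i)"

abbreviation subst_poly :: "nat \<Rightarrow> 'a::idom fps poly \<Rightarrow> 'a fps poly" where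
  "subst_poly N \<equiv> map_poly (pow_subst N)"

lemma residue_poly_add: "residue_poly N i (P + Q) = residue_poly N i P + residue_poly N i Q"
  by (intro poly_eqI) (simp add: coeff_map_poly residue_part_add)

lemma residue_poly_diff: "residue_poly N i (P - Q) = residue_poly N i P - residue_poly N i Q"
  by (metis add_diff_cancel diff_add_cancel residue_poly_add)

lemma residue_poly_sum: "residue_poly N i (sum f A) = (\<Sum>x\<in>A. residue_poly N i (f x))"
  by (intro poly_eqI) (simp add: coeff_map_poly residue_part_sum coeff_sum)

lemma residue_poly_smult_const:
  "residue_poly N i (smult (fps_const c) P) = smult (fps_const c) (residue_poly N i P)"
proof (intro poly_eqI)
  fix n
  show "coeff (residue_poly N i (smult (fps_const c) P)) n = coeff (smult (fps_const c) (residue_poly N i P)) n"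
    by (rule fps_ext) (simp add: coeff_map_poly residue_part_nth)
qed

lemma residue_poly_mult:
  "i < N \<Longrightarrow> residue_poly N i (A * subst_poly N G) = residue_poly N i A * G"
  by (intro poly_eqI) (simp add: coeff_map_poly coeff_mult residue_part_sum residue_part_mult)

lemma residue_poly_subst:
  assumes "j < N" "i < N"
  shows "residue_poly N i (smult (fps_X ^ j) (subst_poly N P)) = (if i = j then P else 0)"
  by (intro poly_eqI) (simp add: coeff_map_poly residue_part_pow_subst[OF assms])

lemma residue_poly_decompose:
  "0 < N \<Longrightarrow> P = (\<Sum>i<N. smult (fps_X ^ i) (subst_poly N (residue_poly N i P)))"
  by (intro poly_eqI) (simp add: coeff_map_poly coeff_sum flip: residue_decompose)

lemma ideal2_sum: "(\<And>x. x \<in> S \<Longrightarrow> f x \<in> ideal2 G H) \<Longrightarrow> sum f S \<in> ideal2 G H"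
  by (induction S rule: infinite_finite_induct) (auto intro: ideal2_add ideal2_0)

text \<open>K[[s]][y] is free over K[[x]][y] on the powers of \<open>s\<close> below
  \<open>N\<close>, so membership in the extended ideal can be tested on coordinates.\<close>

lemma ideal2_subst_iff:
  fixes G H :: "'a::field fps poly"
  assumes N: "0 < N"
  shows "P \<in> ideal2 (subst_poly N G) (subst_poly N H) \<longleftrightarrow> (\<forall>i<N. residue_poly N i P \<in> ideal2 G H)"
    (is "?l \<longleftrightarrow> ?r")
proof
  interpret s: comm_ring_hom_map "pow_subst N :: 'a fps \<Rightarrow> _" by (rule pow_subst_hom[OF N])
  show ?r if l: ?l
  proof (intro allI impI)
    fix i assume i: "i < N"
    obtain A B where "P = A * subst_poly N G + B * subst_poly N H"
      using l by (auto simp: ideal2_def)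
    then have "residue_poly N i P = residue_poly N i A * G + residue_poly N i B * H"
      using i by (simp add: residue_poly_add residue_poly_mult)
    then show "residue_poly N i P \<in> ideal2 G H" using ideal2I by metis
  qed
  show ?l if r: ?r
  proof (subst residue_poly_decompose[OF N, of P], intro ideal2_sum)
    fix i assume "i \<in> {..<N}"
    then obtain A B where "residue_poly N i P = A * G + B * H"
      using r by (auto simp: ideal2_def)
    then have "[:fps_X ^ i:] * subst_poly N (residue_poly N i P) \<in> ideal2 (subst_poly N G) (subst_poly N H)"
      by (intro ideal2_mult) (simp add: s.map_poly_add s.map_poly_mult ideal2I)
    then show "smult (fps_X ^ i) (subst_poly N (residue_poly N i P)) \<in> ideal2 (subst_poly N G) (subst_poly N H)"
      by simp
  qed
qed

text \<open>A basis upstairs consists of the base changes of the basis elements downstairs,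
  multiplied by \<open>1, s, ..., s^(N-1)\<close>.\<close>

lemma has_codim_subst:
  fixes G H :: "'a::field fps poly"
  assumes N: "0 < N" and d: "fpsp.has_codim (ideal2 G H) d"
  shows "fpsp.has_codim (ideal2 (subst_poly N G) (subst_poly N H)) (d * N)"
proof -
  let ?W = "ideal2 G H" let ?W' = "ideal2 (subst_poly N G) (subst_poly N H)"
  obtain b where b: "fpsp.spans_modulo ?W d b" "fpsp.independent_modulo ?W d b"
    using d unfolding fpsp.has_codim_def by auto
  \<comment> \<open>The number \<open>j\<close> encodes a pair: the basis index
    \<open>j div N\<close> and the exponent \<open>j mod N\<close> of \<open>s\<close>.\<close>
  define b' where "b' = (\<lambda>j. smult (fps_X ^ (j mod N)) (subst_poly N (b (j div N))))"
  have part: "residue_poly N i (\<Sum>j<d*N. smult (fps_const (c j)) (b' j))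
      = (\<Sum>k<d. smult (fps_const (c (k * N + i))) (b k))" if i: "i < N" for c i
  proof -
    have "residue_poly N i (\<Sum>j<d*N. smult (fps_const (c j)) (b' j))
      = (\<Sum>j<d*N. if i = j mod N then smult (fps_const (c j)) (b (j div N)) else 0)"
      unfolding residue_poly_sum residue_poly_smult_const b'_def
      using i N by (intro sum.cong refl) (simp only: residue_poly_subst mod_less_divisor if_distrib[of "smult _"] smult_0_right)
    also have "\<dots> = (\<Sum>k<d. \<Sum>j\<in>{k*N..<k*N+N}. if i = j mod N then smult (fps_const (c j)) (b (j div N)) else 0)"
      by (rule sum.nat_group[symmetric])
    also have "\<dots> = (\<Sum>k<d. smult (fps_const (c (k * N + i))) (b k))"
    proof (rule sum.cong)
      fix k
      have "(\<Sum>j\<in>{k*N..<k*N+N}. if i = j mod N then smult (fps_const (c j)) (b (j div N)) else 0)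
        = (\<Sum>j\<in>{k*N+i}. if i = j mod N then smult (fps_const (c j)) (b (j div N)) else 0)"
      proof (rule sum.mono_neutral_right)
        show "\<forall>j\<in>{k*N..<k*N+N} - {k*N+i}. (if i = j mod N then smult (fps_const (c j)) (b (j div N)) else 0) = 0"
        proof
          fix j assume j: "j \<in> {k*N..<k*N+N} - {k*N+i}"
          then obtain l where "j = k * N + l" "l < N"
            by (metis DiffD1 atLeastLessThan_iff le_Suc_ex nat_add_left_cancel_less)
          then show "(if i = j mod N then smult (fps_const (c j)) (b (j div N)) else 0) = 0"
            using j by auto
        qed
      qed (use i in auto)
      then show "(\<Sum>j\<in>{k*N..<k*N+N}. if i = j mod N then smult (fps_const (c j)) (b (j div N)) else 0)
          = smult (fps_const (c (k * N + i))) (b k)"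
        using i by simp
    qed simp
    finally show ?thesis .
  qed
  have "fpsp.spans_modulo ?W' (d * N) b'"
    unfolding fpsp.spans_modulo_def
  proof
    fix P
    obtain c where c: "residue_poly N i P - (\<Sum>k<d. smult (fps_const (c i k)) (b k)) \<in> ?W" for i
      using b unfolding fpsp.spans_modulo_def by meson
    have "P - (\<Sum>j<d*N. smult (fps_const (c (j mod N) (j div N))) (b' j)) \<in> ?W'"
      unfolding ideal2_subst_iff[OF N]
    proof (intro allI impI)
      fix i assume i: "i < N"
      have "(\<Sum>k<d. smult (fps_const (c ((k * N + i) mod N) ((k * N + i) div N))) (b k))
        = (\<Sum>k<d. smult (fps_const (c i k)) (b k))"
        using i by (intro sum.cong) auto
      then show "residue_poly N i (P - (\<Sum>j<d*N. smult (fps_const (c (j mod N) (j div N))) (b' j))) \<in> ?W"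
        unfolding residue_poly_diff part[OF i] using c[of i] by simp
    qed
    then show "\<exists>c. P - (\<Sum>j<d*N. smult (fps_const (c j)) (b' j)) \<in> ?W'"
      by (rule exI[of _ "\<lambda>j. c (j mod N) (j div N)"])
  qed
  moreover have "fpsp.independent_modulo ?W' (d * N) b'"
    unfolding fpsp.independent_modulo_def
  proof (intro allI impI)
    fix c j assume c: "(\<Sum>j<d*N. smult (fps_const (c j)) (b' j)) \<in> ?W'" and j: "j < d * N"
    have i: "j mod N < N" using N by simp
    have "(\<Sum>k<d. smult (fps_const (c (k * N + j mod N))) (b k)) \<in> ?W"
      using c i unfolding ideal2_subst_iff[OF N] part[OF i, symmetric] by blast
    then have "c ((j div N) * N + j mod N) = 0"
      using b(2)[unfolded fpsp.independent_modulo_def, rule_format, of "\<lambda>k. c (k * N + j mod N)"]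
        less_mult_imp_div_less[OF j] by blast
    then show "c j = 0" by simp
  qed
  ultimately show ?thesis unfolding fpsp.has_codim_def by blast
qed

text \<open>Finiteness downstairs is not known beforehand. An independent family stays independent
  after base change, as its coordinate at \<open>s^0\<close> shows, so the codimension upstairs
  bounds its length; multiplicativity then fixes the value.\<close>

lemma has_codim_split:
  fixes G H :: "'a::field fps poly"
  assumes N: "0 < N" and H: "subst_poly N H = (\<Prod>\<beta>\<leftarrow>bs. [:- \<beta>, 1:])"
    and G: "\<And>\<beta>. \<beta> \<in> set bs \<Longrightarrow> poly (subst_poly N G) \<beta> \<noteq> 0"
  shows "\<exists>d. fpsp.has_codim (ideal2 G H) d
    \<and> d * N = (\<Sum>\<beta>\<leftarrow>bs. subdegree (poly (subst_poly N G) \<beta>))"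
proof -
  let ?D = "\<Sum>\<beta>\<leftarrow>bs. subdegree (poly (subst_poly N G) \<beta>)"
  let ?W' = "ideal2 (subst_poly N G) (subst_poly N H)"
  have D: "fpsp.has_codim ?W' ?D"
    unfolding H using G by (rule has_codim_linear_factors)
  have "\<exists>d. fpsp.has_codim (ideal2 G H) d"
  proof (rule fpsp.has_codim_exists[OF subspace_ideal2_fpsp])
    fix m b assume b: "fpsp.independent_modulo (ideal2 G H) m b"
    have "fpsp.independent_modulo ?W' m (\<lambda>k. smult (fps_X ^ 0) (subst_poly N (b k)))"
      unfolding fpsp.independent_modulo_def
    proof (intro allI impI)
      fix c i assume c: "(\<Sum>k<m. smult (fps_const (c k)) (smult (fps_X ^ 0) (subst_poly N (b k)))) \<in> ?W'"
        and i: "i < m"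
      have "residue_poly N 0 (\<Sum>k<m. smult (fps_const (c k)) (smult (fps_X ^ 0) (subst_poly N (b k)))) \<in> ideal2 G H"
        using c N unfolding ideal2_subst_iff[OF N] by blast
      then have "(\<Sum>k<m. smult (fps_const (c k)) (b k)) \<in> ideal2 G H"
        using N by (simp only: residue_poly_sum residue_poly_smult_const residue_poly_subst simp_thms if_True)
      then show "c i = 0" using b i unfolding fpsp.independent_modulo_def by blast
    qed
    then show "m \<le> ?D"
      using D fpsp.independent_modulo_le[OF subspace_ideal2_fpsp] unfolding fpsp.has_codim_def by blast
  qed
  then obtain d where d: "fpsp.has_codim (ideal2 G H) d" by blast
  have "d * N = ?D"
    using fpsp.has_codim_unique[OF subspace_ideal2_fpsp has_codim_subst[OF N d] D] .
  with d show ?thesis by blast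
qed

section \<open>Newton-Puiseux theorem\<close>

text \<open>Reads an element of K[[x]][y] as a power series in \<open>x\<close> whose coefficients
  are polynomials in \<open>y\<close>.\<close>

abbreviation tcoeff :: "nat \<Rightarrow> 'a::zero fps poly \<Rightarrow> 'a poly" where
  "tcoeff k \<equiv> map_poly (\<lambda>c. c $ k)"

lemma coeff_tcoeff [simp]: "coeff (tcoeff k P) i = coeff P i $ k"
  by (simp add: coeff_map_poly)

lemma tcoeff_0_hom: "comm_ring_hom_map (\<lambda>c. c $ 0 :: 'a::idom)"
  by unfold_locales (simp_all add: fps_mult_nth)

lemma tcoeff_mult: "tcoeff k (P * Q) = (\<Sum>i\<le>k. tcoeff i P * tcoeff (k - i) Q)"
  for P Q :: "'a::comm_ring_1 fps poly"
proof (rule poly_eqI)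
  fix n
  have "coeff (tcoeff k (P * Q)) n = (\<Sum>j\<le>n. \<Sum>i\<le>k. coeff P j $ i * coeff Q (n - j) $ (k - i))"
    by (simp add: coeff_mult fps_sum_nth fps_mult_nth atLeast0AtMost)
  also have "\<dots> = (\<Sum>i\<le>k. \<Sum>j\<le>n. coeff P j $ i * coeff Q (n - j) $ (k - i))"
    by (rule sum.swap)
  finally show "coeff (tcoeff k (P * Q)) n = coeff (\<Sum>i\<le>k. tcoeff i P * tcoeff (k - i) Q) n"
    by (simp add: coeff_sum coeff_mult)
qed

lemma tcoeff_ext: "(\<And>k. tcoeff k P = tcoeff k Q) \<Longrightarrow> P = Q"
  by (intro poly_eqI fps_ext) (metis coeff_tcoeff)

text \<open>The common degree bound is what lets the polynomials be collected into finitely many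
  power series.\<close>

lemma exists_poly_of_tcoeffs:
  assumes "\<And>k. degree (u k) \<le> n"
  shows "\<exists>P. \<forall>k. tcoeff k P = (u k :: 'a::comm_ring_1 poly)"
proof -
  let ?P = "\<Sum>i\<le>n. monom (Abs_fps (\<lambda>k. coeff (u k) i)) i"
  have "coeff ?P j = (if j \<le> n then Abs_fps (\<lambda>k. coeff (u k) j) else 0)" for j
    by (simp add: coeff_sum)
  then have "tcoeff k ?P = u k" for k
    using assms[of k] by (intro poly_eqI) (simp add: coeff_eq_0)
  then show ?thesis by blast
qed

text \<open>Coprimality of \<open>g\<close> and a power of a linear factor, by induction on the
  exponent: \<open>u\<close> is corrected by a multiple of \<open>g\<close> until it is divisible by
  one more factor.\<close>

lemma bezout_linear_power:
  fixes g :: "'a::field poly"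
  assumes "poly g a \<noteq> 0"
  shows "\<exists>u v. E = u * [:- a, 1:] ^ m + v * g"
proof (induction m)
  case 0
  show ?case by (intro exI[of _ E] exI[of _ 0]) simp
next
  case (Suc m)
  then obtain u v where E: "E = u * [:- a, 1:] ^ m + v * g" by blast
  \<comment> \<open>Chosen so that \<open>u - c g\<close> vanishes at \<open>a\<close>.\<close>
  let ?c = "poly u a / poly g a"
  have "poly (u - smult ?c g) a = 0" using assms by simp
  then obtain w where w: "u - smult ?c g = [:- a, 1:] * w" unfolding poly_eq_0_iff_dvd by (elim dvdE)
  have "E = (u - smult ?c g) * [:- a, 1:] ^ m + (v + smult ?c ([:- a, 1:] ^ m)) * g"
    unfolding E by (simp add: algebra_simps del: mult_pCons_left mult_pCons_right)
  also have "(u - smult ?c g) * [:- a, 1:] ^ m = w * [:- a, 1:] ^ Suc m"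
    unfolding w power_Suc by (simp only: mult_ac)
  finally show ?case by blast
qed

text \<open>Reducing \<open>v\<close> modulo \<open>h\<close> bounds its degree; comparing degrees
  in the identity then bounds that of \<open>u\<close>. Such bounds keep the factors built by Hensel
  lifting polynomial and monic.\<close>

lemma bezout_degree:
  fixes g h :: "'a::field poly"
  assumes E: "E = u * h + v * g" and dE: "degree E < degree g + degree h" and h: "degree h > 0" "g \<noteq> 0"
  shows "\<exists>u v. E = u * h + v * g \<and> degree v < degree h \<and> (u = 0 \<or> degree u < degree g)"
proof -
  define v' where "v' = v mod h"
  define u' where "u' = u + (v div h) * g"
  have "h \<noteq> 0" using h by auto
  have E': "E = u' * h + v' * g"
  proof -
    have "v = (v div h) * h + v'" by (simp add: v'_def)
    then have "v * g = (v div h) * h * g + v' * g" by (metis distrib_right)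
    then show ?thesis unfolding E u'_def by (simp add: algebra_simps)
  qed
  have dv: "degree v' < degree h"
    using h degree_mod_less[OF \<open>h \<noteq> 0\<close>, of v] by (auto simp: v'_def)
  have "u' = 0 \<or> degree u' < degree g"
  proof (rule disjCI)
    assume *: "\<not> degree u' < degree g"
    show "u' = 0"
    proof (rule ccontr)
      assume "u' \<noteq> 0"
      have "degree (v' * g) < degree g + degree h"
        using dv degree_mult_le[of v' g] by simp
      moreover have "u' * h = E - v' * g" using E' by simp
      ultimately have "degree (u' * h) < degree g + degree h"
        using dE degree_diff_le_max[of E "v' * g"] by simp
      then show False using * \<open>u' \<noteq> 0\<close> \<open>h \<noteq> 0\<close> by (simp add: degree_mult_eq)
    qed
  qed
  then show ?thesis using E' dv by blast
qed

text \<open>The coefficients of \<open>x^k\<close> in the two factors, \<open>u\<close> and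
  \<open>v\<close>, must satisfy \<open>u h + v g = E\<close>, where \<open>E\<close> depends only
  on \<open>P\<close> and on earlier coefficients. The Bezout hypothesis solves this for each
  \<open>k > 0\<close>.\<close>

lemma hensel:
  fixes P :: "'a::field fps poly" and g h :: "'a poly"
  assumes monic: "lead_coeff P = 1" and P0: "tcoeff 0 P = g * h"
    and deg: "degree P = degree g + degree h" "degree g > 0" "degree h > 0"
    and lead: "lead_coeff g = 1" "lead_coeff h = 1"
    and bezout: "\<And>E. \<exists>u v. E = u * h + v * g"
  shows "\<exists>G H. P = G * H \<and> lead_coeff G = 1 \<and> lead_coeff H = 1
    \<and> degree G = degree g \<and> degree H = degree h"
proof -
  let ?n = "degree g + degree h"
  let ?P = "\<lambda>s k (u, v). if k = 0 then u = g \<and> v = h else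
     u * h + v * g = tcoeff k P - (\<Sum>i\<in>{0<..<k}. fst (s i) * snd (s (k - i)))
     \<and> degree v < degree h \<and> degree u < degree g"
  \<comment> \<open>The condition on the \<open>k\<close>-th pair refers to all earlier pairs, hence
    the choice along a well-founded order.\<close>
  have "\<exists>s. \<forall>k. ?P s k (s k)"
  proof (rule dependent_wf_choice[of less_than])
    show "?P s k r = ?P s' k r" if "\<And>z. (z, k) \<in> less_than \<Longrightarrow> s z = s' z" for s s' k r
    proof -
      have "(\<Sum>i\<in>{0<..<k}. fst (s i) * snd (s (k - i))) = (\<Sum>i\<in>{0<..<k}. fst (s' i) * snd (s' (k - i)))"
        by (rule sum.cong) (use that in auto)
      then show ?thesis by (simp add: case_prod_unfold)
    qed
    show "\<exists>r. ?P s k r" if IH: "\<And>i. (i, k) \<in> less_than \<Longrightarrow> ?P s i (s i)" for k s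
    proof (cases "k = 0")
      case False
      let ?E = "tcoeff k P - (\<Sum>i\<in>{0<..<k}. fst (s i) * snd (s (k - i)))"
      have "degree (fst (s i) * snd (s (k - i))) < ?n" if i: "i \<in> {0<..<k}" for i
      proof -
        have "degree (fst (s i)) < degree g" "degree (snd (s (k - i))) < degree h"
          using IH[of i] IH[of "k - i"] i by (auto simp: case_prod_unfold)
        then show ?thesis using degree_mult_le[of "fst (s i)" "snd (s (k - i))"] by linarith
      qed
      then have "degree (\<Sum>i\<in>{0<..<k}. fst (s i) * snd (s (k - i))) < ?n"
        using deg by (intro degree_sum_less) auto
      \<comment> \<open>For \<open>k > 0\<close> the leading coefficient 1 of \<open>P\<close>
        contributes nothing to \<open>x^k\<close>, so the degree drops.\<close>
      moreover have "degree (tcoeff k P) < ?n"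
      proof (rule degree_lessI)
        show "\<forall>j\<ge>?n. coeff (tcoeff k P) j = 0"
        proof (intro allI impI)
          fix j assume "?n \<le> j"
          then show "coeff (tcoeff k P) j = 0"
            using monic False deg by (cases "j = ?n") (auto simp: coeff_eq_0)
        qed
      qed (use deg in simp)
      ultimately have "degree ?E < ?n"
        using degree_diff_le_max[of "tcoeff k P"] by (meson le_less_trans max_less_iff_conj)
      moreover obtain u v where "?E = u * h + v * g" using bezout by blast
      moreover have "g \<noteq> 0" using lead by auto
      ultimately obtain u v where "?E = u * h + v * g" "degree v < degree h" "u = 0 \<or> degree u < degree g"
        using bezout_degree[of ?E u h v g] deg by blast
      then show ?thesis using False deg by (intro exI[of _ "(u, v)"]) auto
    qed auto
  qed simp
  then obtain s where s: "\<And>k. ?P s k (s k)" by blast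
  define u v where "u = fst \<circ> s" and "v = snd \<circ> s"
  have uv0: "u 0 = g" "v 0 = h" using s[of 0] by (auto simp: u_def v_def case_prod_unfold)
  have uv: "u k * h + v k * g = tcoeff k P - (\<Sum>i\<in>{0<..<k}. u i * v (k - i))"
    "degree (v k) < degree h" "degree (u k) < degree g" if "k \<noteq> 0" for k
    using s[of k] that by (auto simp: u_def v_def case_prod_unfold)
  have du: "degree (u k) \<le> degree g" and dv: "degree (v k) \<le> degree h" for k
    using uv[of k] uv0 by (cases "k = 0"; simp)+
  obtain G where G: "\<And>k. tcoeff k G = u k" using exists_poly_of_tcoeffs[of u, OF du] by auto
  obtain H where H: "\<And>k. tcoeff k H = v k" using exists_poly_of_tcoeffs[of v, OF dv] by auto
  have "tcoeff k P = tcoeff k (G * H)" for k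
  proof (cases "k = 0")
    case True
    then show ?thesis by (simp only: tcoeff_mult G H) (simp add: P0 uv0)
  next
    case False
    \<comment> \<open>The terms at 0 and \<open>k\<close> contain the new pair; all others were
      subtracted in the defining equation.\<close>
    have "{..k} = insert 0 (insert k {0<..<k})" using False by auto
    then have "(\<Sum>i\<le>k. u i * v (k - i)) = u 0 * v k + (u k * v 0 + (\<Sum>i\<in>{0<..<k}. u i * v (k - i)))"
      using False by (simp add: sum.insert_if)
    also have "\<dots> = tcoeff k P" using uv(1)[OF False] by (simp add: uv0 algebra_simps)
    finally show ?thesis by (simp only: tcoeff_mult G H)
  qed
  then have PGH: "P = G * H" by (rule tcoeff_ext)
  have mon: "degree Q = degree q \<and> lead_coeff Q = 1"
    if Q: "\<And>k. tcoeff k Q = w k" "w 0 = q" "\<And>k. k \<noteq> 0 \<Longrightarrow> degree (w k) < degree q" "lead_coeff q = 1"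
    for Q :: "'a fps poly" and w q
  proof -
    have c: "coeff Q i = (if i = degree q then 1 else 0)" if "degree q \<le> i" for i
    proof (rule fps_ext)
      fix k
      have "coeff Q i $ k = coeff (w k) i" by (simp flip: Q(1))
      also have "\<dots> = (if i = degree q then 1 else 0 :: 'a fps) $ k"
        using Q(2) Q(3)[of k] Q(4) that by (cases "k = 0") (auto simp: coeff_eq_0)
      finally show "coeff Q i $ k = (if i = degree q then 1 else 0 :: 'a fps) $ k" .
    qed
    have "degree Q = degree q"
    proof (rule antisym)
      show "degree Q \<le> degree q" using c by (intro degree_le) auto
      show "degree q \<le> degree Q" using c[of "degree q"] by (intro le_degree) auto
    qed
    then show ?thesis using c[of "degree q"] by simp
  qed
  show ?thesis using PGH mon[of G u g] mon[of H v h] G H uv0 uv lead by blast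
qed

text \<open>Substituting \<open>\<tau> y\<close> for \<open>y\<close> turns each factor
  \<open>y - \<tau> b\<close> into \<open>\<tau> (y - b)\<close>. No division occurs, since
  \<open>\<tau>\<close> need not be invertible.\<close>

lemma linear_factors_scale:
  fixes \<tau> :: "'a::idom"
  shows "coeff (\<Prod>b\<leftarrow>bs. [:- (\<tau> * b), 1:]) k * \<tau> ^ k
    = \<tau> ^ length bs * coeff (\<Prod>b\<leftarrow>bs. [:- b, 1:]) k"
proof -
  have "pcompose (\<Prod>b\<leftarrow>bs. [:- (\<tau> * b), 1:]) [:0, \<tau>:] = smult (\<tau> ^ length bs) (\<Prod>b\<leftarrow>bs. [:- b, 1:])"
  proof (induction bs)
    case (Cons b bs)
    have "pcompose [:- (\<tau> * b), 1:] [:0, \<tau>:] = smult \<tau> [:- b, 1:]" by (simp add: pcompose_pCons)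
    then have "pcompose (\<Prod>b\<leftarrow>b # bs. [:- (\<tau> * b), 1:]) [:0, \<tau>:]
        = smult \<tau> [:- b, 1:] * smult (\<tau> ^ length bs) (\<Prod>b\<leftarrow>bs. [:- b, 1:])"
      using Cons by (simp only: pcompose_mult list.map prod_list.Cons)
    then show ?case by (simp only: mult_smult_left mult_smult_right smult_smult) (simp add: mult.commute del: mult_pCons_left)
  qed (simp add: pcompose_1)
  from arg_cong[OF this, of "\<lambda>p. coeff p k"] show ?thesis
    by (simp add: coeff_pcompose_linear mult.commute)
qed

lemma length_linear_factors: "degree (\<Prod>b\<leftarrow>bs. [:- b, 1 :: 'a::idom:]) = length bs"
proof (induction bs)
  case (Cons b bs)
  have "(\<Prod>b\<leftarrow>bs. [:- b, 1:]) \<noteq> 0" by (auto simp: prod_list_zero_iff)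
  then show ?case using Cons by (simp add: degree_mult_eq del: mult_pCons_left)
qed simp

definition splits :: "'a::idom poly \<Rightarrow> bool" where
  "splits P \<longleftrightarrow> (\<exists>bs. P = (\<Prod>b\<leftarrow>bs. [:- b, 1:]))"

lemma splits_mult: "splits P \<Longrightarrow> splits Q \<Longrightarrow> splits (P * Q)"
  unfolding splits_def by (metis map_append prod_list.append)

lemma splits_subst:
  assumes "0 < N" "splits P"
  shows "splits (map_poly (pow_subst N) P)"
proof -
  interpret h: comm_ring_hom_map "pow_subst N :: 'a fps \<Rightarrow> _" by (rule pow_subst_hom[OF assms(1)])
  obtain bs where "P = (\<Prod>b\<leftarrow>bs. [:- b, 1:])" using assms(2) by (auto simp: splits_def)
  then have "map_poly (pow_subst N) P = (\<Prod>b\<leftarrow>map (pow_subst N) bs. [:- b, 1:])"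
    by (simp add: h.map_poly_linear_factors o_def)
  then show ?thesis unfolding splits_def by blast
qed

lemma subst_poly_subst_poly:
  assumes "0 < N" "0 < M"
  shows "map_poly (pow_subst N) (map_poly (pow_subst M) P) = map_poly (pow_subst (N * M)) P"
  using assms by (simp add: map_poly_map_poly o_def pow_subst_pow_subst)

lemma splits_shift:
  assumes "splits P"
  shows "splits (pcompose P [:a, 1:])"
proof -
  obtain bs where P: "P = (\<Prod>b\<leftarrow>bs. [:- b, 1:])" using assms by (auto simp: splits_def)
  have "pcompose P [:a, 1:] = (\<Prod>b\<leftarrow>map (\<lambda>b. b - a) bs. [:- b, 1:])"
    unfolding P
    by (induction bs) (simp_all add: pcompose_mult pcompose_pCons pcompose_1 del: mult_pCons_left)
  then show ?thesis unfolding splits_def by blast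
qed

text \<open>The roots of \<open>P\<close> are \<tau> times those of \<open>Q\<close>; this is seen
  by cancelling \<open>\<tau> ^ k\<close> in each coefficient. Here \<tau> will be a power of the
  root of \<open>x\<close>.\<close>

lemma splits_rescale:
  fixes P Q :: "'a::idom poly"
  assumes Q: "splits Q" "degree Q = n" and \<tau>: "\<tau> \<noteq> 0"
    and PQ: "\<And>k. coeff P k * \<tau> ^ k = \<tau> ^ n * coeff Q k"
  shows "splits P"
proof -
  obtain bs where bs: "Q = (\<Prod>b\<leftarrow>bs. [:- b, 1:])" using Q by (auto simp: splits_def)
  have n: "n = length bs" using Q(2) unfolding bs length_linear_factors by simp
  have "P = (\<Prod>b\<leftarrow>bs. [:- (\<tau> * b), 1:])"
  proof (rule poly_eqI)
    fix k
    have "coeff P k * \<tau> ^ k = coeff (\<Prod>b\<leftarrow>bs. [:- (\<tau> * b), 1:]) k * \<tau> ^ k"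
      unfolding PQ linear_factors_scale n bs ..
    then show "coeff P k = coeff (\<Prod>b\<leftarrow>bs. [:- (\<tau> * b), 1:]) k" using \<tau> by simp
  qed
  then have "P = (\<Prod>b\<leftarrow>map ((*) \<tau>) bs. [:- b, 1:])" by (simp add: o_def)
  then show ?thesis unfolding splits_def by blast
qed

lemma pcompose_power: "pcompose (p ^ n) q = pcompose p q ^ n"
  for p q :: "'a::comm_ring_1 poly"
  by (induction n) (simp_all add: pcompose_1 pcompose_mult)

text \<open>Powers of \<open>y\<close> below \<open>m\<close> cannot contribute. With a suitable
  \<open>c\<close> this is the Tschirnhaus shift that removes the second highest
  coefficient.\<close>

lemma coeff_pcompose_shift:
  fixes P :: "'a::idom poly"
  assumes "degree P \<le> Suc m"
  shows "coeff (pcompose P [:c, 1:]) m = coeff P m + of_nat (Suc m) * c * coeff P (Suc m)"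
proof -
  define Q where "Q = (\<Sum>k\<le>Suc m. monom (coeff P k) k)"
  have "P = Q" unfolding Q_def using assms by (simp only: poly_as_sum_of_monoms')
  then have "pcompose P [:c, 1:] = pcompose Q [:c, 1:]" by (rule arg_cong)
  also have "\<dots> = (\<Sum>k\<le>Suc m. pcompose (monom (coeff P k) k) [:c, 1:])"
    unfolding Q_def by (rule pcompose_sum)
  also have "\<dots> = (\<Sum>k\<le>Suc m. smult (coeff P k) ([:c, 1:] ^ k))"
    by (intro sum.cong refl, simp only: monom_altdef pcompose_smult pcompose_power) (simp add: pcompose_pCons)
  finally have "coeff (pcompose P [:c, 1:]) m = (\<Sum>k\<le>Suc m. coeff P k * coeff ([:c, 1:] ^ k) m)"
    by (simp add: coeff_sum)
  also have "\<dots> = (\<Sum>k\<in>{m, Suc m}. coeff P k * coeff ([:c, 1:] ^ k) m)"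
  proof (rule sum.mono_neutral_right)
    show "\<forall>k\<in>{..Suc m} - {m, Suc m}. coeff P k * coeff ([:c, 1:] ^ k) m = 0"
      by (auto simp: coeff_eq_0 degree_linear_power)
  qed auto
  also have "\<dots> = coeff P m + of_nat (Suc m) * c * coeff P (Suc m)"
  proof -
    have "coeff ([:c, 1:] ^ m) m = 1"
      using coeff_linear_poly_power[of m m c 1] by simp
    moreover have "coeff ([:c, 1:] ^ Suc m) m = of_nat (Suc m) * c"
    proof -
      have "coeff ([:c, 1:] ^ Suc m) m = of_nat (Suc m choose m) * 1 ^ m * c ^ (Suc m - m)"
        by (rule coeff_linear_poly_power) simp
      moreover have "Suc m - m = 1" by simp
      ultimately show ?thesis by (metis binomial_Suc_n mult_1_right power_one power_one_right)
    qed
    moreover have "(\<Sum>k\<in>{m, Suc m}. coeff P k * coeff ([:c, 1:] ^ k) m)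
        = coeff P m * coeff ([:c, 1:] ^ m) m + coeff P (Suc m) * coeff ([:c, 1:] ^ Suc m) m"
      by (subst sum.insert) (simp_all del: power_Suc)
    ultimately show ?thesis by (simp only: mult_1_right mult.commute[of "coeff P (Suc m)"])
  qed
  finally show ?thesis .
qed

text \<open>Selects the minimal slope \<open>s k0 / (n - k0)\<close> of a Newton polygon.\<close>

lemma exists_minimal_slope:
  fixes s :: "nat \<Rightarrow> nat"
  assumes "finite K" "K \<noteq> {}" "\<And>k. k \<in> K \<Longrightarrow> k < n"
  shows "\<exists>k0\<in>K. \<forall>k\<in>K. s k0 * (n - k) \<le> s k * (n - k0)"
proof -
  define w where "w k = real (s k) / real (n - k)" for k
  obtain k0 where k0: "k0 \<in> K" "\<forall>k\<in>K. w k0 \<le> w k"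
    using ex_is_arg_min_if_finite[OF assms(1,2), of w] by (auto simp: is_arg_min_linorder)
  have "s k0 * (n - k) \<le> s k * (n - k0)" if k: "k \<in> K" for k
  proof -
    have "w k0 \<le> w k" using k0 k by simp
    moreover have "real (n - k) > 0" "real (n - k0) > 0" using assms(3) k k0 by auto
    ultimately have "real (s k0) * real (n - k) \<le> real (s k) * real (n - k0)"
      unfolding w_def by (simp only: divide_le_eq pos_le_divide_eq times_divide_eq_left mult.commute) (simp add: field_simps)
    then show ?thesis by (metis of_nat_le_iff of_nat_mult)
  qed
  then show ?thesis using k0 by blast
qed

text \<open>A power \<open>(y - a)^n\<close> has second coefficient \<open>- n a\<close>, which in
  characteristic 0 vanishes only for \<open>a = 0\<close>; then all lower coefficients vanish too.
  So a root \<open>a\<close> of \<open>p\<close> has multiplicity below \<open>n\<close>, and its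
  linear factors split off coprimely.\<close>

lemma depressed_poly_factors:
  fixes p :: "'a::{alg_closed_field, field_char_0} poly"
  assumes p: "lead_coeff p = 1" "degree p = n" "n > 0" "coeff p (n - 1) = 0"
    and k0: "k0 < n" "coeff p k0 \<noteq> 0"
  shows "\<exists>a g m. p = g * [:- a, 1:] ^ m \<and> poly g a \<noteq> 0 \<and> 0 < m \<and> m < n \<and> degree g = n - m \<and> lead_coeff g = 1"
proof -
  have p0: "p \<noteq> 0" using p by auto
  obtain a where a: "poly p a = 0" using alg_closed_imp_poly_has_root[of p] p by auto
  obtain g where g: "p = [:- a, 1:] ^ order a p * g" "\<not> [:- a, 1:] dvd g"
    using order_decomp[OF p0] by blast
  let ?m = "order a p"
  have ga: "poly g a \<noteq> 0" using g(2) by (simp add: poly_eq_0_iff_dvd)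
  then have "g \<noteq> 0" by auto
  have m: "0 < ?m" using a p0 by (simp add: order_root)
  have "degree p = ?m + degree g"
    using g(1) \<open>g \<noteq> 0\<close> by (metis degree_linear_power degree_mult_eq mult_eq_0_iff p0)
  have lead: "lead_coeff g = 1"
  proof -
    have "lead_coeff p = lead_coeff ([:- a, 1:] ^ ?m) * lead_coeff g" using g(1) by (metis lead_coeff_mult)
    then show ?thesis using p(1) by (simp add: lead_coeff_power)
  qed
  have "?m < n"
  proof (rule ccontr)
    assume "\<not> ?m < n"
    then have "degree g = 0" "?m = n" using \<open>degree p = ?m + degree g\<close> p by auto
    then have "g = 1" using lead by (metis degree_0_id monom_eq_1 monom_0)
    then have p_eq: "p = [:- a, 1:] ^ n" using g(1) \<open>?m = n\<close> by simp
    have "coeff p (n - 1) = of_nat n * (- a)"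
      unfolding p_eq using p(3) by (cases n) (simp_all add: coeff_linear_poly_power del: power_Suc)
    then have "a = 0" using p by simp
    then have "coeff p k0 = 0" unfolding p_eq using k0 by (simp add: coeff_linear_poly_power)
    then show False using k0 by simp
  qed
  then show ?thesis
    using g(1) ga m lead \<open>degree p = ?m + degree g\<close> p(2)
    by (intro exI[of _ a] exI[of _ g] exI[of _ ?m]) (simp add: mult.commute)
qed

text \<open>Induction on the degree. Scaling the roots by the minimal Newton slope makes the
  reduction at 0 depressed yet different from \<open>y^n\<close>; it then has a coprime
  factorization, which Hensel lifting turns into two factors of smaller degree.\<close>

theorem puiseux:
  fixes P :: "'a::{alg_closed_field, field_char_0} fps poly"
  assumes "lead_coeff P = 1"
  shows "\<exists>N>0. splits (map_poly (pow_subst N) P)"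
  using assms
proof (induction "degree P" arbitrary: P rule: less_induct)
  case less
  let ?n = "degree P"
  have subst_hom: "comm_ring_hom_map (pow_subst N :: 'a fps \<Rightarrow> _)" if "0 < N" for N
    by (rule pow_subst_hom[OF that])
  show ?case
  proof (cases "?n = 0")
    case True
    then have "P = [:coeff P 0:]" by (rule degree_0_id[symmetric])
    then have "P = 1" using less.prems True by (simp add: one_pCons)
    then have "map_poly (pow_subst 1) P = (\<Prod>b\<leftarrow>[]. [:- b, 1:])" by (simp add: map_poly_1')
    then show ?thesis unfolding splits_def by blast
  next
    case n: False
    \<comment> \<open>This is minus the mean of the roots, so that the roots of \<open>P1\<close>
      add up to 0.\<close>
    define a where "a = fps_const (1 / of_nat ?n) * coeff P (?n - 1)"
    define P1 where "P1 = pcompose P [:- a, 1:]"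
    have P_P1: "P = pcompose P1 [:a, 1:]"
      unfolding P1_def pcompose_assoc[symmetric] by (simp add: pcompose_pCons)
    have P1: "degree P1 = ?n" "lead_coeff P1 = 1"
      using less.prems lead_coeff_comp[of "[:- a, 1:]" P] by (simp_all add: P1_def degree_pcompose)
    have P1n: "coeff P1 (?n - 1) = 0"
    proof -
      have "coeff P1 (?n - 1) = coeff P (?n - 1) + of_nat ?n * (- a)"
        using coeff_pcompose_shift[of P "?n - 1" "- a"] less.prems n by (simp add: P1_def)
      moreover have "of_nat ?n * a = coeff P (?n - 1)"
        using n by (simp add: a_def fps_of_nat[symmetric] mult.assoc[symmetric])
      ultimately show ?thesis by simp
    qed
    define K where "K = {k. k < ?n \<and> coeff P1 k \<noteq> 0}"
    have "\<exists>N>0. splits (map_poly (pow_subst N) P1)"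
    proof (cases "K = {}")
      case True
      have "P1 = monom 1 ?n"
      proof (rule poly_eqI)
        fix k
        consider "k < ?n" | "k = ?n" | "?n < k" by linarith
        then show "coeff P1 k = coeff (monom 1 ?n) k"
        proof cases
          case 1
          then have "coeff P1 k = 0" using True by (auto simp only: K_def)
          then show ?thesis using 1 by (simp only: coeff_monom if_False less_imp_neq[THEN not_sym])
        next
          case 2
          then show ?thesis using P1 by (simp only: coeff_monom if_True refl)
        next
          case 3
          then have "coeff P1 k = 0" using P1(1) by (intro coeff_eq_0) (simp only:)
          then show ?thesis using 3 by (simp only: coeff_monom if_False less_imp_neq)
        qed
      qed
      also have "\<dots> = [:- 0, 1:] ^ ?n" unfolding monom_altdef smult_1_left minus_zero ..
      also have "\<dots> = (\<Prod>b\<leftarrow>replicate ?n 0. [:- b, 1:])" unfolding map_replicate prod_list_replicate ..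
      finally have "P1 = (\<Prod>b\<leftarrow>replicate ?n 0. [:- b, 1:])" .
      then have "splits P1" unfolding splits_def by blast
      then have "splits (map_poly (pow_subst 1) P1)" by (intro splits_subst zero_less_one)
      then show ?thesis using zero_less_one by (intro exI[of _ 1] conjI)
    next
      case False
      obtain k0 where k0: "k0 \<in> K" and slope: "\<And>k. k \<in> K \<Longrightarrow>
          subdegree (coeff P1 k0) * (?n - k) \<le> subdegree (coeff P1 k) * (?n - k0)"
      proof -
        have "finite K" "\<And>k. k \<in> K \<Longrightarrow> k < ?n" by (simp_all add: K_def)
        then show ?thesis
          using exists_minimal_slope[of K ?n "\<lambda>k. subdegree (coeff P1 k)"] False that by blast
      qed
      define A where "A = subdegree (coeff P1 k0)"
      \<comment> \<open>After the base change \<open>x = s^b\<close> the minimal slope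
        \<open>A / b\<close> becomes the integer \<open>A\<close>.\<close>
      define b where "b = ?n - k0"
      have b: "0 < b" using k0 by (simp add: b_def K_def)
      interpret h: comm_ring_hom_map "pow_subst b :: 'a fps \<Rightarrow> _" by (rule subst_hom[OF b])
      define c where "c k = pow_subst b (coeff P1 k)" for k
      have c: "A * (?n - k) \<le> subdegree (c k)" if "c k \<noteq> 0" "k \<le> ?n" for k
      proof (cases "k = ?n")
        case False
        then have "k \<in> K" using that b by (auto simp: K_def c_def)
        then show ?thesis using slope[of k] b
          by (simp add: c_def subdegree_pow_subst A_def b_def mult.commute)
      qed simp
      \<comment> \<open>This is \<open>P1\<close> at \<open>s^A y\<close>, divided by
        \<open>s^(A n)\<close>. Minimality of the slope keeps the coefficients free of poles, and
        the one at \<open>k0\<close> becomes a unit.\<close>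
      define P2 where "P2 = (\<Sum>k\<le>?n. monom (fps_shift (A * (?n - k)) (c k)) k)"
      have P2: "coeff P2 k = (if k \<le> ?n then fps_shift (A * (?n - k)) (c k) else 0)" for k
        by (simp add: P2_def coeff_sum)
      have P2_lead: "coeff P2 ?n = 1" using P1 b by (simp add: P2 c_def)
      have P2_deg: "degree P2 = ?n"
      proof (rule antisym)
        show "degree P2 \<le> ?n" by (rule degree_le) (simp add: P2)
        show "?n \<le> degree P2" using P2_lead by (intro le_degree) simp
      qed
      have rel: "coeff (map_poly (pow_subst b) P1) k * (fps_X ^ A) ^ k = (fps_X ^ A) ^ ?n * coeff P2 k" for k
      proof (cases "k \<le> ?n")
        case True
        have "fps_X ^ (A * (?n - k)) * fps_shift (A * (?n - k)) (c k) = c k"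
          using c[OF _ True] by (cases "c k = 0") (simp_all add: fps_shift_times_fps_X_power mult.commute[of "fps_X ^ _"])
        then have "(fps_X ^ A) ^ k * c k = (fps_X ^ A) ^ k * (fps_X ^ (A * (?n - k)) * coeff P2 k)"
          using True by (simp add: P2)
        also have "\<dots> = (fps_X ^ (A * (k + (?n - k)))) * coeff P2 k"
          by (simp only: mult.assoc[symmetric] power_mult[symmetric] power_add[symmetric] distrib_left)
        finally show ?thesis using True by (simp add: c_def coeff_map_poly power_mult mult.commute)
      next
        case False
        then show ?thesis using P1 by (simp add: P2 coeff_map_poly coeff_eq_0)
      qed
      define p where "p = tcoeff 0 P2"
      have p_lead: "coeff p ?n = 1" by (simp add: p_def P2_lead)
      have p_deg: "degree p = ?n"
      proof (rule antisym)
        show "degree p \<le> ?n" by (rule degree_le) (simp add: P2 p_def)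
        show "?n \<le> degree p" using p_lead by (intro le_degree) simp
      qed
      have "coeff p (?n - 1) = 0" using P1n by (simp add: p_def P2 c_def)
      moreover have "k0 < ?n" using k0 by (simp add: K_def)
      moreover have "coeff p k0 \<noteq> 0"
      proof -
        have "coeff P1 k0 \<noteq> 0" using k0 by (simp add: K_def)
        then have "pow_subst b (coeff P1 k0) $ (b * A) \<noteq> 0"
          using b by (simp add: pow_subst_nth A_def)
        then show ?thesis using k0 by (simp add: p_def P2 c_def K_def b_def mult.commute)
      qed
      ultimately obtain r g m where pg: "p = g * [:- r, 1:] ^ m" "poly g r \<noteq> 0" "0 < m" "m < ?n"
        "degree g = ?n - m" "lead_coeff g = 1"
        using depressed_poly_factors[of p ?n k0] p_lead p_deg n by auto
      have dl: "degree ([:- r, 1:] ^ m) = m" "lead_coeff ([:- r, 1:] ^ m) = 1"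
        using lead_coeff_power[of "[:- r, 1:]" m] by (simp_all add: degree_linear_power)
      obtain G H where GH: "P2 = G * H" "lead_coeff G = 1" "lead_coeff H = 1" "degree G = ?n - m" "degree H = m"
      proof -
        have "\<exists>G H. P2 = G * H \<and> lead_coeff G = 1 \<and> lead_coeff H = 1
            \<and> degree G = degree g \<and> degree H = degree ([:- r, 1:] ^ m)"
        proof (rule hensel)
          show "tcoeff 0 P2 = g * [:- r, 1:] ^ m" using pg(1) by (simp only: p_def)
          show "lead_coeff P2 = 1" by (simp only: P2_deg P2_lead)
          show "degree P2 = degree g + degree ([:- r, 1:] ^ m)"
            unfolding P2_deg pg(5) dl(1) using pg(4) by simp
          show "\<exists>u v. E = u * [:- r, 1:] ^ m + v * g" for E
            by (rule bezout_linear_power[OF pg(2)])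
          show "lead_coeff g = 1" by (rule pg(6))
          show "lead_coeff ([:- r, 1:] ^ m) = 1" by (rule dl(2))
          show "0 < degree ([:- r, 1:] ^ m)" unfolding dl(1) by (rule pg(3))
        qed (simp_all add: pg)
        then obtain G H where "P2 = G * H" "lead_coeff G = 1" "lead_coeff H = 1"
          "degree G = degree g" "degree H = degree ([:- r, 1:] ^ m)" by blast
        then show ?thesis using that unfolding pg(5) dl(1) by blast
      qed
      obtain N1 where N1: "N1 > 0" "splits (map_poly (pow_subst N1) G)"
        using less.hyps[of G] GH pg by auto
      obtain N2 where N2: "N2 > 0" "splits (map_poly (pow_subst N2) H)"
        using less.hyps[of H] GH pg by auto
      define N where "N = N2 * N1"
      have N: "N > 0" using N1 N2 by (simp add: N_def)
      interpret hN: comm_ring_hom_map "pow_subst N :: 'a fps \<Rightarrow> _" by (rule subst_hom[OF N])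
      have "splits (map_poly (pow_subst N) G)"
        using splits_subst[OF N2(1) N1(2)] N1 N2 by (simp add: subst_poly_subst_poly N_def)
      moreover have "splits (map_poly (pow_subst N) H)"
        using splits_subst[OF N1(1) N2(2)] N1 N2 by (simp add: subst_poly_subst_poly N_def mult.commute)
      ultimately have "splits (map_poly (pow_subst N) P2)"
        unfolding GH hN.map_poly_mult by (rule splits_mult)
      moreover have "degree (map_poly (pow_subst N) P2) = ?n"
        using P2_deg P2_lead by (subst map_poly_degree_eq) auto
      ultimately have "splits (map_poly (pow_subst N) (map_poly (pow_subst b) P1))"
      proof (rule splits_rescale[where \<tau> = "pow_subst N (fps_X ^ A)"])
        show "pow_subst N (fps_X ^ A) \<noteq> (0 :: 'a fps)" using N by (simp add: pow_subst_eq_0_iff)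
        show "coeff (map_poly (pow_subst N) (map_poly (pow_subst b) P1)) k * pow_subst N (fps_X ^ A) ^ k
          = pow_subst N (fps_X ^ A) ^ ?n * coeff (map_poly (pow_subst N) P2) k" for k
          using arg_cong[OF rel[of k], of "pow_subst N"]
          by (simp only: hN.hom_mult hN.hom_power coeff_map_poly hN.hom_zero)
      qed
      then show ?thesis using N b by (auto simp: subst_poly_subst_poly intro!: exI[of _ "N * b"])
    qed
    then obtain N where N: "N > 0" "splits (map_poly (pow_subst N) P1)" by blast
    interpret hN: comm_ring_hom_map "pow_subst N :: 'a fps \<Rightarrow> _" by (rule subst_hom[OF N(1)])
    have "map_poly (pow_subst N) P = pcompose (map_poly (pow_subst N) P1) [:pow_subst N a, 1:]"
      by (subst P_P1) (simp add: hN.map_poly_pcompose hN.map_poly_linear)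
    then have "splits (map_poly (pow_subst N) P)" using splits_shift[OF N(2)] by simp
    then show ?thesis using N(1) by blast
  qed
qed

section \<open>Uniqueness of the irregularity\<close>

definition slope :: "nat \<Rightarrow> 'a::zero fls \<Rightarrow> real" where
  "slope q f = real_of_ereal (max 0 (- puiseux_ord q f))"

definition pole_order :: "'a::zero fls \<Rightarrow> int" where
  "pole_order f = max 0 (- fls_subdegree f)"

lemma slope_eq:
  assumes "0 < q"
  shows "slope q f = real_of_int (pole_order f) / real q"
proof (cases "f = 0")
  case False
  let ?s = "real_of_int (fls_subdegree f) / real q"
  have "max 0 (- puiseux_ord q f) = ereal (max 0 (- ?s))"
    using False by (simp add: puiseux_ord_def max_def zero_ereal_def)
  also have "max 0 (- ?s) = real_of_int (pole_order f) / real q"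
    using assms by (simp add: pole_order_def max_def divide_le_0_iff not_le)
  finally show ?thesis by (simp add: slope_def)
qed (simp add: slope_def puiseux_ord_def pole_order_def)

abbreviation EJ_conn :: "'a::field_char_0 fls \<Rightarrow> nat \<Rightarrow> nat \<Rightarrow> ('a, nat \<Rightarrow> 'a fls) conn" where
  "EJ_conn f q m \<equiv> tensor_matrix_conn (E_conn f q) m jordan_matrix"

lemma carr_E: "carr (E_conn f q) = UNIV"
  and scal_E: "scal (E_conn f q) h v = fls_compose_power h q * v"
  and nabla_E: "nabla (E_conn f q) v = ddx q v + fls_X powi (- int q) * f * v"
  unfolding E_conn_def by simp_all

lemma carr_EJ: "u \<in> carr (EJ_conn f q m) \<longleftrightarrow> (\<forall>i\<ge>m. u i = 0)"
  by (auto simp: tensor_matrix_conn_def carr_E not_less split: if_splits)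

lemma scal_EJ: "scal (EJ_conn f q m) h u = (\<lambda>i. if i < m then fls_compose_power h q * u i else 0)"
  by (simp add: tensor_matrix_conn_def scal_E fun_eq_iff)

section \<open>Growth of poles under the logarithmic derivation\<close>

text \<open>On the connection of \<open>f\<close> this is \<open>(1/q) t d/dt + f\<close>. The
  derivation term does not lower orders, so \<open>f\<close> alone governs the growth of
  poles.\<close>

definition xnabla :: "('a::field_char_0, 'v) conn \<Rightarrow> 'v \<Rightarrow> 'v" where
  "xnabla C v = scal C fls_X (nabla C v)"

lemma xnabla_EJ:
  assumes q: "0 < q"
  shows "xnabla (EJ_conn f q m) u = (\<lambda>i. if i < m then
    fls_const (1 / of_nat q) * (fls_X * fls_deriv (u i)) + f * u i + (if Suc i < m then u (Suc i) else 0) else 0)"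
proof
  fix i
  have X1: "fls_X powi int q * fls_X powi (1 - int q) = (fls_X :: 'a fls)"
    by (subst power_int_add[symmetric]) simp_all
  have X2: "fls_X powi int q * fls_X powi (- int q) = (1 :: 'a fls)"
    by (subst power_int_add[symmetric]) simp_all
  have XX: "fls_compose_power (fls_X :: 'a fls) q = fls_X powi int q"
    using q by (simp add: fls_X_power_conv_shift_1)
  have "(\<Sum>j<m. fls_compose_power (jordan_matrix i j) q * u j)
      = (\<Sum>j<m. if j = Suc i then fls_X powi (- int q) * u (Suc i) else 0)"
    using q by (intro sum.cong) (auto simp: jordan_matrix_def fls_inverse_X fls_X_inv_power_conv_shift_1)
  then have "xnabla (EJ_conn f q m) u i = (if i < m then fls_X powi int q *
      (fls_const (1 / of_nat q) * fls_X powi (1 - int q) * fls_deriv (u i) + fls_X powi (- int q) * f * u i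
       + (if Suc i < m then fls_X powi (- int q) * u (Suc i) else 0)) else 0)"
    unfolding xnabla_def tensor_matrix_conn_def conn.simps scal_E nabla_E ddx_def XX by simp
  also have "fls_X powi int q *
      (fls_const (1 / of_nat q) * fls_X powi (1 - int q) * fls_deriv (u i) + fls_X powi (- int q) * f * u i
       + (if Suc i < m then fls_X powi (- int q) * u (Suc i) else 0))
    = fls_const (1 / of_nat q) * ((fls_X powi int q * fls_X powi (1 - int q)) * fls_deriv (u i))
      + (fls_X powi int q * fls_X powi (- int q)) * f * u i
      + (if Suc i < m then (fls_X powi int q * fls_X powi (- int q)) * u (Suc i) else 0)"
    by (simp add: algebra_simps del: fls_X_power_times_conv_shift)
  finally show "xnabla (EJ_conn f q m) u i = (if i < m then
    fls_const (1 / of_nat q) * (fls_X * fls_deriv (u i)) + f * u i + (if Suc i < m then u (Suc i) else 0) else 0)"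
    unfolding X1 X2 by simp
qed

text \<open>Membership of all components in the lattice \<open>t^k K[[t]]\<close>.\<close>

definition vanishes_below :: "int \<Rightarrow> ('i \<Rightarrow> 'a::zero fls) \<Rightarrow> bool" where
  "vanishes_below k u \<longleftrightarrow> (\<forall>i. \<forall>n<k. u i $$ n = 0)"

lemma vanishes_below_mono: "vanishes_below k u \<Longrightarrow> l \<le> k \<Longrightarrow> vanishes_below l u"
  by (auto simp: vanishes_below_def)

lemma fls_mult_nth_eq_0:
  fixes g h :: "'a::comm_ring_1 fls"
  assumes "\<And>n. n < k \<Longrightarrow> g $$ n = 0" "\<And>n. n < l \<Longrightarrow> h $$ n = 0" "n < k + l"
  shows "(g * h) $$ n = 0"
proof (cases "g = 0 \<or> h = 0")
  case False
  then have "k \<le> fls_subdegree g" "l \<le> fls_subdegree h"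
    using assms by (auto intro!: fls_subdegree_geI)
  then show ?thesis using assms(3) by (intro fls_times_nth_eq0) simp
qed auto

lemma vanishes_below_mult:
  fixes u :: "'i \<Rightarrow> 'a::comm_ring_1 fls"
  assumes "\<And>n. n < l \<Longrightarrow> h $$ n = 0" "vanishes_below k u"
  shows "vanishes_below (k + l) (\<lambda>i. h * u i)"
  using assms fls_mult_nth_eq_0[of l h k] unfolding vanishes_below_def by (simp add: add.commute)

lemma fls_X_deriv_nth: "(fls_X * fls_deriv h) $$ n = of_int n * h $$ n"
  for h :: "'a::comm_ring_1 fls"
  by (simp add: fls_X_times_conv_shift)

lemma vanishes_below_scal:
  fixes f :: "'a::field_char_0 fls"
  assumes q: "0 < q" and h: "\<And>n. n < l \<Longrightarrow> h $$ n = 0" and u: "vanishes_below k u"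
  shows "vanishes_below (k + int q * l) (scal (EJ_conn f q m) h u)"
  unfolding vanishes_below_def scal_EJ
proof (intro allI impI)
  fix i n assume n: "n < k + int q * l"
  have "fls_compose_power h q $$ n = 0" if "n < int q * l" for n
  proof (cases "int q dvd n")
    case True
    then obtain j where "n = int q * j" by (elim dvdE)
    then show ?thesis using that q h by (simp add: fls_nth_compose_power)
  qed (simp add: fls_nth_compose_power q)
  then have "(fls_compose_power h q * u i) $$ n = 0"
    using fls_mult_nth_eq_0[of "int q * l" "fls_compose_power h q" k "u i" n] u n
    by (simp add: vanishes_below_def add.commute)
  then show "(if i < m then fls_compose_power h q * u i else 0) $$ n = 0" by simp
qed

lemma pole_order_nth: "n < - pole_order f \<Longrightarrow> f $$ n = 0"
  by (simp add: pole_order_def)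

lemma vanishes_below_xnabla:
  fixes f :: "'a::field_char_0 fls"
  assumes q: "0 < q" and u: "vanishes_below k u"
  shows "vanishes_below (k - pole_order f) (xnabla (EJ_conn f q m) u)"
  unfolding vanishes_below_def xnabla_EJ[OF q]
proof (intro allI impI)
  fix i n assume n: "n < k - pole_order f"
  have "0 \<le> pole_order f" by (simp add: pole_order_def)
  then have "n < k" using n by simp
  moreover have "(f * u i) $$ n = 0"
    using fls_mult_nth_eq_0[of "- pole_order f" f k "u i" n] pole_order_nth[of _ f] u n
    by (simp add: vanishes_below_def)
  ultimately show "(if i < m then fls_const (1 / of_nat q) * (fls_X * fls_deriv (u i)) + f * u i
      + (if Suc i < m then u (Suc i) else 0) else 0) $$ n = 0"
    using u by (simp add: vanishes_below_def fls_X_deriv_nth)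
qed

text \<open>Division by \<open>f\<close> inverts \<open>xnabla\<close> up to terms of lower pole order.\<close>

lemma xnabla_approx_inverse:
  fixes f :: "'a::field_char_0 fls"
  assumes q: "0 < q" and p: "0 < pole_order f" and u: "u \<in> carr (EJ_conn f q m)" "vanishes_below k u"
  obtains w r where "w \<in> carr (EJ_conn f q m)" "r \<in> carr (EJ_conn f q m)"
    "vanishes_below (k + pole_order f) w" "vanishes_below (k + pole_order f) r"
    "xnabla (EJ_conn f q m) w = (\<lambda>i. u i + r i)"
proof -
  define w where "w i = inverse f * u i" for i
  define r where "r i = (if i < m then fls_const (1 / of_nat q) * (fls_X * fls_deriv (w i))
      + (if Suc i < m then w (Suc i) else 0) else 0)" for i
  have f: "f \<noteq> 0" using p by (auto simp: pole_order_def)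
  have "fls_subdegree (inverse f) = pole_order f" using p f by (simp add: pole_order_def)
  then have "inverse f $$ n = 0" if "n < pole_order f" for n using that by simp
  then have w: "vanishes_below (k + pole_order f) w"
    unfolding w_def[abs_def] using u(2) by (intro vanishes_below_mult)
  then have "vanishes_below (k + pole_order f) r"
    by (auto simp: vanishes_below_def fls_X_deriv_nth r_def)
  moreover have "w \<in> carr (EJ_conn f q m)" "r \<in> carr (EJ_conn f q m)"
    using u(1) by (auto simp: carr_EJ w_def r_def)
  moreover have "xnabla (EJ_conn f q m) w = (\<lambda>i. u i + r i)"
  proof
    fix i
    have "f * w i = u i" using f by (simp add: w_def)
    then show "xnabla (EJ_conn f q m) w i = u i + r i"
      using u(1) by (simp add: xnabla_EJ[OF q] r_def carr_EJ)
  qed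
  ultimately show ?thesis using that w by blast
qed

lemma carr_vanishes_below:
  assumes "u \<in> carr (EJ_conn f q m)"
  shows "\<exists>c\<ge>0. vanishes_below (- c) u"
proof -
  \<comment> \<open>The index \<open>m\<close>, where \<open>u\<close> vanishes, is included so that
    the maximum ranges over a nonempty set also for \<open>m = 0\<close>.\<close>
  define c where "c = Max ((\<lambda>i. \<bar>fls_subdegree (u i)\<bar>) ` {..m})"
  have c: "\<bar>fls_subdegree (u i)\<bar> \<le> c" if "i \<le> m" for i unfolding c_def using that by (intro Max_ge) auto
  have "u i $$ n = 0" if n: "n < - c" for i n
  proof (cases "i < m")
    case True
    then show ?thesis using n c[of i] by (intro fls_eq0_below_subdegree) auto
  next
    case False
    then show ?thesis using assms by (simp add: carr_EJ)
  qed
  moreover have "0 \<le> c" using c[of m] by simp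
  ultimately show ?thesis unfolding vanishes_below_def by blast
qed

locale EJ_morphism =
  fixes f :: "'a::field_char_0 fls" and q m :: nat and f' :: "'a fls" and q' m' :: nat
    and \<phi> :: "(nat \<Rightarrow> 'a fls) \<Rightarrow> nat \<Rightarrow> 'a fls"
  assumes q: "0 < q" and q': "0 < q'"
    and carr: "u \<in> carr (EJ_conn f q m) \<Longrightarrow> \<phi> u \<in> carr (EJ_conn f' q' m')"
    and add: "u \<in> carr (EJ_conn f q m) \<Longrightarrow> v \<in> carr (EJ_conn f q m) \<Longrightarrow> \<phi> (\<lambda>i. u i + v i) = (\<lambda>i. \<phi> u i + \<phi> v i)"
    and scal: "u \<in> carr (EJ_conn f q m) \<Longrightarrow> \<phi> (scal (EJ_conn f q m) h u) = scal (EJ_conn f' q' m') h (\<phi> u)"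
    and xnabla: "u \<in> carr (EJ_conn f q m) \<Longrightarrow> \<phi> (xnabla (EJ_conn f q m) u) = xnabla (EJ_conn f' q' m') (\<phi> u)"
begin

abbreviation "M \<equiv> EJ_conn f q m"
abbreviation "M' \<equiv> EJ_conn f' q' m'"

lemma zero: "\<phi> (\<lambda>_. 0) = (\<lambda>_. 0)"
proof -
  have "scal M 0 (\<lambda>_. 0) = (\<lambda>_. 0)" by (auto simp: scal_EJ)
  then have "\<phi> (\<lambda>_. 0) = scal M' 0 (\<phi> (\<lambda>_. 0))" using scal[of "\<lambda>_. 0" 0] by (simp add: carr_EJ)
  then show ?thesis by (simp add: scal_EJ cong: if_cong)
qed

lemma sum: "finite A \<Longrightarrow> (\<And>x. x \<in> A \<Longrightarrow> g x \<in> carr M) \<Longrightarrow>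
    \<phi> (\<lambda>i. \<Sum>x\<in>A. g x i) = (\<lambda>i. \<Sum>x\<in>A. \<phi> (g x) i)"
proof (induction A rule: finite_induct)
  case (insert x A)
  have "(\<lambda>i. \<Sum>x\<in>A. g x i) \<in> carr M" using insert.prems by (auto simp: carr_EJ intro: sum.neutral)
  then show ?case using insert by (simp add: add)
qed (simp add: zero)

text \<open>The lattice is generated over K[[x]] by the finitely many vectors \<open>t^r e_i\<close>
  with \<open>r < q\<close>, and multiplication by elements of K[[x]] creates no poles.\<close>

lemma bounded_on_lattice:
  "\<exists>c\<ge>0. \<forall>u\<in>carr M. vanishes_below 0 u \<longrightarrow> vanishes_below (- c) (\<phi> u)"
proof -
  define e where "e i r = (\<lambda>k. if k = i then fls_X ^ r else (0 :: 'a fls))" for i r :: nat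
  have e: "e i r \<in> carr M" if "i < m" for i r using that by (auto simp: e_def carr_EJ)
  have "\<exists>c\<ge>0. vanishes_below (- c) (\<phi> (e i r))" if "i < m" for i r
    using carr[OF e[OF that]] carr_vanishes_below by blast
  then obtain c where c: "\<And>i r. i < m \<Longrightarrow> 0 \<le> c i r \<and> vanishes_below (- c i r) (\<phi> (e i r))" by metis
  define C where "C = (\<Sum>x\<in>{..<m} \<times> {..<q}. c (fst x) (snd x))"
  have C: "c i r \<le> C" if "i < m" "r < q" for i r
  proof -
    have "c (fst (i, r)) (snd (i, r)) \<le> C"
      unfolding C_def using that c by (intro member_le_sum) auto
    then show ?thesis by simp
  qed
  have "vanishes_below (- C) (\<phi> u)" if u: "u \<in> carr M" "vanishes_below 0 u" for u
  proof -
    let ?A = "{..<m} \<times> {..<q}"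
    define g where "g x = scal M (fls_part q (snd x) (u (fst x))) (e (fst x) (snd x))" for x
    have g: "g x \<in> carr M" for x by (auto simp: g_def scal_EJ carr_EJ)
    have "u = (\<lambda>i. \<Sum>x\<in>?A. g x i)"
    proof
      fix i
      have "(\<Sum>x\<in>?A. g x i) = (\<Sum>j<m. \<Sum>r<q. g (j, r) i)"
        by (simp add: sum.cartesian_product)
      also have "\<dots> = (\<Sum>j<m. if j = i then (\<Sum>r<q. g (j, r) i) else 0)"
        by (rule sum.cong) (auto simp: g_def scal_EJ e_def intro!: sum.neutral)
      also have "\<dots> = (if i < m then (\<Sum>r<q. fls_X ^ r * fls_compose_power (fls_part q r (u i)) q) else 0)"
        by (simp add: g_def scal_EJ e_def mult.commute)
      also have "\<dots> = u i" using u(1) fls_decompose[OF q, of "u i"] by (simp add: carr_EJ)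
      finally show "u i = (\<Sum>x\<in>?A. g x i)" ..
    qed
    then have "\<phi> u = \<phi> (\<lambda>i. \<Sum>x\<in>?A. g x i)" by (rule arg_cong)
    also have "\<dots> = (\<lambda>i. \<Sum>x\<in>?A. \<phi> (g x) i)" using g by (intro sum) auto
    finally have eq: "\<phi> u = (\<lambda>i. \<Sum>x\<in>?A. \<phi> (g x) i)" .
    have "vanishes_below (- C) (\<phi> (g x))" if x: "x \<in> ?A" for x
    proof -
      obtain i r where x: "x = (i, r)" "i < m" "r < q" using x by auto
      have "fls_part q r (u i) $$ n = 0" if "n < 0" for n
      proof -
        have "int q * n \<le> int q * (- 1)" using that by (intro mult_left_mono) auto
        then have "int q * n + int r < 0" using x(3) by simp
        then show ?thesis using u(2) q by (simp add: fls_part_nth vanishes_below_def)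
      qed
      then have "vanishes_below (- c i r + int q' * 0) (scal M' (fls_part q r (u i)) (\<phi> (e i r)))"
        using q' c[OF x(2)] by (intro vanishes_below_scal) auto
      moreover have "\<phi> (g x) = scal M' (fls_part q r (u i)) (\<phi> (e i r))"
        using scal[OF e[OF x(2)]] x(1) by (simp add: g_def)
      ultimately show ?thesis using C[OF x(2,3)] by (auto elim: vanishes_below_mono)
    qed
    then show ?thesis unfolding eq vanishes_below_def fls_nth_sum by (auto intro: sum.neutral)
  qed
  moreover have "0 \<le> C" unfolding C_def using c by (intro sum_nonneg) auto
  ultimately show ?thesis by blast
qed

text \<open>Write \<open>u\<close> as \<open>xnabla w - r\<close>, where \<open>w\<close> and
  \<open>r\<close> have poles smaller by the pole order of \<open>f\<close>. The morphism carries
  \<open>xnabla w\<close> to \<open>xnabla\<close> of the image of \<open>w\<close>, which adds at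
  most the pole order of \<open>f'\<close>.\<close>

lemma pole_growth:
  assumes p: "0 < pole_order f"
  shows "\<exists>c\<ge>0. \<forall>n. \<forall>u\<in>carr M. vanishes_below (- (pole_order f * int n)) u
    \<longrightarrow> vanishes_below (- c - pole_order f' * int n) (\<phi> u)"
proof -
  obtain c where c: "0 \<le> c" "\<And>u. u \<in> carr M \<Longrightarrow> vanishes_below 0 u \<Longrightarrow> vanishes_below (- c) (\<phi> u)"
    using bounded_on_lattice by blast
  have p': "0 \<le> pole_order f'" by (simp add: pole_order_def)
  have "vanishes_below (- c - pole_order f' * int n) (\<phi> u)"
    if "u \<in> carr M" "vanishes_below (- (pole_order f * int n)) u" for n u
    using that
  proof (induction n arbitrary: u)
    case 0
    then show ?case using c by simp
  next
    case (Suc n)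
    obtain w r where wr: "w \<in> carr M" "r \<in> carr M"
      "vanishes_below (- (pole_order f * int (Suc n)) + pole_order f) w"
      "vanishes_below (- (pole_order f * int (Suc n)) + pole_order f) r"
      "xnabla M w = (\<lambda>i. u i + r i)"
      using xnabla_approx_inverse[OF q p Suc.prems] by blast
    have e: "- (pole_order f * int (Suc n)) + pole_order f = - (pole_order f * int n)"
      by (simp add: algebra_simps)
    have w: "vanishes_below (- c - pole_order f' * int n) (\<phi> w)"
      and r: "vanishes_below (- c - pole_order f' * int n) (\<phi> r)"
      using wr Suc.IH unfolding e by blast+
    have eq: "xnabla M' (\<phi> w) = (\<lambda>i. \<phi> u i + \<phi> r i)"
      using xnabla[OF wr(1)] add[OF Suc.prems(1) wr(2)] wr(5) by simp
    have "vanishes_below (- c - pole_order f' * int n - pole_order f') (xnabla M' (\<phi> w))"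
      by (rule vanishes_below_xnabla[OF q' w])
    then have "\<phi> u i $$ k = 0" if "k < - c - pole_order f' * int n - pole_order f'" for i k
      using r that p' unfolding eq vanishes_below_def by simp
    then show ?case by (simp add: vanishes_below_def algebra_simps)
  qed
  then show ?thesis using c(1) by blast
qed

text \<open>Multiplying by negative powers of $x$ and comparing the growth of poles shows that a
  morphism to a connection of smaller slope vanishes.\<close>

lemma zero_if_slope_less:
  assumes less: "slope q' f' < slope q f" and u: "u \<in> carr M"
  shows "\<phi> u = (\<lambda>_. 0)"
proof (rule ccontr)
  let ?p = "pole_order f" and ?p' = "pole_order f'"
  have p': "0 \<le> ?p'" by (simp add: pole_order_def)
  have "real_of_int ?p' * real q < real_of_int ?p * real q'"
    using less q q' by (simp add: slope_eq field_simps)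
  then have "real_of_int (?p' * int q) < real_of_int (?p * int q')" by simp
  \<comment> \<open>The cross-multiplied slopes are integers, so strict inequality leaves a gap of
    at least 1.\<close>
  then have gap: "1 \<le> ?p * int q' - ?p' * int q" by linarith
  have p: "0 < ?p"
  proof (rule ccontr)
    assume "\<not> 0 < ?p"
    then have "?p * int q' \<le> 0" by (intro mult_nonpos_nonneg) auto
    moreover have "0 \<le> ?p' * int q" using p' by simp
    ultimately show False using gap by linarith
  qed
  assume "\<phi> u \<noteq> (\<lambda>_. 0)"
  then obtain i k where ik: "\<phi> u i $$ k \<noteq> 0" by (metis ext fls_nonzero_nth)
  then have "i < m'" using carr[OF u] by (metis carr_EJ fls_zero_nth not_less)
  obtain c where c: "0 \<le> c" "\<And>n u. u \<in> carr M \<Longrightarrow> vanishes_below (- (?p * int n)) u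
      \<Longrightarrow> vanishes_below (- c - ?p' * int n) (\<phi> u)"
    using pole_growth[OF p] by blast
  obtain c0 where c0: "0 \<le> c0" "vanishes_below (- c0) u" using carr_vanishes_below[OF u] by blast
  define n0 where "n0 = nat c0"
  \<comment> \<open>Let \<open>p\<close>, \<open>p'\<close> be the two pole orders. Multiplying by
    \<open>h = x^(-p l)\<close> moves the coefficient at \<open>k\<close> down by
    \<open>q' p l\<close>, while the growth bound allows a pole of order at most
    \<open>c + p' (n0 + q l)\<close>. The gap gives an excess of at least \<open>l\<close>, and this
    \<open>l\<close> outweighs the constants.\<close>
  define l where "l = nat (\<bar>k\<bar> + c + ?p' * int n0 + 1)"
  define h where "h = (fls_X_intpow (- (?p * int l)) :: 'a fls)"
  have h: "h $$ n = (if n = - (?p * int l) then 1 else 0)" for n by (simp add: h_def)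
  have "- (?p * int n0) \<le> - c0"
    using p c0(1) mult_right_mono[of 1 ?p c0] by (simp add: n0_def)
  then have u0: "vanishes_below (- (?p * int n0)) u" using c0 vanishes_below_mono by blast
  have hz: "h $$ n = 0" if "n < - (?p * int l)" for n using that unfolding h by simp
  have "vanishes_below (- (?p * int n0) + int q * (- (?p * int l))) (scal M h u)"
    by (rule vanishes_below_scal[OF q hz u0])
  then have "vanishes_below (- (?p * int (n0 + q * l))) (scal M h u)" by (simp add: algebra_simps)
  moreover have "scal M h u \<in> carr M" by (simp add: scal_EJ carr_EJ)
  ultimately have "vanishes_below (- c - ?p' * int (n0 + q * l)) (scal M' h (\<phi> u))"
    using c(2) scal[OF u] by metis
  moreover have "(scal M' h (\<phi> u)) i $$ (k - int q' * (?p * int l)) = \<phi> u i $$ k"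
  proof -
    have "fls_compose_power h q' = fls_X_intpow (int q' * (- (?p * int l)))"
      unfolding h_def using q' by (rule fls_compose_power_X_intpow)
    then show ?thesis using \<open>i < m'\<close> by (simp add: scal_EJ fls_shifted_times_simps)
  qed
  moreover have "k - int q' * (?p * int l) < - c - ?p' * int (n0 + q * l)"
  proof -
    have "int l * 1 \<le> int l * (?p * int q' - ?p' * int q)" using gap by (intro mult_left_mono) auto
    moreover have "\<bar>k\<bar> + c + ?p' * int n0 + 1 \<le> int l" using c(1) p' by (simp add: l_def)
    ultimately have "k + c + ?p' * int n0 < int l * (?p * int q' - ?p' * int q)" by linarith
    then show ?thesis by (simp add: algebra_simps)
  qed
  ultimately show False using ik by (auto simp: vanishes_below_def)
qed

end

section \<open>Direct sums and the dimensions of their slope parts\<close>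

type_synonym 'a summand = "'a fls \<times> nat \<times> nat"

abbreviation summand_conn :: "'a::field_char_0 summand \<Rightarrow> ('a, nat \<Rightarrow> 'a fls) conn" where
  "summand_conn d \<equiv> (case d of (f, q, m) \<Rightarrow> EJ_conn f q m)"

definition sum_conn :: "'a::field_char_0 summand list \<Rightarrow> ('a, nat \<Rightarrow> nat \<Rightarrow> 'a fls) conn" where
  "sum_conn ds = direct_sum (map summand_conn ds)"

definition summand_slope :: "'a::zero summand \<Rightarrow> real" where
  "summand_slope = (\<lambda>(f, q, m). slope q f)"

definition summand_dim :: "'a summand \<Rightarrow> nat" where
  "summand_dim = (\<lambda>(f, q, m). m * q)"

lemma carr_sum_conn: "u \<in> carr (sum_conn ds) \<longleftrightarrow>
    (\<forall>i<length ds. u i \<in> carr (summand_conn (ds ! i))) \<and> (\<forall>i\<ge>length ds. u i = 0)"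
  unfolding sum_conn_def direct_sum_def by (auto simp: not_less split: if_splits)

lemma scal_sum_conn: "scal (sum_conn ds) h u = (\<lambda>i. if i < length ds then scal (summand_conn (ds ! i)) h (u i) else 0)"
  unfolding sum_conn_def direct_sum_def by (simp add: fun_eq_iff)

lemma nabla_sum_conn: "nabla (sum_conn ds) u = (\<lambda>i. if i < length ds then nabla (summand_conn (ds ! i)) (u i) else 0)"
  unfolding sum_conn_def direct_sum_def by (simp add: fun_eq_iff)

lemma xnabla_sum_conn: "xnabla (sum_conn ds) u = (\<lambda>i. if i < length ds then xnabla (summand_conn (ds ! i)) (u i) else 0)"
  unfolding xnabla_def scal_sum_conn nabla_sum_conn by (simp add: fun_eq_iff)

lemma scal_EJ_0: "scal (summand_conn d) h 0 = 0"
  by (cases d) (simp add: scal_EJ fun_eq_iff)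

lemma xnabla_EJ_0: "0 < q \<Longrightarrow> xnabla (EJ_conn f q m) 0 = 0"
  by (simp add: xnabla_EJ fun_eq_iff)

definition embed :: "nat \<Rightarrow> 'v \<Rightarrow> nat \<Rightarrow> 'v::zero" where
  "embed i u = (\<lambda>k. if k = i then u else 0)"

text \<open>Labels a K((x))-basis of the summands whose slope satisfies \<open>P\<close> by summand,
  place in the Jordan block, and power of \<open>t\<close>.\<close>

definition coord_index :: "(real \<Rightarrow> bool) \<Rightarrow> 'a::zero summand list \<Rightarrow> (nat \<times> nat \<times> nat) set" where
  "coord_index P ds = (SIGMA i:{i. i < length ds \<and> P (summand_slope (ds ! i))}.
    {..<snd (snd (ds ! i))} \<times> {..<fst (snd (ds ! i))})"

definition coord :: "'a::zero summand list \<Rightarrow> nat \<times> nat \<times> nat \<Rightarrow> (nat \<Rightarrow> nat \<Rightarrow> 'a fls) \<Rightarrow> 'a fls" where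
  "coord ds = (\<lambda>(i, l, r) v. fls_part (fst (snd (ds ! i))) r (v i l))"

definition coord_vector :: "nat \<times> nat \<times> nat \<Rightarrow> nat \<Rightarrow> nat \<Rightarrow> 'a::comm_ring_1 fls" where
  "coord_vector = (\<lambda>(i, l, r). embed i (embed l (fls_X ^ r)))"

lemma finite_coord_index: "finite (coord_index P ds)"
  by (simp add: coord_index_def)

lemma card_coord_index:
  "card (coord_index P ds) = (\<Sum>d\<leftarrow>ds. if P (summand_slope d) then summand_dim d else 0)"
proof -
  have "card (coord_index P ds) = (\<Sum>i\<in>{i. i < length ds \<and> P (summand_slope (ds ! i))}. summand_dim (ds ! i))"
    unfolding coord_index_def by (subst card_SigmaI) (simp_all add: summand_dim_def case_prod_unfold)
  also have "\<dots> = (\<Sum>i<length ds. if P (summand_slope (ds ! i)) then summand_dim (ds ! i) else 0)"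
    by (rule sum.mono_neutral_cong_left) auto
  also have "\<dots> = (\<Sum>d\<leftarrow>ds. if P (summand_slope d) then summand_dim d else 0)"
    by (simp add: sum_list_sum_nth atLeast0LessThan)
  finally show ?thesis .
qed

lemma coord_zero_iff:
  assumes v: "v \<in> carr (sum_conn ds)" and q: "\<And>d. d \<in> set ds \<Longrightarrow> 0 < fst (snd d)"
    and P: "\<And>i. i < length ds \<Longrightarrow> \<not> P (summand_slope (ds ! i)) \<Longrightarrow> v i = 0"
    and c: "\<And>b. b \<in> coord_index P ds \<Longrightarrow> coord ds b v = 0"
  shows "v = 0"
proof (intro ext)
  fix i l
  show "v i l = 0 i l"
  proof (cases "i < length ds \<and> P (summand_slope (ds ! i))")
    case True
    obtain f q m where d: "ds ! i = (f, q, m)" by (cases "ds ! i")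
    have q: "0 < q" using q[OF nth_mem[of i ds]] d True by simp
    show ?thesis
    proof (cases "l < m")
      case l: True
      have "fls_part q r (v i l) = 0" if "r < q" for r
        using c[of "(i, l, r)"] True d l that by (simp add: coord_index_def coord_def)
      then show ?thesis using fls_decompose[OF q, of "v i l"] by simp
    next
      case False
      then show ?thesis using v True d by (auto simp: carr_sum_conn carr_EJ)
    qed
  next
    case False
    then show ?thesis using v P[of i] by (cases "i < length ds") (auto simp: carr_sum_conn)
  qed
qed

locale sum_conn_morphism =
  fixes ds ds' :: "'a::field_char_0 summand list" and T
  assumes pos: "\<And>d. d \<in> set ds \<Longrightarrow> 0 < fst (snd d)" "\<And>d. d \<in> set ds' \<Longrightarrow> 0 < fst (snd d)"
    and carr: "u \<in> carr (sum_conn ds) \<Longrightarrow> T u \<in> carr (sum_conn ds')"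
    and inj: "inj_on T (carr (sum_conn ds))"
    and add: "u \<in> carr (sum_conn ds) \<Longrightarrow> v \<in> carr (sum_conn ds) \<Longrightarrow> T (u + v) = T u + T v"
    and scal: "u \<in> carr (sum_conn ds) \<Longrightarrow> T (scal (sum_conn ds) h u) = scal (sum_conn ds') h (T u)"
    and nabla: "u \<in> carr (sum_conn ds) \<Longrightarrow> T (nabla (sum_conn ds) u) = nabla (sum_conn ds') (T u)"
begin

lemma nabla_carr: "u \<in> carr (sum_conn ds) \<Longrightarrow> nabla (sum_conn ds) u \<in> carr (sum_conn ds)"
  by (auto simp: carr_sum_conn nabla_sum_conn tensor_matrix_conn_def carr_E split: prod.splits)

lemma scal_carr: "u \<in> carr (sum_conn ds) \<Longrightarrow> scal (sum_conn ds) h u \<in> carr (sum_conn ds)"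
  by (auto simp: carr_sum_conn scal_sum_conn carr_EJ scal_EJ split: prod.splits)

lemma zero_carr: "0 \<in> carr (sum_conn ds)"
  by (auto simp: carr_sum_conn carr_EJ split: prod.splits)

lemma add_carr: "u \<in> carr (sum_conn ds) \<Longrightarrow> v \<in> carr (sum_conn ds) \<Longrightarrow> u + v \<in> carr (sum_conn ds)"
  by (fastforce simp: carr_sum_conn carr_EJ split: prod.splits)

lemma zero: "T 0 = 0"
  using add[OF zero_carr zero_carr] by simp

lemma sum_carr: "(\<And>x. x \<in> A \<Longrightarrow> g x \<in> carr (sum_conn ds)) \<Longrightarrow> sum g A \<in> carr (sum_conn ds)"
  by (induction A rule: infinite_finite_induct) (auto intro: zero_carr add_carr)

lemma sum: "(\<And>x. x \<in> A \<Longrightarrow> g x \<in> carr (sum_conn ds)) \<Longrightarrow> T (sum g A) = (\<Sum>x\<in>A. T (g x))"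
  by (induction A rule: infinite_finite_induct) (simp_all add: zero add sum_carr)

lemma embed_carr:
  "i < length ds \<Longrightarrow> u \<in> carr (summand_conn (ds ! i)) \<Longrightarrow> embed i u \<in> carr (sum_conn ds)"
  by (auto simp: carr_sum_conn embed_def carr_EJ split: prod.splits)

text \<open>Cuts a morphism of sums into morphisms between single blocks, to which the comparison of
  slopes applies.\<close>

lemma component:
  assumes i: "i < length ds" "ds ! i = (f, q, m)" and j: "j < length ds'" "ds' ! j = (f', q', m')"
  shows "EJ_morphism f q m f' q' m' (\<lambda>u. T (embed i u) j)"
proof
  have pq: "0 < fst (snd (ds ! k))" if "k < length ds" for k using pos(1) that by simp
  show "0 < q" using pos(1)[OF nth_mem[OF i(1)]] i by simp
  show "0 < q'" using pos(2)[OF nth_mem[OF j(1)]] j by simp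
  note e = embed_carr[OF i(1), unfolded i(2) prod.case]
  fix u v and h :: "'a fls" assume u: "u \<in> carr (EJ_conn f q m)"
  show "T (embed i u) j \<in> carr (EJ_conn f' q' m')"
    using carr[OF e[OF u]] j by (auto simp: carr_sum_conn)
  have "scal (sum_conn ds) h (embed i u) = embed i (scal (EJ_conn f q m) h u)"
    using i by (auto simp: scal_sum_conn embed_def scal_EJ_0 fun_eq_iff)
  then show "T (embed i (scal (EJ_conn f q m) h u)) j = scal (EJ_conn f' q' m') h (T (embed i u) j)"
    using scal[OF e[OF u], of h] j by (simp add: scal_sum_conn)
  have "xnabla (sum_conn ds) (embed i u) = embed i (xnabla (EJ_conn f q m) u)"
  proof
    fix k
    have "xnabla (summand_conn (ds ! k)) 0 = 0" if "k < length ds"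
      using pq[OF that] by (cases "ds ! k") (simp add: xnabla_EJ_0)
    then show "xnabla (sum_conn ds) (embed i u) k = embed i (xnabla (EJ_conn f q m) u) k"
      using i by (auto simp: xnabla_sum_conn embed_def)
  qed
  moreover have "T (xnabla (sum_conn ds) (embed i u)) = xnabla (sum_conn ds') (T (embed i u))"
    using e[OF u] by (simp add: xnabla_def scal nabla nabla_carr)
  ultimately show "T (embed i (xnabla (EJ_conn f q m) u)) j = xnabla (EJ_conn f' q' m') (T (embed i u) j)"
    using j by (simp add: xnabla_sum_conn)
  assume v: "v \<in> carr (EJ_conn f q m)"
  have A: "embed i (\<lambda>k. u k + v k) = embed i u + embed i v" by (auto simp: embed_def fun_eq_iff)
  show "T (embed i (\<lambda>k. u k + v k)) j = (\<lambda>k. T (embed i u) j k + T (embed i v) j k)"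
    unfolding A add[OF e[OF u] e[OF v]] by (rule ext) simp
qed

text \<open>For upward closed \<open>P\<close> the summands with slope in \<open>P\<close> are
  mapped into those of the target, since components of smaller slope vanish; an injective linear map
  cannot lower the dimension.\<close>

lemma dim_le:
  assumes P: "\<And>x y. x \<le> y \<Longrightarrow> P x \<Longrightarrow> P y"
  shows "card (coord_index P ds) \<le> card (coord_index P ds')"
proof (rule ccontr)
  let ?I = "coord_index P ds" let ?J = "coord_index P ds'"
  assume "\<not> card ?I \<le> card ?J"
  \<comment> \<open>A system over K((x)): one unknown per basis vector of the source with slope in
    \<open>P\<close>, one equation per such coordinate of the target.\<close>
  then obtain c where c: "\<exists>b\<in>?I. c b \<noteq> 0"
    "\<And>b'. b' \<in> ?J \<Longrightarrow> (\<Sum>b\<in>?I. c b * coord ds' b' (T (coord_vector b))) = 0"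
    using homogeneous_system_solution[OF finite_coord_index finite_coord_index,
        of P ds' P ds "\<lambda>b b'. coord ds' b' (T (coord_vector b))"] by auto
  have e: "coord_vector b \<in> carr (sum_conn ds)" if b: "b \<in> ?I" for b
  proof -
    obtain i l r where b': "b = (i, l, r)" by (cases b)
    then have "i < length ds" "l < snd (snd (ds ! i))" using b by (auto simp: coord_index_def)
    then show ?thesis unfolding b' coord_vector_def prod.case
      by (intro embed_carr) (auto simp: embed_def carr_EJ split: prod.splits)
  qed
  \<comment> \<open>A target slope outside \<open>P\<close> is strictly below the source slope
    because \<open>P\<close> is upward closed.\<close>
  have low: "T (coord_vector b) j = 0"
    if b: "b \<in> ?I" and j: "j < length ds'" "\<not> P (summand_slope (ds' ! j))" for b j
  proof -
    obtain i l r where b': "b = (i, l, r)" by (cases b)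
    then have i: "i < length ds" "l < snd (snd (ds ! i))" "P (summand_slope (ds ! i))"
      using b by (auto simp: coord_index_def)
    obtain f q m where d: "ds ! i = (f, q, m)" by (cases "ds ! i")
    obtain f' q' m' where d': "ds' ! j = (f', q', m')" by (cases "ds' ! j")
    have "\<not> slope q f \<le> slope q' f'"
      using P[of "slope q f" "slope q' f'"] i j d d' by (auto simp: summand_slope_def)
    then have "slope q' f' < slope q f" by simp
    moreover have "embed l (fls_X ^ r) \<in> carr (EJ_conn f q m)"
      using i d by (auto simp: carr_EJ embed_def)
    ultimately have "T (embed i (embed l (fls_X ^ r))) j = (\<lambda>_. 0)"
      using EJ_morphism.zero_if_slope_less[OF component[OF i(1) d j(1) d']] by blast
    then show ?thesis unfolding b' coord_vector_def prod.case by (simp add: zero_fun_def)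
  qed
  define v where "v = (\<Sum>b\<in>?I. scal (sum_conn ds) (c b) (coord_vector b))"
  have v: "v \<in> carr (sum_conn ds)" unfolding v_def by (intro sum_carr scal_carr e)
  have Tv: "T v = (\<Sum>b\<in>?I. scal (sum_conn ds') (c b) (T (coord_vector b)))"
    unfolding v_def by (subst sum) (auto intro!: scal_carr e sum.cong scal)
  have sum_app: "(\<Sum>x\<in>A. g x) i = (\<Sum>x\<in>A. g x i)" for g :: "'c \<Rightarrow> 'd \<Rightarrow> 'e::comm_monoid_add" and i A
    by (induction A rule: infinite_finite_induct) auto
  have coord_sum: "coord es b (\<Sum>x\<in>A. scal (sum_conn es) (c x) (w x)) = (\<Sum>x\<in>A. c x * coord es b (w x))"
    if b: "b \<in> coord_index P es" for es :: "'a summand list" and A w b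
  proof -
    obtain i l r where b': "b = (i, l, r)" by (cases b)
    obtain f q m where d: "es ! i = (f, q, m)" by (cases "es ! i")
    have "i < length es" "l < m" "r < q" using b b' d by (auto simp: coord_index_def)
    then show ?thesis unfolding b' coord_def
      by (simp add: sum_app d scal_sum_conn scal_EJ fls_part_sum fls_part_compose_power_mult)
  qed
  have "T v = 0"
  proof (rule coord_zero_iff[of "T v" ds' P])
    show "T v \<in> carr (sum_conn ds')" using carr v by blast
    show "T v i = 0" if "i < length ds'" "\<not> P (summand_slope (ds' ! i))" for i
    proof -
      have "T v i = (\<Sum>b\<in>?I. scal (sum_conn ds') (c b) (T (coord_vector b)) i)"
        unfolding Tv by (rule sum_app)
      also have "\<dots> = 0"
        by (intro sum.neutral ballI) (simp add: scal_sum_conn low[OF _ that] scal_EJ_0)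
      finally show ?thesis .
    qed
    show "coord ds' b (T v) = 0" if "b \<in> ?J" for b
      unfolding Tv using that c(2) by (simp add: coord_sum)
  qed (rule pos(2))
  then have "T v = T 0" by (simp add: zero)
  then have "v = 0" using inj v zero_carr by (simp add: inj_on_eq_iff)
  obtain b0 where b0: "b0 \<in> ?I" "c b0 \<noteq> 0" using c(1) by blast
  have "coord ds b0 v = (\<Sum>b\<in>?I. c b * coord ds b0 (coord_vector b))"
    unfolding v_def using b0 by (simp add: coord_sum)
  also have "\<dots> = (\<Sum>b\<in>?I. if b = b0 then c b0 else 0)"
  proof (rule sum.cong)
    fix b assume b: "b \<in> ?I"
    obtain i l r where b': "b = (i, l, r)" by (cases b)
    obtain i0 l0 r0 where b0': "b0 = (i0, l0, r0)" by (cases b0)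
    obtain f q m where d: "ds ! i0 = (f, q, m)" by (cases "ds ! i0")
    have "r0 < q" using b0 b0' d by (auto simp: coord_index_def)
    moreover have "r < q" if "i = i0" using b b' d that by (auto simp: coord_index_def)
    ultimately show "c b * coord ds b0 (coord_vector b) = (if b = b0 then c b0 else 0)"
      using fls_part_monomial_mult[of r0 q r 1]
      by (auto simp: b' b0' coord_def coord_vector_def embed_def d)
  qed simp
  also have "\<dots> = c b0" using b0 by (simp add: finite_coord_index)
  finally have "c b0 = coord ds b0 0" using \<open>v = 0\<close> by simp
  then show False
  proof -
    obtain i0 l0 r0 where b0': "b0 = (i0, l0, r0)" by (cases b0)
    have "0 < fst (snd (ds ! i0))" using b0 b0' by (auto simp: coord_index_def)
    then show False using \<open>c b0 = coord ds b0 0\<close> b0 by (simp add: b0' coord_def)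
  qed
qed

end

text \<open>Taking for \<open>P\<close> the conditions of being at least \<open>s\<close> and of
  exceeding \<open>s\<close>, and subtracting, gives equal total dimension for each single slope
  \<open>s\<close>.\<close>

lemma weighted_sum_eq:
  fixes w w' :: "'b \<Rightarrow> real" and ds ds' :: "'b list"
  assumes "\<And>P. (\<And>x y. x \<le> y \<Longrightarrow> P x \<Longrightarrow> P y) \<Longrightarrow>
    (\<Sum>d\<leftarrow>ds. if P (w d) then n d else 0) = (\<Sum>d\<leftarrow>ds'. if P (w d) then n d else (0::nat))"
  shows "(\<Sum>d\<leftarrow>ds. real (n d) * w d) = (\<Sum>d\<leftarrow>ds'. real (n d) * w d)"
proof -
  let ?N = "\<lambda>ds P. \<Sum>d\<leftarrow>ds. if P (w d) then n d else (0::nat)"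
  have split: "?N es ((\<le>) s) = ?N es ((<) s) + ?N es ((=) s)" for es s
    by (induction es) auto
  have eq: "?N ds ((=) s) = ?N ds' ((=) s)" for s
    using split[where es = ds and s = s] split[where es = ds' and s = s] assms[of "(\<le>) s"] assms[of "(<) s"] by auto
  define S where "S = w ` (set ds \<union> set ds')"
  have S: "finite S" by (simp add: S_def)
  have *: "(\<Sum>d\<leftarrow>es. real (n d) * w d) = (\<Sum>s\<in>S. s * real (?N es ((=) s)))"
    if "set es \<subseteq> set ds \<union> set ds'" for es
    using that
  proof (induction es)
    case (Cons d es)
    have "w d \<in> S" using Cons.prems by (auto simp: S_def)
    have "(\<Sum>s\<in>S. s * real (?N (d # es) ((=) s)))
      = (\<Sum>s\<in>S. (if s = w d then s * real (n d) else 0) + s * real (?N es ((=) s)))"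
      by (rule sum.cong) (auto simp: algebra_simps)
    also have "\<dots> = w d * real (n d) + (\<Sum>s\<in>S. s * real (?N es ((=) s)))"
      using S \<open>w d \<in> S\<close> by (simp add: sum.distrib)
    finally show ?case using Cons by simp
  qed simp
  show ?thesis using *[of ds] *[of ds'] by (simp add: eq)
qed

text \<open>\<open>conn_iso\<close> constrains the map only on the carrier, so closure of the
  carrier is what permits computing with the inverse.\<close>

lemma conn_iso_sym:
  assumes "conn_iso C D" and C: "\<And>u v. u \<in> carr C \<Longrightarrow> v \<in> carr C \<Longrightarrow> u + v \<in> carr C"
    "\<And>h u. u \<in> carr C \<Longrightarrow> scal C h u \<in> carr C" "\<And>u. u \<in> carr C \<Longrightarrow> nabla C u \<in> carr C"
  shows "conn_iso D C"
proof -
  obtain T where T: "bij_betw T (carr C) (carr D)"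
    "\<And>u v. u \<in> carr C \<Longrightarrow> v \<in> carr C \<Longrightarrow> T (u + v) = T u + T v"
    "\<And>h v. v \<in> carr C \<Longrightarrow> T (scal C h v) = scal D h (T v)"
    "\<And>v. v \<in> carr C \<Longrightarrow> T (nabla C v) = nabla D (T v)"
    using assms(1) unfolding conn_iso_def by blast
  let ?S = "inv_into (carr C) T"
  have S: "bij_betw ?S (carr D) (carr C)" by (rule bij_betw_inv_into[OF T(1)])
  have in_C: "?S u \<in> carr C" if "u \<in> carr D" for u using S that by (auto simp: bij_betw_def)
  have TS: "T (?S u) = u" if "u \<in> carr D" for u
    using T(1) that by (rule bij_betw_inv_into_right)
  have ST: "?S (T u) = u" if "u \<in> carr C" for u
    using T(1) that by (rule bij_betw_inv_into_left)
  show ?thesis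
    unfolding conn_iso_def
  proof (intro exI[of _ ?S] conjI ballI allI S)
    fix u v h assume u: "u \<in> carr D"
    show "?S (scal D h u) = scal C h (?S u)"
      using ST[OF C(2)[OF in_C[OF u]], of h] T(3)[OF in_C[OF u]] TS[OF u] by simp
    show "?S (nabla D u) = nabla C (?S u)"
      using ST[OF C(3)[OF in_C[OF u]]] T(4)[OF in_C[OF u]] TS[OF u] by simp
    assume v: "v \<in> carr D"
    show "?S (u + v) = ?S u + ?S v"
      using ST[OF C(1)[OF in_C[OF u] in_C[OF v]]] T(2)[OF in_C[OF u] in_C[OF v]] TS[OF u] TS[OF v] by simp
  qed
qed

lemma conn_iso_trans:
  assumes "conn_iso C D" "conn_iso D E"
  shows "conn_iso C E"
proof -
  obtain T where T: "bij_betw T (carr C) (carr D)"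
    "\<forall>u\<in>carr C. \<forall>v\<in>carr C. T (u + v) = T u + T v"
    "\<forall>h. \<forall>v\<in>carr C. T (scal C h v) = scal D h (T v)"
    "\<forall>v\<in>carr C. T (nabla C v) = nabla D (T v)"
    using assms(1) unfolding conn_iso_def by blast
  obtain S where S: "bij_betw S (carr D) (carr E)"
    "\<forall>u\<in>carr D. \<forall>v\<in>carr D. S (u + v) = S u + S v"
    "\<forall>h. \<forall>v\<in>carr D. S (scal D h v) = scal E h (S v)"
    "\<forall>v\<in>carr D. S (nabla D v) = nabla E (S v)"
    using assms(2) unfolding conn_iso_def by blast
  have "T v \<in> carr D" if "v \<in> carr C" for v using T(1) that by (auto simp: bij_betw_def)
  then show ?thesis unfolding conn_iso_def
    using bij_betw_trans[OF T(1) S(1)] T(2-4) S(2-4) by (intro exI[of _ "S \<circ> T"]) (simp add: o_def)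
qed

lemma sum_conn_iso_dim_le:
  assumes iso: "conn_iso (sum_conn ds) (sum_conn ds')"
    and pos: "\<And>d. d \<in> set ds \<Longrightarrow> 0 < fst (snd d)" "\<And>d. d \<in> set ds' \<Longrightarrow> 0 < fst (snd d)"
    and P: "\<And>x y. x \<le> y \<Longrightarrow> P x \<Longrightarrow> P y"
  shows "card (coord_index P ds) \<le> card (coord_index P ds')"
proof -
  obtain T where T: "bij_betw T (carr (sum_conn ds)) (carr (sum_conn ds'))"
    "\<forall>u\<in>carr (sum_conn ds). \<forall>v\<in>carr (sum_conn ds). T (u + v) = T u + T v"
    "\<forall>h. \<forall>v\<in>carr (sum_conn ds). T (scal (sum_conn ds) h v) = scal (sum_conn ds') h (T v)"
    "\<forall>v\<in>carr (sum_conn ds). T (nabla (sum_conn ds) v) = nabla (sum_conn ds') (T v)"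
    using iso unfolding conn_iso_def by blast
  interpret sum_conn_morphism ds ds' T
  proof
    show "inj_on T (carr (sum_conn ds))" using T(1) by (rule bij_betw_imp_inj_on)
    show "T u \<in> carr (sum_conn ds')" if "u \<in> carr (sum_conn ds)" for u
      using T(1) that by (rule bij_betwE[rule_format])
  qed (use T(2-4) in \<open>simp_all add: pos\<close>)
  show ?thesis using P by (rule dim_le)
qed

definition closed_conn :: "('a::field, 'v::ab_group_add) conn \<Rightarrow> bool" where
  "closed_conn C \<longleftrightarrow> (\<forall>u\<in>carr C. \<forall>v\<in>carr C. u + v \<in> carr C)
    \<and> (\<forall>h. \<forall>u\<in>carr C. scal C h u \<in> carr C) \<and> (\<forall>u\<in>carr C. nabla C u \<in> carr C)"

text \<open>Two decompositions are isomorphic through \<open>C\<close>; the dimension inequality in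
  both directions makes the \<open>THE\<close> definite.\<close>

lemma irregularity_eqI:
  assumes C: "closed_conn C" and ds: "HTL_decomposition C ds"
  shows "irregularity C = (\<Sum>d\<leftarrow>ds. real (summand_dim d) * summand_slope d)"
proof -
  have weight: "(\<Sum>(f, q, m)\<leftarrow>ds. real m * real q * real_of_ereal (max 0 (- puiseux_ord q f)))
      = (\<Sum>d\<leftarrow>ds. real (summand_dim d) * summand_slope d)" for ds :: "'a summand list"
    by (intro arg_cong[where f = sum_list] map_cong)
      (auto simp: summand_dim_def summand_slope_def slope_def)
  have pos: "0 < fst (snd d)" if "HTL_decomposition C es" "d \<in> set es" for es d
    using that unfolding HTL_decomposition_def by fastforce
  have iso: "conn_iso C (sum_conn es)" if "HTL_decomposition C es" for es
    using that unfolding HTL_decomposition_def sum_conn_def by blast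
  have iso': "conn_iso (sum_conn es) (sum_conn es')"
    if "HTL_decomposition C es" "HTL_decomposition C es'" for es es'
    using conn_iso_trans[OF conn_iso_sym[OF iso[OF that(1)]] iso[OF that(2)]] C
    unfolding closed_conn_def by blast
  have "(\<Sum>d\<leftarrow>es. real (summand_dim d) * summand_slope d) = (\<Sum>d\<leftarrow>ds. real (summand_dim d) * summand_slope d)"
    if es: "HTL_decomposition C es" for es
  proof (rule weighted_sum_eq)
    fix P :: "real \<Rightarrow> bool" assume P: "\<And>x y. x \<le> y \<Longrightarrow> P x \<Longrightarrow> P y"
    have "card (coord_index P es) \<le> card (coord_index P ds)"
      using iso'[OF es ds] pos[OF es] pos[OF ds] P by (rule sum_conn_iso_dim_le)
    moreover have "card (coord_index P ds) \<le> card (coord_index P es)"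
      using iso'[OF ds es] pos[OF ds] pos[OF es] P by (rule sum_conn_iso_dim_le)
    ultimately have "card (coord_index P es) = card (coord_index P ds)" by simp
    then show "(\<Sum>d\<leftarrow>es. if P (summand_slope d) then summand_dim d else 0)
        = (\<Sum>d\<leftarrow>ds. if P (summand_slope d) then summand_dim d else 0)"
      by (simp only: card_coord_index)
  qed
  then show ?thesis unfolding irregularity_def weight using ds by (intro the_equality) metis+
qed

section \<open>Decomposition of the endomorphism connection\<close>

definition polar_part :: "'a::comm_ring_1 fls \<Rightarrow> 'a fls" where
  "polar_part h = h - fps_to_fls (fls_regpart h)"

lemma polar_part_nth: "polar_part h $$ n = (if n < 0 then h $$ n else 0)"
  by (simp add: polar_part_def)

lemma ddx_nth: "ddx q v $$ n = of_int (n + int q) / of_nat q * v $$ (n + int q)"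
proof -
  have "ddx q v = fls_const (1 / of_nat q) * fls_shift (int q - 1) (fls_deriv v)"
    by (simp add: ddx_def mult.assoc fls_shifted_times_simps)
  then show ?thesis by simp
qed

lemma ddx_add: "ddx q (u + v) = ddx q u + ddx q v"
  by (rule fls_eqI) (simp add: ddx_nth algebra_simps)

lemma ddx_sum: "ddx q (sum g A) = (\<Sum>x\<in>A. ddx q (g x))"
  by (rule fls_eqI) (simp add: ddx_nth fls_nth_sum sum_distrib_left)

lemma ddx_mult: "ddx q (u * v) = ddx q u * v + u * ddx q v"
  by (simp add: ddx_def algebra_simps)

lemma ddx_compose_power:
  assumes "0 < d" "0 < r"
  shows "ddx (d * r) (fls_compose_power w d) = fls_compose_power (ddx r w) d"
proof (rule fls_eqI)
  fix n
  show "ddx (d * r) (fls_compose_power w d) $$ n = fls_compose_power (ddx r w) d $$ n"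
  proof (cases "int d dvd n")
    case True
    then obtain k where k: "n = int d * k" by (elim dvdE)
    have "n + int (d * r) = int d * (k + int r)" using k by (simp add: algebra_simps)
    then show ?thesis using assms k by (simp add: ddx_nth fls_nth_compose_power field_simps)
  next
    case False
    then have "\<not> int d dvd n + int (d * r)" by (simp add: dvd_add_left_iff)
    then show ?thesis using False assms by (simp add: ddx_nth fls_nth_compose_power)
  qed
qed

lemma ddx_X_power:
  assumes "0 < q"
  shows "ddx q (fls_X ^ k) = fls_const (of_nat k / of_nat q) * fls_X powi (- int q) * fls_X ^ k"
proof (rule fls_eqI)
  fix n
  have A: "fls_const (of_nat k / of_nat q) * fls_X powi (- int q) * fls_X ^ k
      = fls_const (of_nat k / of_nat q) * fls_shift (int q) (fls_X ^ k :: 'a fls)"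
    by (simp add: mult.assoc fls_shifted_times_simps)
  have "(fls_const (of_nat k / of_nat q) * fls_X powi (- int q) * fls_X ^ k :: 'a fls) $$ n
      = of_nat k / of_nat q * (if n + int q = int k then 1 else 0)" unfolding A by simp
  moreover have "ddx q (fls_X ^ k :: 'a fls) $$ n = of_nat k / of_nat q * (if n + int q = int k then 1 else 0)"
  proof -
    have "(of_int (n + int q) :: 'a) = of_nat k" if "n + int q = int k"
      unfolding that by simp
    then show ?thesis unfolding ddx_nth by (cases "n + int q = int k") (simp_all only: fls_X_power_nth if_True if_False simp_thms mult_zero_right)
  qed
  ultimately show "ddx q (fls_X ^ k :: 'a fls) $$ n = (fls_const (of_nat k / of_nat q) * fls_X powi (- int q) * fls_X ^ k) $$ n"
    by (simp only:)
qed

lemma fls_compose_power_compose_power: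
  assumes "0 < d" "0 < r"
  shows "fls_compose_power (fls_compose_power h r) d = fls_compose_power h (d * r)"
proof (rule fls_eqI)
  fix n
  show "fls_compose_power (fls_compose_power h r) d $$ n = fls_compose_power h (d * r) $$ n"
  proof (cases "int d dvd n")
    case True
    then obtain k where k: "n = int d * k" by (elim dvdE)
    then show ?thesis using assms by (simp add: fls_nth_compose_power)
  next
    case False
    then have "\<not> int (d * r) dvd n" by (metis dvd_mult_left of_nat_mult)
    then show ?thesis using False assms by (simp add: fls_nth_compose_power)
  qed
qed

text \<open>Without constant term the non-polar part of \<open>h\<close> is \<open>t g\<close> with
  \<open>g\<close> in K[[t]]. The equation becomes \<open>dE/dt = - q g E\<close>, solved by the
  exponential of \<open>- q\<close> times the integral of \<open>g\<close>.\<close>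

lemma gauge_exists:
  fixes h :: "'a::field_char_0 fls"
  assumes q: "0 < q" and h0: "h $$ 0 = 0"
  shows "\<exists>E. E \<noteq> 0 \<and> ddx q E = - (fls_X powi (- int q) * (h - polar_part h) * E)"
proof -
  define g where "g = fps_shift 1 (fls_regpart h)"
  have hg: "h - polar_part h = fls_X * fps_to_fls g"
  proof (rule fls_eqI)
    fix n
    show "(h - polar_part h) $$ n = (fls_X * fps_to_fls g) $$ n"
      using h0 by (cases "n \<le> 0") (auto simp: fls_X_times_conv_shift g_def polar_part_nth nat_diff_distrib
          Suc_nat_eq_nat_zadd1 order_less_le)
  qed
  define y where "y = fps_integral0 g"
  define e where "e = (fps_exp (- of_nat q) oo y :: 'a fps)"
  have y0: "y $ 0 = 0" by (simp add: y_def fps_integral_def)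
  have e0: "e $ 0 = 1" by (simp add: e_def y0)
  have "fps_deriv e = (fps_deriv (fps_exp (- of_nat q)) oo y) * fps_deriv y"
    unfolding e_def by (rule fps_compose_deriv[OF y0])
  also have "fps_deriv y = g" by (simp add: y_def fps_deriv_fps_integral)
  also have "fps_deriv (fps_exp (- of_nat q)) oo y = fps_const (- of_nat q) * e"
    by (simp add: e_def fps_compose_mult_distrib y0)
  finally have de: "fps_deriv e = fps_const (- of_nat q) * e * g" .
  let ?E = "fps_to_fls e"
  have "?E \<noteq> 0" using e0 by auto
  moreover have "ddx q ?E = - (fls_X powi (- int q) * (h - polar_part h) * ?E)"
  proof -
    have "fls_X powi (1 - int q) = fls_X powi (- int q) * (fls_X :: 'a fls)"
      by (subst power_int_diff) (simp_all add: fls_shifted_times_simps)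
    moreover have "fls_deriv ?E = fps_to_fls (fps_deriv e)" by (simp add: fls_deriv_fps_to_fls)
    moreover have "\<dots> = fls_const (- of_nat q) * ?E * fps_to_fls g"
      unfolding de by (simp add: fls_times_fps_to_fls del: fls_const_uminus fps_const_neg)
    ultimately have "ddx q ?E = (fls_const (1 / of_nat q) * fls_const (- of_nat q))
        * (fls_X powi (- int q) * (fls_X * fps_to_fls g) * ?E)"
      unfolding ddx_def by (simp only: mult_ac)
    also have "fls_const (1 / of_nat q) * fls_const (- of_nat q) = (- 1 :: 'a fls)"
      using q by (simp only: fls_const_mult_const) simp
    finally show ?thesis unfolding hg by simp
  qed
  ultimately show ?thesis by blast
qed

text \<open>The largest divisor \<open>d\<close> of \<open>q\<close> such that the polar part of
  \<open>h\<close> is a series in \<open>t^d\<close>.\<close>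

definition polar_gcd :: "nat \<Rightarrow> 'a::zero fls \<Rightarrow> nat" where
  "polar_gcd q h = Gcd (insert q {n. 0 < n \<and> h $$ (- int n) \<noteq> 0})"

lemma polar_gcd_dvd: "polar_gcd q h dvd q"
  by (simp add: polar_gcd_def Gcd_dvd)

lemma polar_gcd_pos: "0 < q \<Longrightarrow> 0 < polar_gcd q h"
  using polar_gcd_dvd[of q h] by (auto intro: Nat.gr0I)

lemma polar_gcd_dvd_exponent: "0 < n \<Longrightarrow> h $$ (- int n) \<noteq> 0 \<Longrightarrow> polar_gcd q h dvd n"
  unfolding polar_gcd_def by (rule Gcd_dvd) simp

lemma polar_part_compose_power:
  fixes h :: "'a::comm_ring_1 fls"
  assumes "0 < q"
  shows "fls_compose_power (fls_part (polar_gcd q h) 0 (polar_part h)) (polar_gcd q h) = polar_part h"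
proof (rule fls_eqI)
  fix n
  let ?d = "polar_gcd q h"
  have d: "0 < ?d" using assms by (rule polar_gcd_pos)
  have "h $$ n = 0" if "n < 0" "\<not> int ?d dvd n"
  proof (rule ccontr)
    assume "h $$ n \<noteq> 0"
    then have "?d dvd nat (- n)" using that by (intro polar_gcd_dvd_exponent) auto
    then have "int ?d dvd int (nat (- n))" by (simp only: int_dvd_int_iff)
    then show False using that by simp
  qed
  then show "fls_compose_power (fls_part ?d 0 (polar_part h)) ?d $$ n = polar_part h $$ n"
    using d by (auto simp: fls_nth_compose_power fls_part_nth polar_part_nth)
qed

lemma R_class_polar: "g \<in> R_class q f \<Longrightarrow> n < 0 \<Longrightarrow> g $$ n = f $$ n"
  by (auto simp: R_class_def R_kernel_def)

text \<open>The class fixes the polar part, and constants lie in every K((x^(1/r))), so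
  representability with smaller ramification depends only on the pole exponents and
  \<open>q\<close>.\<close>

lemma R_circ_iff_polar_gcd:
  fixes f :: "'a::field_char_0 fls"
  assumes q: "0 < q"
  shows "R_class q f \<in> R_circ q \<longleftrightarrow> polar_gcd q f = 1"
proof
  assume R: "R_class q f \<in> R_circ q"
  show "polar_gcd q f = 1"
  proof (rule ccontr)
    let ?d = "polar_gcd q f"
    assume "?d \<noteq> 1"
    then have d: "1 < ?d" using polar_gcd_pos[OF q, of f] by simp
    obtain r where r: "q = ?d * r" using polar_gcd_dvd[of q f] by (elim dvdE)
    have "0 < r" using r q by (metis mult_0_right neq0_conv)
    moreover from this have "r < ?d * r" using d by simp
    ultimately have r': "0 < r" "r < q" using r by simp_all
    \<comment> \<open>The part of positive order may be dropped within the class; the constant term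
      is kept, as it need not lie in \<open>(1/q)\<close> Z.\<close>
    define f0 where "f0 = polar_part f + fls_const (f $$ 0)"
    define g where "g = fls_part ?d 0 (polar_part f) + fls_const (f $$ 0)"
    have g: "fls_compose_power g ?d = f0"
      using polar_part_compose_power[OF q, of f] d by (simp add: g_def f0_def)
    have "f0 \<in> R_class q f"
    proof -
      have "f0 - f = fps_to_fls (fps_X * fps_shift 1 (fls_regpart (f0 - f))) + fls_const (of_int 0 / of_nat q)"
      proof (rule fls_eqI)
        fix n
        show "(f0 - f) $$ n = (fps_to_fls (fps_X * fps_shift 1 (fls_regpart (f0 - f))) + fls_const (of_int 0 / of_nat q)) $$ n"
          by (cases "n \<le> 0") (auto simp: f0_def polar_part_nth)
      qed
      then have "f0 - f \<in> R_kernel q" unfolding R_kernel_def by blast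
      moreover have "f0 = f + (f0 - f)" by simp
      ultimately show ?thesis unfolding R_class_def by blast
    qed
    moreover have "fls_compose_power f0 r = fls_compose_power g q"
      unfolding g[symmetric] using r r' d by (simp add: fls_compose_power_compose_power mult.commute)
    ultimately show False using R r' unfolding R_circ_def by blast
  qed
next
  assume d: "polar_gcd q f = 1"
  show "R_class q f \<in> R_circ q"
    unfolding R_circ_def
  proof (intro CollectI conjI notI)
    assume "\<exists>r. 0 < r \<and> r < q \<and> (\<exists>h\<in>R_class q f. \<exists>g. fls_compose_power h r = fls_compose_power g q)"
    then obtain r h g where r: "0 < r" "r < q" and h: "h \<in> R_class q f"
      and eq: "fls_compose_power h r = fls_compose_power g q" by blast
    have "q dvd r * n" if n: "0 < n" "f $$ (- int n) \<noteq> 0" for n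
    proof -
      have "h $$ (- int n) \<noteq> 0" using R_class_polar[OF h, of "- int n"] n by simp
      moreover have shift: "fls_compose_power h r $$ (int r * j) = h $$ j" for j
        using r by (simp add: fls_nth_compose_power)
      ultimately have "fls_compose_power g q $$ (int r * (- int n)) \<noteq> 0"
        using shift[of "- int n"] by (simp only: eq not_False_eq_True)
      then have "int q dvd int r * (- int n)" using q by (auto simp: fls_nth_compose_power split: if_splits)
      then have "int q dvd int (r * n)" by simp
      then show ?thesis by (simp only: int_dvd_int_iff)
    qed
    \<comment> \<open>The member \<open>q\<close> of the set qualifies too, because \<open>q\<close>
      divides \<open>r * q\<close>. Hence \<open>q\<close> divides \<open>r\<close> times the gcd,
      that is \<open>r\<close>.\<close>
    then have "q dvd Gcd ((*) r ` insert q {n. 0 < n \<and> f $$ (- int n) \<noteq> 0})"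
      by (intro Gcd_greatest) auto
    also have "\<dots> = r * polar_gcd q f"
      unfolding polar_gcd_def by (subst Gcd_mult) simp
    finally have "q dvd r" using d by simp
    then show False using r by (simp add: dvd_imp_le leD)
  qed simp
qed

text \<open>Dividing all pole exponents and \<open>q\<close> by their gcd leaves gcd 1. Only
  negative exponents of \<open>G\<close> are compared, so constants may be added to it.\<close>

lemma polar_gcd_reduced:
  fixes h :: "'a::comm_ring_1 fls"
  assumes q: "0 < q" and qdr: "q = polar_gcd q h * r"
    and G: "\<And>n. n < 0 \<Longrightarrow> G $$ n = h $$ (int (polar_gcd q h) * n)"
  shows "polar_gcd r G = 1"
proof -
  let ?d = "polar_gcd q h"
  have d: "0 < ?d" using q by (rule polar_gcd_pos)
  have "?d * polar_gcd r G dvd x" if x: "x \<in> insert q {n. 0 < n \<and> h $$ (- int n) \<noteq> 0}" for x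
  proof (cases "x = q")
    case True
    then show ?thesis using polar_gcd_dvd[of r G] by (subst True, subst qdr) (rule mult_dvd_mono, auto)
  next
    case False
    then have x: "0 < x" "h $$ (- int x) \<noteq> 0" using x by auto
    obtain k where k: "x = ?d * k" using polar_gcd_dvd_exponent[OF x, of q] by (elim dvdE)
    have "0 < k" using k x by (auto intro: Nat.gr0I)
    have "- int x = int ?d * (- int k)" by (subst k) simp
    then have "G $$ (- int k) \<noteq> 0" using G[of "- int k"] \<open>0 < k\<close> x by simp
    then have "polar_gcd r G dvd k" using \<open>0 < k\<close> by (rule polar_gcd_dvd_exponent[rotated])
    then show ?thesis using k by (metis dvd_refl mult_dvd_mono)
  qed
  then have "?d * polar_gcd r G dvd ?d" unfolding polar_gcd_def[of q h] by (rule Gcd_greatest)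
  then show ?thesis using d by simp
qed

lemma sum_scale_regroup:
  fixes K :: "'a::comm_ring"
  shows "(K * (\<Sum>k\<in>S. a k * x k * y k)) * (c * z) = K * (\<Sum>k\<in>S. (a k * c) * (x k * y k * z))"
  by (simp add: sum_distrib_right sum_distrib_left mult_ac)

lemma sum_fls_const_mult: "(\<Sum>x\<in>S. fls_const (c x) * B) = fls_const (sum c S) * B"
  for c :: "'b \<Rightarrow> 'a::comm_ring_1"
proof -
  have "fls_const (sum c S) = (\<Sum>x\<in>S. fls_const (c x))"
    by (induction S rule: infinite_finite_induct) (simp_all flip: fls_plus_const)
  then show ?thesis by (simp only: sum_distrib_right)
qed

section \<open>Conjugation and the expansion of K((x))-linear maps\<close>

locale conjugates =
  fixes \<zeta> :: "'a::field_char_0" and q :: nat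
  assumes q: "0 < q" and primitive: "primitive_root_of_unity q \<zeta>"
begin

lemma zeta_power_q: "\<zeta> ^ q = 1"
  using primitive by (simp add: primitive_root_of_unity_def)

lemma zeta_nonzero: "\<zeta> \<noteq> 0"
  using zeta_power_q q by (cases "\<zeta> = 0") (simp_all add: power_0_left)

lemma zeta_power_power_q: "(\<zeta> ^ i) ^ q = 1"
proof -
  have "(\<zeta> ^ i) ^ q = (\<zeta> ^ q) ^ i" by (simp add: mult.commute flip: power_mult)
  then show ?thesis by (simp add: zeta_power_q)
qed

abbreviation conj :: "nat \<Rightarrow> 'a fls \<Rightarrow> 'a fls" where
  "conj i \<equiv> fls_conjugate \<zeta> i"

lemma conj_nth: "conj i h $$ n = h $$ n * (\<zeta> ^ i) powi n"
  unfolding fls_conjugate_def using zeta_nonzero by (intro fls_nth_fls_compose_fps_linear) simp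

lemma conj_add: "conj i (g + h) = conj i g + conj i h"
  by (rule fls_eqI) (simp add: conj_nth algebra_simps)

lemma conj_mult: "conj i (g * h) = conj i g * conj i h"
  unfolding fls_conjugate_def using zeta_nonzero by (intro fls_compose_fps_mult) simp_all

lemma conj_eq_0_iff: "conj i h = 0 \<longleftrightarrow> h = 0"
  using zeta_nonzero by (auto simp: fls_eq_iff conj_nth)

lemma subdegree_conj: "fls_subdegree (conj i h) = fls_subdegree h"
proof (cases "h = 0")
  case False
  show ?thesis
    by (rule fls_subdegree_eqI) (use False zeta_nonzero in \<open>simp_all add: conj_nth\<close>)
qed (use conj_eq_0_iff[of i 0] in simp)

lemma zeta_powi_eq_1: "int q dvd n \<Longrightarrow> (\<zeta> ^ i) powi n = 1"
proof (elim dvdE)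
  fix k assume "n = int q * k"
  then have "(\<zeta> ^ i) powi n = ((\<zeta> ^ i) ^ q) powi k" by (simp add: power_int_mult)
  also have "(\<zeta> ^ i) ^ q = 1" by (rule zeta_power_power_q)
  finally show ?thesis by simp
qed

lemma conj_compose_power: "conj i (fls_compose_power h q) = fls_compose_power h q"
  by (rule fls_eqI) (use q in \<open>auto simp: conj_nth fls_nth_compose_power zeta_powi_eq_1\<close>)

lemma ddx_conj: "ddx q (conj i h) = conj i (ddx q h)"
proof (rule fls_eqI)
  fix n
  have "(\<zeta> ^ i) powi (n + int q) = (\<zeta> ^ i) powi n"
    using zeta_nonzero by (simp add: power_int_add zeta_powi_eq_1[of "int q", simplified])
  then show "ddx q (conj i h) $$ n = conj i (ddx q h) $$ n"
    by (simp add: ddx_nth conj_nth)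
qed

lemma conj_X_power: "conj i (fls_X ^ l) = fls_const ((\<zeta> ^ l) ^ i) * fls_X ^ l"
proof (rule fls_eqI)
  show "conj i (fls_X ^ l) $$ n = (fls_const ((\<zeta> ^ l) ^ i) * fls_X ^ l) $$ n" for n
    by (simp add: conj_nth mult.commute flip: power_mult)
qed

lemma zeta_power_inj:
  assumes "k < q" "l < q" "\<zeta> ^ k = \<zeta> ^ l"
  shows "k = l"
proof -
  have *: "k = l" if "k \<le> l" "l < q" "\<zeta> ^ k = \<zeta> ^ l" for k l
  proof (rule ccontr)
    assume "k \<noteq> l"
    then have "0 < l - k" "l - k < q" using that by auto
    moreover have "\<zeta> ^ (l - k) = 1" using that zeta_nonzero by (simp add: power_diff)
    ultimately show False using primitive by (auto simp: primitive_root_of_unity_def)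
  qed
  show ?thesis using *[of k l] *[of l k] assms by (cases "k \<le> l") auto
qed

lemma orthogonality:
  assumes "k < q" "l < q"
  shows "(\<Sum>i<q. (\<zeta> ^ k / \<zeta> ^ l) ^ i) = (if k = l then of_nat q else 0)"
proof (cases "k = l")
  case True
  then show ?thesis using zeta_nonzero by simp
next
  case False
  let ?z = "\<zeta> ^ k / \<zeta> ^ l"
  have "?z \<noteq> 1" using zeta_power_inj[OF assms] False zeta_nonzero by auto
  moreover have "?z ^ q = 1"
    by (simp add: power_divide zeta_power_power_q)
  ultimately have "(\<Sum>i<q. ?z ^ i) = 0"
    unfolding sum_gp_strict by (simp only: if_False diff_self div_0)
  then show ?thesis using False by simp
qed

text \<open>Fourier inversion: if \<phi> is the sum of the \<open>b_i \<sigma>_i\<close>, then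
  \<open>t^(-l) \<phi>(t^l)\<close> is the sum of the \<open>b_i \<zeta>^(i l)\<close>, and
  averaging against \<open>\<zeta>^(- i l)\<close> recovers \<open>b_i\<close>.\<close>

definition conj_coeff :: "nat \<Rightarrow> ('a fls \<Rightarrow> 'a fls) \<Rightarrow> 'a fls" where
  "conj_coeff i \<phi> = fls_const (1 / of_nat q) *
     (\<Sum>l<q. fls_const (1 / (\<zeta> ^ i) ^ l) * (fls_X powi (- int l)) * \<phi> (fls_X ^ l))"

lemma X_powi_cancel: "(fls_X powi (- int l)) * fls_X ^ l = (1 :: 'a fls)"
  by (simp add: fls_shifted_times_simps fls_X_power_conv_shift_1)

lemma conj_coeff_combination:
  assumes i: "i < q"
  shows "conj_coeff i (\<lambda>v. \<Sum>j<q. A j * conj j v) = A i"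
proof -
  have "(\<Sum>l<q. fls_const (1 / (\<zeta> ^ i) ^ l) * (fls_X powi (- int l)) * (\<Sum>j<q. A j * conj j (fls_X ^ l)))
    = (\<Sum>l<q. \<Sum>j<q. fls_const ((\<zeta> ^ j / \<zeta> ^ i) ^ l) * A j)"
  proof (rule sum.cong)
    fix l
    have "fls_const (1 / (\<zeta> ^ i) ^ l) * (fls_X powi (- int l)) * (A j * conj j (fls_X ^ l))
      = fls_const ((\<zeta> ^ j / \<zeta> ^ i) ^ l) * A j" for j
    proof -
      have "fls_const (1 / (\<zeta> ^ i) ^ l) * (fls_X powi (- int l)) * (A j * conj j (fls_X ^ l))
        = (fls_const (1 / (\<zeta> ^ i) ^ l) * fls_const ((\<zeta> ^ l) ^ j)) * ((fls_X powi (- int l)) * fls_X ^ l) * A j"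
        unfolding conj_X_power by (simp only: mult_ac)
      also have "fls_const (1 / (\<zeta> ^ i) ^ l) * fls_const ((\<zeta> ^ l) ^ j) = fls_const ((\<zeta> ^ j / \<zeta> ^ i) ^ l)"
        by (simp add: power_divide mult.commute flip: power_mult)
      finally show ?thesis unfolding X_powi_cancel by simp
    qed
    then show "fls_const (1 / (\<zeta> ^ i) ^ l) * (fls_X powi (- int l)) * (\<Sum>j<q. A j * conj j (fls_X ^ l))
        = (\<Sum>j<q. fls_const ((\<zeta> ^ j / \<zeta> ^ i) ^ l) * A j)"
      by (simp only: sum_distrib_left)
  qed simp
  also have "\<dots> = (\<Sum>j<q. fls_const (\<Sum>l<q. (\<zeta> ^ j / \<zeta> ^ i) ^ l) * A j)"
    by (subst sum.swap) (simp only: sum_fls_const_mult)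
  also have "\<dots> = (\<Sum>j<q. if j = i then fls_const (of_nat q) * A i else 0)"
    using i by (intro sum.cong) (auto simp: orthogonality)
  also have "\<dots> = fls_const (of_nat q) * A i" using i by simp
  finally have "conj_coeff i (\<lambda>v. \<Sum>j<q. A j * conj j v)
      = (fls_const (1 / of_nat q) * fls_const (of_nat q)) * A i"
    unfolding conj_coeff_def by (simp only: mult.assoc)
  also have "fls_const (1 / of_nat q) * fls_const (of_nat q) = (1 :: 'a fls)" using q by simp
  finally show ?thesis by simp
qed

text \<open>Linearity over K((x)), embedded into K((t)) by \<open>x = t^q\<close>.\<close>

definition semilinear :: "('a fls \<Rightarrow> 'a fls) \<Rightarrow> bool" where
  "semilinear \<phi> \<longleftrightarrow> (\<forall>u v. \<phi> (u + v) = \<phi> u + \<phi> v) \<and> (\<forall>h v. \<phi> (fls_compose_power h q * v) = fls_compose_power h q * \<phi> v)"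

lemma semilinear_sum: "semilinear \<phi> \<Longrightarrow> \<phi> (sum g A) = (\<Sum>x\<in>A. \<phi> (g x))"
proof (induction A rule: infinite_finite_induct)
  case empty
  have "\<phi> (fls_compose_power 0 q * 0) = fls_compose_power 0 q * \<phi> 0"
    using empty unfolding semilinear_def by blast
  then show ?case by simp
next
  case (infinite A)
  have "\<phi> (fls_compose_power 0 q * 0) = fls_compose_power 0 q * \<phi> 0"
    using infinite unfolding semilinear_def by blast
  then show ?case using infinite by simp
qed (simp add: semilinear_def)

lemma semilinear_eqI:
  assumes "semilinear \<phi>" "semilinear \<psi>" and eq: "\<And>l. l < q \<Longrightarrow> \<phi> (fls_X ^ l) = \<psi> (fls_X ^ l)"
  shows "\<phi> = \<psi>"
proof
  fix v :: "'a fls"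
  have v: "v = (\<Sum>l<q. fls_compose_power (fls_part q l v) q * fls_X ^ l)"
    using fls_decompose[OF q, of v] by (simp add: mult.commute)
  have "\<phi> (\<Sum>l<q. fls_compose_power (fls_part q l v) q * fls_X ^ l)
      = \<psi> (\<Sum>l<q. fls_compose_power (fls_part q l v) q * fls_X ^ l)"
    unfolding semilinear_sum[OF assms(1)] semilinear_sum[OF assms(2)]
  proof (rule sum.cong)
    fix l assume "l \<in> {..<q}"
    then have "\<phi> (fls_X ^ l) = \<psi> (fls_X ^ l)" using eq by simp
    then show "\<phi> (fls_compose_power (fls_part q l v) q * fls_X ^ l)
        = \<psi> (fls_compose_power (fls_part q l v) q * fls_X ^ l)"
      using assms(1,2) unfolding semilinear_def by simp
  qed simp
  then show "\<phi> v = \<psi> v" by (simp only: v[symmetric])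
qed

lemma semilinear_combination: "semilinear (\<lambda>v. \<Sum>j<q. A j * conj j v)"
  unfolding semilinear_def
  by (simp add: conj_add conj_mult conj_compose_power distrib_left sum.distrib sum_distrib_left mult_ac)

text \<open>Both sides are K((x))-linear, so it suffices to compare them at \<open>t^l\<close> for
  \<open>l < q\<close>, where orthogonality of the powers of \<zeta> applies.\<close>

lemma combination_conj_coeff:
  assumes "semilinear \<phi>"
  shows "(\<lambda>v. \<Sum>j<q. conj_coeff j \<phi> * conj j v) = \<phi>"
proof (rule semilinear_eqI[OF semilinear_combination assms])
  fix l assume l: "l < q"
  have "conj_coeff j \<phi> * conj j (fls_X ^ l) = fls_const (1 / of_nat q) *
    (\<Sum>k<q. fls_const ((\<zeta> ^ l / \<zeta> ^ k) ^ j) * ((fls_X powi (- int k)) * \<phi> (fls_X ^ k) * fls_X ^ l))" for j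
  proof -
    have "fls_const (1 / (\<zeta> ^ j) ^ k) * fls_const ((\<zeta> ^ l) ^ j) = fls_const ((\<zeta> ^ l / \<zeta> ^ k) ^ j)" for k
      by (simp add: power_divide mult.commute flip: power_mult)
    then show ?thesis unfolding conj_coeff_def conj_X_power sum_scale_regroup by (simp only:)
  qed
  then have "(\<Sum>j<q. conj_coeff j \<phi> * conj j (fls_X ^ l)) = fls_const (1 / of_nat q) *
    (\<Sum>j<q. \<Sum>k<q. fls_const ((\<zeta> ^ l / \<zeta> ^ k) ^ j) * ((fls_X powi (- int k)) * \<phi> (fls_X ^ k) * fls_X ^ l))"
    by (simp only: sum_distrib_left)
  also have "(\<Sum>j<q. \<Sum>k<q. fls_const ((\<zeta> ^ l / \<zeta> ^ k) ^ j) * ((fls_X powi (- int k)) * \<phi> (fls_X ^ k) * fls_X ^ l))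
    = (\<Sum>k<q. fls_const (\<Sum>j<q. (\<zeta> ^ l / \<zeta> ^ k) ^ j) * ((fls_X powi (- int k)) * \<phi> (fls_X ^ k) * fls_X ^ l))"
    by (subst sum.swap) (simp only: sum_fls_const_mult)
  also have "\<dots> = (\<Sum>k<q. if k = l then fls_const (of_nat q) * ((fls_X powi (- int l)) * \<phi> (fls_X ^ l) * fls_X ^ l) else 0)"
    using l by (intro sum.cong) (auto simp: orthogonality)
  also have "\<dots> = fls_const (of_nat q) * (((fls_X powi (- int l)) * fls_X ^ l) * \<phi> (fls_X ^ l))"
    using l by (simp add: mult_ac)
  also have "fls_const (1 / of_nat q) * \<dots> = (fls_const (1 / of_nat q) * fls_const (of_nat q)) * \<phi> (fls_X ^ l)"
    unfolding X_powi_cancel by (simp only: mult_1_left mult.assoc)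
  also have "fls_const (1 / of_nat q) * fls_const (of_nat q) = (1 :: 'a fls)" using q by simp
  finally show "(\<Sum>j<q. conj_coeff j \<phi> * conj j (fls_X ^ l)) = \<phi> (fls_X ^ l)" by simp
qed

end

lemma pole_order_eqI:
  assumes "0 \<le> N" "\<And>n. n < - N \<Longrightarrow> h $$ n = 0" "N = 0 \<or> h $$ (- N) \<noteq> 0"
  shows "pole_order h = N"
proof (cases "N = 0")
  case True
  then have "0 \<le> fls_subdegree h" using assms(2) by (intro fls_subdegree_ge0I) simp
  then show ?thesis using True by (simp add: pole_order_def)
next
  case False
  then have "fls_subdegree h = - N" using assms by (intro fls_subdegree_eqI) auto
  then show ?thesis using assms(1) by (simp add: pole_order_def)
qed

lemma pole_order_nonzero: "0 < pole_order h \<Longrightarrow> h $$ (- pole_order h) \<noteq> 0"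
proof -
  assume p: "0 < pole_order h"
  then have "h \<noteq> 0" by (auto simp: pole_order_def)
  moreover have "- pole_order h = fls_subdegree h" using p by (simp add: pole_order_def)
  ultimately show ?thesis by simp
qed

lemma pole_order_nonneg: "0 \<le> pole_order h"
  by (simp add: pole_order_def)

context conjugates
begin

lemma carr_End: "\<phi> \<in> carr (End_conn (E_conn f q)) \<longleftrightarrow> semilinear \<phi>"
  by (simp add: End_conn_def carr_E scal_E semilinear_def)

lemma scal_End: "scal (End_conn (E_conn f q)) h \<phi> = (\<lambda>v. fls_compose_power h q * \<phi> v)"
  by (simp add: End_conn_def carr_E scal_E)

lemma nabla_End: "nabla (End_conn (E_conn f q)) \<phi> =
    (\<lambda>v. nabla (E_conn f q) (\<phi> v) - \<phi> (nabla (E_conn f q) v))"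
  by (simp add: End_conn_def carr_E)

lemma nabla_E_add: "nabla (E_conn f q) (u + v) = nabla (E_conn f q) u + nabla (E_conn f q) v"
  by (simp only: nabla_E ddx_add distrib_left add_ac)

lemma nabla_E_scal: "nabla (E_conn f q) (fls_compose_power h q * v)
    = fls_compose_power (ddx 1 h) q * v + fls_compose_power h q * nabla (E_conn f q) v"
proof -
  have "ddx q (fls_compose_power h q) = fls_compose_power (ddx 1 h) q"
    using ddx_compose_power[OF q, of 1 h] by simp
  then show ?thesis by (simp only: nabla_E ddx_mult distrib_left mult_ac add_ac)
qed

lemma closed_End:
  fixes f :: "'a fls"
  shows "closed_conn (End_conn (E_conn f q))"
  unfolding closed_conn_def carr_End
proof (intro conjI ballI allI)
  fix \<phi> assume \<phi>: "\<phi> \<in> carr (End_conn (E_conn f q))"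
  then have \<phi>: "\<And>u v. \<phi> (u + v) = \<phi> u + \<phi> v"
    "\<And>h v. \<phi> (fls_compose_power h q * v) = fls_compose_power h q * \<phi> v"
    by (auto simp: carr_End semilinear_def)
  show "semilinear (scal (End_conn (E_conn f q)) h \<phi>)" for h
    unfolding semilinear_def scal_End by (simp add: \<phi> distrib_left mult.left_commute)
  show "semilinear (nabla (End_conn (E_conn f q)) \<phi>)"
    unfolding semilinear_def nabla_End
  proof (intro conjI allI)
    fix u v h
    show "nabla (E_conn f q) (\<phi> (u + v)) - \<phi> (nabla (E_conn f q) (u + v))
      = nabla (E_conn f q) (\<phi> u) - \<phi> (nabla (E_conn f q) u) + (nabla (E_conn f q) (\<phi> v) - \<phi> (nabla (E_conn f q) v))"
      by (simp only: \<phi> nabla_E_add) simp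
    show "nabla (E_conn f q) (\<phi> (fls_compose_power h q * v)) - \<phi> (nabla (E_conn f q) (fls_compose_power h q * v))
      = fls_compose_power h q * (nabla (E_conn f q) (\<phi> v) - \<phi> (nabla (E_conn f q) v))"
      by (simp only: \<phi> nabla_E_scal right_diff_distrib) simp
  qed
  fix \<psi> assume "\<psi> \<in> carr (End_conn (E_conn f q))"
  then show "semilinear (\<phi> + \<psi>)" using \<phi>
    by (simp add: carr_End semilinear_def distrib_left)
qed

end

section \<open>The summands of the endomorphism connection\<close>

locale end_decomposition = conjugates +
  fixes f :: "'a fls"
begin

text \<open>The connection sends \<open>b \<sigma>_i\<close> to
  \<open>(db/dx + x^(-1) (f - \<sigma>_i f) b) \<sigma>_i\<close>, so this is the series that
  defines the \<open>i\<close>-th part.\<close>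

definition dif :: "nat \<Rightarrow> 'a fls" where "dif i = f - conj i f"

text \<open>The number of irreducible summands of the \<open>i\<close>-th part, each of rank
  \<open>ram i\<close>. For \<open>i = 0\<close> the difference is 0 and there are \<open>q\<close>
  summands of rank 1.\<close>

definition width :: "nat \<Rightarrow> nat" where "width i = polar_gcd q (dif i)"

definition ram :: "nat \<Rightarrow> nat" where "ram i = q div width i"

definition G :: "nat \<Rightarrow> 'a fls" where "G i = fls_part (width i) 0 (polar_part (dif i))"

definition gauge :: "nat \<Rightarrow> 'a fls" where
  "gauge i = (SOME E. E \<noteq> 0 \<and> ddx q E = - (fls_X powi (- int q) * (dif i - polar_part (dif i)) * E))"

text \<open>K((t)) is the sum of the \<open>t^k K((t^d))\<close> for \<open>k < d\<close>, where
  \<open>d = width i\<close>. Since \<open>x d/dx\<close> multiplies \<open>t^k\<close> by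
  \<open>k / q\<close>, that constant is added to the series of the \<open>k\<close>-th summand. All
  Jordan blocks have size 1.\<close>

definition summand :: "nat \<times> nat \<Rightarrow> 'a summand" where
  "summand = (\<lambda>(i, k). (G i + fls_const (of_nat k / of_nat q), ram i, 1))"

definition idx :: "(nat \<times> nat) set" where "idx = (SIGMA i:{..<q}. {..<width i})"

text \<open>The coefficient of \<open>\<sigma>_i\<close> belonging to a family of elements of the
  summands: the sum is the expansion in powers of \<open>t\<close>, and \<open>gauge i\<close>
  restores the removed part of positive order.\<close>

definition A :: "(nat \<times> nat \<Rightarrow> 'a fls) \<Rightarrow> nat \<Rightarrow> 'a fls" where
  "A w i = gauge i * (\<Sum>k<width i. fls_X ^ k * fls_compose_power (w (i, k)) (width i))"

definition assemble :: "(nat \<times> nat \<Rightarrow> 'a fls) \<Rightarrow> 'a fls \<Rightarrow> 'a fls" where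
  "assemble w = (\<lambda>v. \<Sum>i<q. A w i * conj i v)"

definition parts :: "('a fls \<Rightarrow> 'a fls) \<Rightarrow> nat \<times> nat \<Rightarrow> 'a fls" where
  "parts \<phi> = (\<lambda>(i, k). fls_part (width i) k (inverse (gauge i) * conj_coeff i \<phi>))"

lemma width_pos: "0 < width i"
  unfolding width_def by (rule polar_gcd_pos[OF q])

lemma width_ram: "width i * ram i = q"
  unfolding ram_def width_def using polar_gcd_dvd by (rule dvd_mult_div_cancel)

lemma ram_pos: "0 < ram i"
  using width_ram[of i] q by (metis mult_0_right neq0_conv)

lemma dif_nth_0: "dif i $$ 0 = 0"
  by (simp add: dif_def conj_nth)

lemma gauge: "gauge i \<noteq> 0" "ddx q (gauge i) = - (fls_X powi (- int q) * (dif i - polar_part (dif i)) * gauge i)"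
  using someI_ex[OF gauge_exists[OF q dif_nth_0[of i]]] unfolding gauge_def by blast+

lemma G_compose: "fls_compose_power (G i) (width i) = polar_part (dif i)"
  unfolding G_def width_def by (rule polar_part_compose_power[OF q])

lemma G_nth: "n < 0 \<Longrightarrow> G i $$ n = dif i $$ (int (width i) * n)"
  using width_pos[of i] by (simp add: G_def fls_part_nth polar_part_nth mult_pos_neg)

text \<open>Passing to \<open>t^d\<close> divides the pole exponents by their gcd with
  \<open>q\<close>, and the added constant does not touch the polar part.\<close>

lemma summand_class:
  "R_class (ram i) (G i + fls_const c) \<in> R_circ (ram i)"
  unfolding R_circ_iff_polar_gcd[OF ram_pos]
proof (rule polar_gcd_reduced[OF q, of "dif i"])
  show "q = polar_gcd q (dif i) * ram i" using width_ram[of i] by (simp add: width_def)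
  show "(G i + fls_const c) $$ n = dif i $$ (int (polar_gcd q (dif i)) * n)" if "n < 0" for n
    using G_nth[OF that, of i] that by (simp add: width_def)
qed

lemma A_add: "A (\<lambda>p. w p + w' p) i = A w i + A w' i"
  by (simp add: A_def distrib_left sum.distrib)

lemma A_scal: "A (\<lambda>p. fls_compose_power h (ram (fst p)) * w p) i = fls_compose_power h q * A w i"
proof -
  have "fls_compose_power (fls_compose_power h (ram i)) (width i) = fls_compose_power h q"
    using fls_compose_power_compose_power[OF width_pos ram_pos, of h i i] width_ram[of i] by simp
  then show ?thesis by (simp add: A_def sum_distrib_left mult_ac)
qed

definition nabla_family :: "(nat \<times> nat \<Rightarrow> 'a fls) \<Rightarrow> nat \<times> nat \<Rightarrow> 'a fls" where
  "nabla_family w = (\<lambda>(i, k). ddx (ram i) (w (i, k))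
     + fls_X powi (- int (ram i)) * (G i + fls_const (of_nat k / of_nat q)) * w (i, k))"

text \<open>The derivative of \<open>gauge i\<close> cancels the non-polar part of
  \<open>dif i\<close>, and the derivative of \<open>t^k\<close> produces the constant
  \<open>k / q\<close>.\<close>

lemma A_nabla: "A (nabla_family w) i = ddx q (A w i) + fls_X powi (- int q) * dif i * A w i"
proof -
  let ?d = "width i" and ?x = "fls_X powi (- int q) :: 'a fls"
  let ?w = "\<lambda>k. fls_compose_power (w (i, k)) ?d"
  let ?B = "\<Sum>k<?d. fls_X ^ k * ?w k"
  have x: "fls_compose_power (fls_X powi (- int (ram i))) ?d = ?x"
  proof -
    have "fls_compose_power (fls_X_intpow (- int (ram i)) :: 'a fls) ?d = fls_X_intpow (int ?d * - int (ram i))"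
      by (rule fls_compose_power_X_intpow[OF width_pos])
    also have "int ?d * - int (ram i) = - int q"
      by (subst width_ram[of i, symmetric]) simp
    finally show ?thesis by simp
  qed
  have c: "fls_compose_power (nabla_family w (i, k)) ?d
      = ddx q (?w k) + ?x * (polar_part (dif i) + fls_const (of_nat k / of_nat q)) * ?w k" for k
    unfolding nabla_family_def prod.case fls_compose_power_add fls_compose_power_mult x G_compose
      fls_compose_power_const_left[OF width_pos] ddx_compose_power[OF width_pos ram_pos, symmetric] width_ram ..
  have "ddx q (fls_X ^ k * ?w k) + ?x * polar_part (dif i) * (fls_X ^ k * ?w k)
      = fls_X ^ k * fls_compose_power (nabla_family w (i, k)) ?d" for k
    unfolding c ddx_mult ddx_X_power[OF q] by (simp only: distrib_left distrib_right mult_ac add_ac)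
  then have B: "(\<Sum>k<?d. fls_X ^ k * fls_compose_power (nabla_family w (i, k)) ?d)
      = ddx q ?B + ?x * polar_part (dif i) * ?B"
    by (simp only: ddx_sum sum_distrib_left sum.distrib[symmetric])
  show ?thesis unfolding A_def B ddx_mult gauge(2)
    by (simp add: algebra_simps)
qed

lemma semilinear_assemble: "semilinear (assemble w)"
  unfolding assemble_def by (rule semilinear_combination)

lemma assemble_add: "assemble (\<lambda>p. w p + w' p) = assemble w + assemble w'"
  by (simp add: assemble_def A_add distrib_right sum.distrib fun_eq_iff)

lemma assemble_scal:
  "assemble (\<lambda>p. fls_compose_power h (ram (fst p)) * w p) = scal (End_conn (E_conn f q)) h (assemble w)"
  unfolding assemble_def A_scal scal_End by (simp only: sum_distrib_left mult_ac)

text \<open>Conjugation commutes with \<open>d/dx\<close> and fixes \<open>x\<close>, so in the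
  commutator the two terms with \<open>f\<close> combine to \<open>f - \<sigma>_i f\<close>.\<close>

lemma assemble_nabla: "assemble (nabla_family w) = nabla (End_conn (E_conn f q)) (assemble w)"
proof
  fix v
  let ?x = "fls_X powi (- int q) :: 'a fls"
  have x: "conj i ?x = ?x" for i
  proof -
    have "?x = fls_compose_power fls_X_inv q"
      using q by simp
    then show ?thesis by (simp only: conj_compose_power)
  qed
  have "A (nabla_family w) i * conj i v = nabla (E_conn f q) (A w i * conj i v) - A w i * conj i (nabla (E_conn f q) v)" for i
    unfolding A_nabla nabla_E ddx_mult conj_add conj_mult x ddx_conj dif_def by (simp add: algebra_simps)
  moreover have "nabla (E_conn f q) (\<Sum>i<q. g i) = (\<Sum>i<q. nabla (E_conn f q) (g i))" for g
    unfolding nabla_E by (simp only: ddx_sum sum_distrib_left sum.distrib)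
  ultimately show "assemble (nabla_family w) v = nabla (End_conn (E_conn f q)) (assemble w) v"
    unfolding assemble_def nabla_End by (simp only: sum_subtractf)
qed

lemma parts_assemble:
  assumes "(i, k) \<in> idx"
  shows "parts (assemble w) (i, k) = w (i, k)"
proof -
  have ik: "i < q" "k < width i" using assms by (auto simp: idx_def)
  have "conj_coeff i (assemble w) = A w i"
    unfolding assemble_def by (rule conj_coeff_combination[OF ik(1)])
  then have "inverse (gauge i) * conj_coeff i (assemble w)
      = (\<Sum>k<width i. fls_X ^ k * fls_compose_power (w (i, k)) (width i))"
    using gauge(1)[of i] by (simp add: A_def)
  then have "parts (assemble w) (i, k) = (\<Sum>k'<width i. fls_part (width i) k (fls_X ^ k' * fls_compose_power (w (i, k')) (width i)))"
    unfolding parts_def prod.case by (simp only: fls_part_sum[OF width_pos])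
  also have "\<dots> = (\<Sum>k'<width i. if k = k' then w (i, k') else 0)"
    using ik by (intro sum.cong fls_part_monomial_mult) auto
  also have "\<dots> = w (i, k)" using ik by simp
  finally show ?thesis .
qed

lemma assemble_parts:
  assumes "semilinear \<phi>"
  shows "assemble (parts \<phi>) = \<phi>"
proof -
  have "A (parts \<phi>) i = conj_coeff i \<phi>" for i
  proof -
    have "A (parts \<phi>) i = gauge i * (inverse (gauge i) * conj_coeff i \<phi>)"
      unfolding A_def parts_def prod.case
      by (subst (3) fls_decompose[OF width_pos[of i]]) (rule refl)
    then show ?thesis using gauge(1)[of i] by (simp add: mult.assoc[symmetric])
  qed
  then show ?thesis unfolding assemble_def using combination_conj_coeff[OF assms] by simp
qed

lemma assemble_cong:
  assumes "\<And>p. p \<in> idx \<Longrightarrow> w p = w' p"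
  shows "assemble w = assemble w'"
proof -
  have "A w i = A w' i" if "i < q" for i
    unfolding A_def using that assms by (auto simp: idx_def intro!: sum.cong arg_cong2[where f = "(*)"])
  then show ?thesis unfolding assemble_def by (intro ext sum.cong) auto
qed

text \<open>Exponents in \<open>t^d\<close> are multiplied by \<open>d\<close> on passing to
  \<open>t\<close>, and a constant creates no pole. Rank times slope of a summand is its pole order,
  so this gives the share of each of the \<open>d\<close> summands.\<close>

lemma weighted_pole_order:
  "int (width i) * pole_order (G i + fls_const c) = pole_order (dif i)"
proof (rule pole_order_eqI[symmetric])
  let ?g = "G i + fls_const c" and ?d = "int (width i)"
  have d: "0 < ?d" using width_pos by simp
  have g: "?g $$ n = dif i $$ (?d * n)" if "n < 0" for n using G_nth[OF that, of i] that by simp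
  show "0 \<le> ?d * pole_order ?g" using d pole_order_nonneg[of ?g] by simp
  show "dif i $$ n = 0" if n: "n < - (?d * pole_order ?g)" for n
  proof (cases "?d dvd n")
    case True
    then obtain k where k: "n = ?d * k" by (elim dvdE)
    then have "?d * k < ?d * (- pole_order ?g)" using n by simp
    then have "k < - pole_order ?g" using d by (simp only: mult_less_cancel_left_pos)
    moreover have "k < 0" using calculation pole_order_nonneg[of ?g] by simp
    ultimately show ?thesis using g[of k] pole_order_nth[of k ?g] k by simp
  next
    case False
    have "0 \<le> ?d * pole_order ?g" using d pole_order_nonneg[of ?g] by simp
    then have n0: "n < 0" using n by simp
    show ?thesis
    proof (rule ccontr)
      assume "dif i $$ n \<noteq> 0"
      then have "width i dvd nat (- n)"
        unfolding width_def using n0 by (intro polar_gcd_dvd_exponent) auto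
      then have "?d dvd int (nat (- n))" by (simp only: int_dvd_int_iff)
      then show False using n0 False by simp
    qed
  qed
  show "?d * pole_order ?g = 0 \<or> dif i $$ (- (?d * pole_order ?g)) \<noteq> 0"
  proof (cases "pole_order ?g = 0")
    case False
    then have "0 < pole_order ?g" using pole_order_nonneg[of ?g] by simp
    then show ?thesis using pole_order_nonzero[of ?g] g[of "- pole_order ?g"] by simp
  qed simp
qed

lemma nabla_EJ_1: "nabla (EJ_conn g r 1) u 0 = ddx r (u 0) + fls_X powi (- int r) * g * u 0"
  unfolding tensor_matrix_conn_def conn.simps nabla_E scal_E by (simp add: jordan_matrix_def)

theorem End_decomposition:
  "\<exists>ds. HTL_decomposition (End_conn (E_conn f q)) ds
    \<and> (\<Sum>d\<leftarrow>ds. real (summand_dim d) * summand_slope d) = (\<Sum>i<q. real_of_int (pole_order (dif i)))"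
proof -
  have fin: "finite idx" by (simp add: idx_def)
  define n where "n = card idx"
  obtain h where h: "bij_betw h {..<n} idx"
    using ex_bij_betw_nat_finite[OF fin] by (auto simp: n_def atLeast0LessThan)
  have hidx: "h j \<in> idx" if "j < n" for j using h that by (auto simp: bij_betw_def)
  define ds where "ds = map (\<lambda>j. summand (h j)) [0..<n]"
  have len: "length ds = n" by (simp add: ds_def)
  have nth: "ds ! j = summand (h j)" if "j < n" for j using that by (simp add: ds_def)
  \<comment> \<open>Blocks of size 1 carry all information in component 0.\<close>
  define fam where "fam u p = (if p \<in> idx then u (inv_into {..<n} h p) 0 else 0)"
    for u :: "nat \<Rightarrow> nat \<Rightarrow> 'a fls" and p
  have fam_h: "fam u (h j) = u j 0" if "j < n" for u j
    using that hidx[OF that] h by (simp add: fam_def bij_betw_inv_into_left)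
  have eq_on: "assemble w = assemble w'" if "\<And>j. j < n \<Longrightarrow> w (h j) = w' (h j)" for w w'
  proof (rule assemble_cong)
    fix p assume "p \<in> idx"
    then obtain j where "j < n" "p = h j" using h by (auto simp: bij_betw_def)
    then show "w p = w' p" using that by simp
  qed
  have sum_scal: "scal (sum_conn ds) c u j 0 = fls_compose_power c (ram (fst (h j))) * u j 0" if "j < n" for c u j
    using that by (cases "h j") (simp add: scal_sum_conn len nth summand_def scal_EJ)
  have sum_nabla: "nabla (sum_conn ds) u j 0 = nabla_family (\<lambda>p. u j 0) (h j)" if "j < n" for u j
    using that by (cases "h j") (simp add: nabla_sum_conn len nth summand_def nabla_EJ_1[simplified] nabla_family_def)
  have carr: "u \<in> carr (sum_conn ds) \<longleftrightarrow> (\<forall>j<n. \<forall>l\<ge>1. u j l = 0) \<and> (\<forall>j\<ge>n. u j = 0)" for u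
    unfolding carr_sum_conn len by (auto simp: nth summand_def carr_EJ split: prod.splits)
  let ?S = "\<lambda>u. assemble (fam u)"
  let ?T = "\<lambda>\<phi> j. if j < n then embed 0 (parts \<phi> (h j)) else 0"
  have S_scal: "?S (scal (sum_conn ds) c u) = scal (End_conn (E_conn f q)) c (?S u)" for c u
    unfolding assemble_scal[symmetric] by (rule eq_on) (simp add: fam_h sum_scal)
  have S_nabla: "?S (nabla (sum_conn ds) u) = nabla (End_conn (E_conn f q)) (?S u)" for u
    unfolding assemble_nabla[symmetric]
    by (rule eq_on) (simp add: fam_h sum_nabla nabla_family_def case_prod_unfold)
  have S_add: "?S (u + v) = ?S u + ?S v" for u v
    unfolding assemble_add[symmetric] by (rule eq_on) (simp add: fam_h)
  have bij: "bij_betw ?S (carr (sum_conn ds)) (carr (End_conn (E_conn f q)))"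
  proof (rule bij_betw_byWitness[where f' = ?T])
    show "\<forall>u\<in>carr (sum_conn ds). ?T (?S u) = u"
    proof (intro ballI ext)
      fix u j l assume u: "u \<in> carr (sum_conn ds)"
      show "?T (?S u) j l = u j l"
      proof (cases "j < n")
        case True
        have "parts (assemble (fam u)) (h j) = fam u (h j)"
          using parts_assemble[of "fst (h j)" "snd (h j)"] hidx[OF True] by simp
        then show ?thesis using True u fam_h[OF True] by (cases l) (auto simp: carr embed_def)
      next
        case False
        then show ?thesis using u by (simp add: carr)
      qed
    qed
    show "\<forall>\<phi>\<in>carr (End_conn (E_conn f q)). ?S (?T \<phi>) = \<phi>"
    proof
      fix \<phi> assume \<phi>: "\<phi> \<in> carr (End_conn (E_conn f q))"
      have "?S (?T \<phi>) = assemble (parts \<phi>)" by (rule eq_on) (simp add: fam_h embed_def)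
      then show "?S (?T \<phi>) = \<phi>" using \<phi> by (simp add: assemble_parts carr_End)
    qed
    show "?S ` carr (sum_conn ds) \<subseteq> carr (End_conn (E_conn f q))"
      using semilinear_assemble by (auto simp: carr_End)
    show "?T ` carr (End_conn (E_conn f q)) \<subseteq> carr (sum_conn ds)"
      by (auto simp: carr embed_def)
  qed
  have iso: "conn_iso (sum_conn ds) (End_conn (E_conn f q))"
    unfolding conn_iso_def using bij S_add S_scal S_nabla by (intro exI[of _ ?S]) blast
  have "conn_iso (End_conn (E_conn f q)) (sum_conn ds)"
  proof (rule conn_iso_sym[OF iso])
    show "u + v \<in> carr (sum_conn ds)" if "u \<in> carr (sum_conn ds)" "v \<in> carr (sum_conn ds)" for u v
      using that by (simp add: carr)
    show "scal (sum_conn ds) c u \<in> carr (sum_conn ds)" for c u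
      by (auto simp: carr scal_sum_conn len nth summand_def scal_EJ split: prod.splits)
    show "nabla (sum_conn ds) u \<in> carr (sum_conn ds)" for u
      by (auto simp: carr nabla_sum_conn len nth summand_def tensor_matrix_conn_def split: prod.splits)
  qed
  moreover have "\<forall>(g, r, m)\<in>set ds. 0 < r \<and> 0 < m \<and> R_class r g \<in> R_circ r"
    using ram_pos summand_class by (auto simp: ds_def summand_def split: prod.splits)
  ultimately have HTL: "HTL_decomposition (End_conn (E_conn f q)) ds"
    unfolding HTL_decomposition_def sum_conn_def by blast
  have "(\<Sum>d\<leftarrow>ds. real (summand_dim d) * summand_slope d)
      = (\<Sum>j<n. real (summand_dim (summand (h j))) * summand_slope (summand (h j)))"
    by (simp add: ds_def interv_sum_list_conv_sum_set_nat atLeast0LessThan o_def)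
  also have "\<dots> = (\<Sum>p\<in>idx. real (summand_dim (summand p)) * summand_slope (summand p))"
    by (rule sum.reindex_bij_betw[OF h])
  also have "\<dots> = (\<Sum>(i, k)\<in>idx. real_of_int (pole_order (G i + fls_const (of_nat k / of_nat q))))"
    using ram_pos by (intro sum.cong) (auto simp: summand_def summand_dim_def summand_slope_def slope_eq)
  also have "\<dots> = (\<Sum>(i, k)\<in>idx. real_of_int (pole_order (dif i)) / real (width i))"
  proof (rule sum.cong)
    fix p assume "p \<in> idx"
    obtain i k where p: "p = (i, k)" by (cases p)
    have "real_of_int (int (width i) * pole_order (G i + fls_const (of_nat k / of_nat q))) = real_of_int (pole_order (dif i))"
      by (simp only: weighted_pole_order)
    then show "(case p of (i, k) \<Rightarrow> real_of_int (pole_order (G i + fls_const (of_nat k / of_nat q))))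
        = (case p of (i, k) \<Rightarrow> real_of_int (pole_order (dif i)) / real (width i))"
      using width_pos[of i] unfolding p by (simp add: field_simps)
  qed simp
  also have "\<dots> = (\<Sum>i<q. \<Sum>k<width i. real_of_int (pole_order (dif i)) / real (width i))"
    unfolding idx_def by (rule sum.Sigma[symmetric]) auto
  \<comment> \<open>The \<open>width i\<close> equal shares add up to the whole pole order.\<close>
  also have "\<dots> = (\<Sum>i<q. real_of_int (pole_order (dif i)))"
    using width_pos by (intro sum.cong) (auto simp: less_imp_neq[symmetric])
  finally show ?thesis using HTL by blast
qed

corollary irregularity_End:
  "irregularity (End_conn (E_conn f q)) = (\<Sum>i<q. real_of_int (pole_order (dif i)))"
proof -
  obtain ds where ds: "HTL_decomposition (End_conn (E_conn f q)) ds"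
    "(\<Sum>d\<leftarrow>ds. real (summand_dim d) * summand_slope d) = (\<Sum>i<q. real_of_int (pole_order (dif i)))"
    using End_decomposition by blast
  show ?thesis using irregularity_eqI[OF closed_End ds(1)] ds(2) by (rule trans)
qed

end

section \<open>The Milnor number of the associated curve\<close>

text \<open>Chain rule along the curve \<open>y = \<beta>(s)\<close>: the first term differentiates
  the coefficients, the second the argument.\<close>

lemma fps_deriv_poly:
  fixes p :: "'a::field_char_0 fps poly"
  shows "fps_deriv (poly p \<beta>) = poly (map_poly fps_deriv p) \<beta> + poly (pderiv p) \<beta> * fps_deriv \<beta>"
proof (induction p)
  case (pCons a p)
  have "map_poly fps_deriv (pCons a p) = pCons (fps_deriv a) (map_poly fps_deriv p)"
    by (simp add: map_poly_pCons)
  then show ?case using pCons by (simp add: pderiv_pCons algebra_simps)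
qed simp

lemma fps_deriv_pow_subst:
  fixes c :: "'a::field_char_0 fps"
  assumes "0 < M"
  shows "fps_deriv (pow_subst M c) = fps_const (of_nat M) * fps_X ^ (M - 1) * pow_subst M (fps_deriv c)"
proof -
  have "fps_deriv (pow_subst M c) = pow_subst M (fps_deriv c) * fps_deriv (fps_X ^ M)"
    using assms by (intro fps_compose_deriv) simp
  also have "fps_deriv (fps_X ^ M :: 'a fps) = fps_const (of_nat M) * fps_X ^ (M - 1)"
    by (simp add: fps_deriv_power)
  finally show ?thesis by (simp only: mult_ac)
qed

lemma subdegree_fps_deriv:
  fixes v :: "'a::field_char_0 fps"
  assumes "v \<noteq> 0" "v $ 0 = 0"
  shows "fps_deriv v \<noteq> 0" "Suc (subdegree (fps_deriv v)) = subdegree v"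
proof -
  let ?s = "subdegree v"
  have "v $ ?s \<noteq> 0" using assms(1) by (rule nth_subdegree_nonzero)
  then have "?s \<noteq> 0" using assms(2) by (metis)
  then have s: "0 < ?s" by simp
  have nth: "fps_deriv v $ k = of_nat (Suc k) * v $ Suc k" for k by simp
  have nz: "fps_deriv v $ (?s - 1) \<noteq> 0"
  proof -
    obtain s' where s': "?s = Suc s'" using s by (cases ?s) auto
    have "of_nat (Suc s') * v $ Suc s' \<noteq> 0"
      using of_nat_neq_0[of s'] \<open>v $ ?s \<noteq> 0\<close> unfolding s' by (metis mult_eq_0_iff)
    then show ?thesis unfolding nth s' diff_Suc_1 .
  qed
  have "subdegree (fps_deriv v) = ?s - 1"
  proof (rule subdegreeI[OF nz])
    fix k assume "k < ?s - 1"
    then have "v $ Suc k = 0" by (intro nth_less_subdegree_zero) simp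
    then show "fps_deriv v $ k = 0" unfolding nth by simp
  qed
  then show "Suc (subdegree (fps_deriv v)) = subdegree v" using s by simp
  show "fps_deriv v \<noteq> 0"
  proof
    assume "fps_deriv v = 0"
    with nz show False by simp
  qed
qed

lemma subdegree_prod_fps:
  fixes g :: "'i \<Rightarrow> 'a::field fps"
  assumes "finite A" "\<And>x. x \<in> A \<Longrightarrow> g x \<noteq> 0"
  shows "subdegree (prod g A) = (\<Sum>x\<in>A. subdegree (g x))"
  using assms by (induction A rule: finite_induct) (auto simp: prod_zero_iff)

lemma subdegree_prod_list_fps:
  fixes g :: "'i \<Rightarrow> 'a::field fps"
  assumes "\<And>x. x \<in> set xs \<Longrightarrow> g x \<noteq> 0"
  shows "subdegree (\<Prod>x\<leftarrow>xs. g x) = (\<Sum>x\<leftarrow>xs. subdegree (g x))"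
  using assms
proof (induction xs)
  case (Cons a xs)
  have "(\<Prod>x\<leftarrow>xs. g x) \<noteq> 0" using Cons.prems by (auto simp: prod_list_zero_iff)
  then show ?case using Cons by simp
qed simp

lemma poly_linear_factors: "poly (\<Prod>b\<leftarrow>bs. [:- b, 1:]) x = (\<Prod>b\<leftarrow>bs. x - b)"
  for x :: "'a::idom"
  by (induction bs) (simp_all add: algebra_simps)

lemma poly_pderiv_linear_factors:
  fixes g :: "'i \<Rightarrow> 'a::idom"
  assumes "finite A" "i \<in> A"
  shows "poly (pderiv (\<Prod>k\<in>A. [:- g k, 1:])) (g i) = (\<Prod>k\<in>A - {i}. g i - g k)"
proof -
  have "(\<Prod>k\<in>A. [:- g k, 1:]) = [:- g i, 1:] * (\<Prod>k\<in>A - {i}. [:- g k, 1:])"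
    using assms by (rule prod.remove)
  then have "poly (pderiv (\<Prod>k\<in>A. [:- g k, 1:])) (g i) = poly (\<Prod>k\<in>A - {i}. [:- g k, 1:]) (g i)"
    by (simp add: pderiv_mult pderiv_pCons del: mult_pCons_left)
  then show ?thesis by (simp add: poly_prod)
qed

lemma sum_list_sum_swap: "(\<Sum>x\<leftarrow>xs. \<Sum>i\<in>A. g x i) = (\<Sum>i\<in>A. \<Sum>x\<leftarrow>xs. g x i)"
  for g :: "'b \<Rightarrow> 'i \<Rightarrow> nat"
  by (induction xs) (simp_all add: sum.distrib)

text \<open>Reconciles the index range of the curve's definition with residues modulo
  \<open>q\<close>: the conjugates at 0 and \<open>q\<close> coincide.\<close>

lemma prod_periodic_shift:
  fixes g :: "nat \<Rightarrow> 'a::comm_monoid_mult"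
  assumes "g q = g 0"
  shows "(\<Prod>i<q. g i) = (\<Prod>i=1..q. g i)"
proof (cases q)
  case (Suc r)
  have "(\<Prod>i<q. g i) = g 0 * (\<Prod>i<r. g (Suc i))"
    unfolding Suc by (rule prod.lessThan_Suc_shift)
  also have "\<dots> = (\<Prod>i<q. g (Suc i))"
    unfolding Suc prod.lessThan_Suc using assms Suc by (simp only: mult.commute)
  also have "\<dots> = (\<Prod>i=1..q. g i)" by (simp only: prod.atLeast1_atMost_eq One_nat_def)
  finally show ?thesis .
qed simp

text \<open>The two products below both equal, up to sign, the resultant of the polynomials with roots
  \<open>bs\<close> and \<open>g i\<close>.\<close>

lemma subdegree_resultant:
  fixes g :: "'i \<Rightarrow> 'a::field fps" and c :: "'a fps"
  assumes A: "finite A" and c: "c \<noteq> 0" "subdegree c = 0"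
    and D: "D = smult c (\<Prod>b\<leftarrow>bs. [:- b, 1:])"
    and nz: "\<And>i. i \<in> A \<Longrightarrow> poly D (g i) \<noteq> 0"
  shows "\<And>b. b \<in> set bs \<Longrightarrow> poly (\<Prod>i\<in>A. [:- g i, 1:]) b \<noteq> 0"
    and "(\<Sum>b\<leftarrow>bs. subdegree (poly (\<Prod>i\<in>A. [:- g i, 1:]) b)) = (\<Sum>i\<in>A. subdegree (poly D (g i)))"
proof -
  have D_eq: "poly D (g i) = c * (\<Prod>b\<leftarrow>bs. g i - b)" for i
    by (simp add: D poly_linear_factors)
  have ne: "g i - b \<noteq> 0" "b - g i \<noteq> 0" if "i \<in> A" "b \<in> set bs" for i b
    using nz[OF that(1)] that(2) by (auto simp: D_eq prod_list_zero_iff)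
  have P: "poly (\<Prod>i\<in>A. [:- g i, 1:]) b = (\<Prod>i\<in>A. b - g i)" for b
    by (simp add: poly_prod)
  show "poly (\<Prod>i\<in>A. [:- g i, 1:]) b \<noteq> 0" if "b \<in> set bs" for b
    using ne that A by (auto simp: P prod_zero_iff)
  have "(\<Sum>b\<leftarrow>bs. subdegree (poly (\<Prod>i\<in>A. [:- g i, 1:]) b)) = (\<Sum>b\<leftarrow>bs. \<Sum>i\<in>A. subdegree (b - g i))"
    using ne A by (intro arg_cong[where f = sum_list] map_cong) (simp_all add: P subdegree_prod_fps)
  also have "\<dots> = (\<Sum>i\<in>A. \<Sum>b\<leftarrow>bs. subdegree (b - g i))" by (rule sum_list_sum_swap)
  also have "\<dots> = (\<Sum>i\<in>A. \<Sum>b\<leftarrow>bs. subdegree (g i - b))"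
    by (simp only: subdegree_minus_commute)
  also have "\<dots> = (\<Sum>i\<in>A. subdegree (poly D (g i)))"
  proof (rule sum.cong)
    fix i assume i: "i \<in> A"
    have "(\<Prod>b\<leftarrow>bs. g i - b) \<noteq> 0" using nz[OF i] by (auto simp: D_eq)
    then have "subdegree (poly D (g i)) = subdegree (\<Prod>b\<leftarrow>bs. g i - b)"
      using c by (simp add: D_eq)
    also have "\<dots> = (\<Sum>b\<leftarrow>bs. subdegree (g i - b))"
      using ne i by (intro subdegree_prod_list_fps) auto
    finally show "(\<Sum>b\<leftarrow>bs. subdegree (g i - b)) = subdegree (poly D (g i))" ..
  qed simp
  finally show "(\<Sum>b\<leftarrow>bs. subdegree (poly (\<Prod>i\<in>A. [:- g i, 1:]) b)) = (\<Sum>i\<in>A. subdegree (poly D (g i)))" .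
qed

section \<open>The roots of the curve and their differences\<close>

locale curve = end_decomposition +
  fixes p :: int
  assumes polar1: "polar_gcd q f = 1"
    and f_nonzero: "f \<noteq> 0" and subdegree_f: "fls_subdegree f = - p" and p_nonneg: "0 \<le> p"
begin

lemma zeta_power_eq_1D: "\<zeta> ^ j = 1 \<Longrightarrow> q dvd j"
proof -
  assume j: "\<zeta> ^ j = 1"
  have "\<zeta> ^ j = (\<zeta> ^ q) ^ (j div q) * \<zeta> ^ (j mod q)"
    by (simp flip: power_mult power_add)
  then have "\<zeta> ^ (j mod q) = 1" using j by (simp add: zeta_power_q)
  then have "j mod q = 0"
    using primitive mod_less_divisor[OF q, of j] unfolding primitive_root_of_unity_def by auto
  then show ?thesis by (simp add: dvd_eq_mod_eq_0)
qed

text \<open>Without a pole, \<open>\<zeta>^(m n) = 1\<close> for every pole exponent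
  \<open>n\<close> of \<open>f\<close>, so \<open>q\<close> divides all \<open>m n\<close> as well
  as \<open>m q\<close>; since the gcd is 1, it would divide \<open>m\<close>.\<close>

lemma pole_order_dif_pos:
  assumes "0 < m" "m < q"
  shows "0 < pole_order (dif m)"
proof (rule ccontr)
  assume "\<not> 0 < pole_order (dif m)"
  then have "pole_order (dif m) = 0" using pole_order_nonneg[of "dif m"] by simp
  then have z: "dif m $$ n = 0" if "n < 0" for n using pole_order_nth[of n "dif m"] that by simp
  have "q dvd m * n" if n: "0 < n" "f $$ (- int n) \<noteq> 0" for n
  proof -
    have "f $$ (- int n) * (1 - (\<zeta> ^ m) powi (- int n)) = 0"
      using z[of "- int n"] n(1) by (simp add: dif_def conj_nth algebra_simps)
    then have "(\<zeta> ^ m) powi (- int n) = 1" using n(2) by simp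
    then have "\<zeta> ^ (m * n) = 1" by (simp add: power_int_minus power_mult)
    then show ?thesis by (rule zeta_power_eq_1D)
  qed
  then have "q dvd Gcd ((*) m ` insert q {n. 0 < n \<and> f $$ (- int n) \<noteq> 0})"
    by (intro Gcd_greatest) auto
  also have "\<dots> = m * polar_gcd q f"
    unfolding polar_gcd_def by (subst Gcd_mult) simp
  finally have "q dvd m" using polar1 by simp
  then show False using assms by (simp add: dvd_imp_le leD)
qed

lemma dif_0: "dif 0 = 0"
  by (rule fls_eqI) (simp add: dif_def conj_nth)

text \<open>If \<open>f\<close> had no pole, the gcd with \<open>q\<close> would be \<open>q\<close>
  itself.\<close>

lemma p_pos: "1 < q \<Longrightarrow> 0 < p"
proof -
  assume q1: "1 < q"
  obtain n where n: "0 < n" "f $$ (- int n) \<noteq> 0"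
  proof (rule ccontr)
    assume "\<not> thesis"
    then have e: "{n. 0 < n \<and> f $$ (- int n) \<noteq> 0} = {}" using that by blast
    have "polar_gcd q f = q" unfolding polar_gcd_def e by simp
    then show False using polar1 q1 by simp
  qed
  then have "fls_subdegree f \<le> - int n" by (intro fls_subdegree_leI)
  then show ?thesis using n(1) subdegree_f by simp
qed

lemma conj_1: "conj i 1 = 1"
  using conj_compose_power[of i 1] q by simp

lemma conj_diff: "conj i (g - h) = conj i g - conj i h"
  by (rule fls_eqI) (simp add: conj_nth algebra_simps)

lemma conj_inverse: "conj i (inverse h) = inverse (conj i h)"
proof (cases "h = 0")
  case True
  then show ?thesis using conj_eq_0_iff[of i 0] by simp
next
  case False
  then have "conj i h * conj i (inverse h) = 1" by (simp add: conj_1 flip: conj_mult)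
  then show ?thesis by (rule inverse_unique[symmetric])
qed

lemma conj_conj: "conj i (conj j h) = conj ((i + j) mod q) h"
proof (rule fls_eqI)
  fix n
  have "\<zeta> ^ ((i + j) mod q) = \<zeta> ^ (i + j)"
  proof -
    have "\<zeta> ^ (i + j) = (\<zeta> ^ q) ^ ((i + j) div q) * \<zeta> ^ ((i + j) mod q)"
      by (simp flip: power_mult power_add)
    then show ?thesis by (simp add: zeta_power_q)
  qed
  then show "conj i (conj j h) $$ n = conj ((i + j) mod q) h $$ n"
    by (simp add: conj_nth power_add power_int_mult_distrib mult_ac)
qed

definition root :: "nat \<Rightarrow> 'a fps" where "root i = fls_regpart (conj i (inverse f))"

lemma root_fls: "fps_to_fls (root i) = inverse (conj i f)"
proof -
  have "0 \<le> fls_subdegree (conj i (inverse f))"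
    using subdegree_conj[of i "inverse f"] f_nonzero subdegree_f p_nonneg by simp
  then show ?thesis unfolding root_def using conj_inverse by simp
qed

text \<open>The difference of reciprocals has numerator \<open>- \<sigma>_i (dif m)\<close>.
  Conjugation preserves orders, so the result depends on \<open>m\<close> alone, and the two factors
  in the denominator contribute \<open>p\<close> each.\<close>

lemma root_diff:
  assumes "i < q" "0 < m" "m < q"
  shows "root i - root ((i + m) mod q) \<noteq> 0"
    and "int (subdegree (root i - root ((i + m) mod q))) = 2 * p - pole_order (dif m)"
proof -
  let ?k = "(i + m) mod q"
  have nz: "conj j f \<noteq> 0" for j using f_nonzero by (simp add: conj_eq_0_iff)
  have pos: "0 < pole_order (dif m)" using assms by (intro pole_order_dif_pos)
  then have d: "dif m \<noteq> 0" "fls_subdegree (dif m) = - pole_order (dif m)"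
    by (auto simp: pole_order_def)
  have "fps_to_fls (root i - root ?k) = inverse (conj i f) - inverse (conj ?k f)"
    by (simp add: root_fls)
  also have "\<dots> = (conj ?k f - conj i f) / (conj i f * conj ?k f)"
    using nz[of i] nz[of ?k] by (simp add: field_simps)
  also have "conj ?k f - conj i f = - conj i (dif m)"
    by (simp add: dif_def conj_diff conj_conj)
  finally have eq: "fps_to_fls (root i - root ?k) = - conj i (dif m) / (conj i f * conj ?k f)" .
  have "conj i (dif m) \<noteq> 0" using d by (simp add: conj_eq_0_iff)
  then have ne: "- conj i (dif m) / (conj i f * conj ?k f) \<noteq> 0" using nz by simp
  then show "root i - root ?k \<noteq> 0" using eq by auto
  have "int (subdegree (root i - root ?k)) = fls_subdegree (- conj i (dif m) / (conj i f * conj ?k f))"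
    by (simp only: fls_subdegree_fls_to_fps[symmetric] eq)
  also have "\<dots> = fls_subdegree (conj i (dif m)) - (fls_subdegree (conj i f) + fls_subdegree (conj ?k f))"
    using nz[of i] nz[of ?k] \<open>conj i (dif m) \<noteq> 0\<close> by (simp add: divide_inverse)
  also have "\<dots> = 2 * p - pole_order (dif m)"
    by (simp add: subdegree_conj d(2) subdegree_f)
  finally show "int (subdegree (root i - root ?k)) = 2 * p - pole_order (dif m)" .
qed

text \<open>Re-indexes the roots other than the \<open>i\<close>-th by the difference
  \<open>m\<close>, which makes the sum of the orders independent of \<open>i\<close>.\<close>

lemma shift_bij: "i < q \<Longrightarrow> bij_betw (\<lambda>m. (i + m) mod q) {1..<q} ({..<q} - {i})"
proof -
  assume i: "i < q"
  have e: "(i + m) mod q = (if i + m < q then i + m else i + m - q)" if "m < q" for m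
    using i that by (simp add: le_mod_geq)
  have inj: "inj_on (\<lambda>m. (i + m) mod q) {1..<q}"
  proof (rule inj_onI)
    fix m m' assume m: "m \<in> {1..<q}" "m' \<in> {1..<q}" and "(i + m) mod q = (i + m') mod q"
    then have "(if i + m < q then i + m else i + m - q) = (if i + m' < q then i + m' else i + m' - q)"
      by (simp only: e atLeastLessThan_iff)
    then show "m = m'" using m i by (simp split: if_splits)
  qed
  have ne: "(i + m) mod q \<noteq> i" if "m \<in> {1..<q}" for m
  proof -
    have "m < q" "1 \<le> m" using that by auto
    then show ?thesis unfolding e[OF \<open>m < q\<close>] using i by (cases "i + m < q") auto
  qed
  have "(\<lambda>m. (i + m) mod q) ` {1..<q} = {..<q} - {i}"
  proof (rule card_subset_eq)
    show "(\<lambda>m. (i + m) mod q) ` {1..<q} \<subseteq> {..<q} - {i}" using ne q by auto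
    show "card ((\<lambda>m. (i + m) mod q) ` {1..<q}) = card ({..<q} - {i})"
      unfolding card_image[OF inj] using i by simp
  qed simp
  then show ?thesis using inj by (simp add: bij_betw_def)
qed

lemma root_diff_nonzero:
  assumes "i < q" "k < q" "k \<noteq> i"
  shows "root i - root k \<noteq> 0"
proof -
  have "k \<in> (\<lambda>m. (i + m) mod q) ` {1..<q}"
    using shift_bij[OF assms(1)] assms by (auto simp: bij_betw_def)
  then obtain m where m: "k = (i + m) mod q" "0 < m" "m < q" by auto
  show ?thesis unfolding m(1) using assms(1) m(2,3) by (rule root_diff(1))
qed

lemma sum_subdegree_root_diff:
  assumes i: "i < q"
  shows "int (\<Sum>k\<in>{..<q} - {i}. subdegree (root i - root k))
    = 2 * p * int (q - 1) - (\<Sum>m<q. pole_order (dif m))"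
proof -
  have "(\<Sum>k\<in>{..<q} - {i}. subdegree (root i - root k))
      = (\<Sum>m\<in>{1..<q}. subdegree (root i - root ((i + m) mod q)))"
    by (rule sum.reindex_bij_betw[OF shift_bij[OF i], symmetric])
  then have "int (\<Sum>k\<in>{..<q} - {i}. subdegree (root i - root k))
      = (\<Sum>m\<in>{1..<q}. int (subdegree (root i - root ((i + m) mod q))))" by simp
  also have "\<dots> = (\<Sum>m\<in>{1..<q}. 2 * p - pole_order (dif m))"
    using root_diff(2)[OF i] by (intro sum.cong) auto
  also have "\<dots> = 2 * p * int (q - 1) - (\<Sum>m\<in>{1..<q}. pole_order (dif m))"
    by (simp add: sum_subtractf)
  also have "(\<Sum>m\<in>{1..<q}. pole_order (dif m)) = (\<Sum>m<q. pole_order (dif m))"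
    by (rule sum.mono_neutral_left) (auto simp: dif_0 pole_order_def not_le)
  finally show ?thesis .
qed

definition P :: "'a fps poly" where "P = (\<Prod>i<q. [:- root i, 1:])"

lemma P_degree: "degree P = q" and P_lead: "coeff P q = 1"
proof -
  show *: "degree P = q" unfolding P_def by (subst degree_prod_eq_sum_degree) auto
  have "lead_coeff P = 1" unfolding P_def by (simp add: lead_coeff_prod)
  then show "coeff P q = 1" using * by simp
qed

lemma map_P: "map_poly fps_to_fls P = (\<Prod>i=1..q. [:- (1 / conj i f), 1:])"
proof -
  interpret h: comm_ring_hom_map "fps_to_fls :: 'a fps \<Rightarrow> 'a fls" by (rule fps_to_fls_hom)
  interpret hp: comm_ring_hom_map "map_poly (fps_to_fls :: 'a fps \<Rightarrow> 'a fls)" by (rule h.map_poly_hom)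
  have per: "conj q f = conj 0 f" by (rule fls_eqI) (simp add: conj_nth zeta_power_q)
  have "map_poly fps_to_fls P = (\<Prod>i<q. [:- (1 / conj i f), 1:])"
    unfolding P_def hp.hom_prod by (simp add: h.map_poly_linear root_fls divide_inverse)
  also have "\<dots> = (\<Prod>i=1..q. [:- (1 / conj i f), 1:])"
    by (rule prod_periodic_shift) (simp only: per)
  finally show ?thesis .
qed

text \<open>Replacing \<open>t\<close> by \<open>\<zeta> t\<close> permutes the linear factors
  cyclically.\<close>

lemma P_invariant: "conj 1 (fps_to_fls (coeff P n)) = fps_to_fls (coeff P n)"
proof -
  interpret c: comm_ring_hom_map "conj 1" by unfold_locales (simp_all only: conj_1 conj_add conj_mult)
  interpret cp: comm_ring_hom_map "map_poly (conj 1)" by (rule c.map_poly_hom)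
  have "map_poly (conj 1) (map_poly fps_to_fls P) = (\<Prod>i=1..q. [:- (1 / conj (Suc i mod q) f), 1:])"
    unfolding map_P cp.hom_prod c.map_poly_linear c.hom_uminus divide_inverse c.hom_mult conj_1 conj_inverse conj_conj
    by simp
  also have "\<dots> = (\<Prod>i=1..q. [:- (1 / conj i f), 1:])"
  proof -
    have per: "conj (i mod q) f = conj i f" for i
      using conj_conj[of i 0 f] by (metis add.right_neutral conj_conj dif_0 dif_def eq_iff_diff_eq_0)
    have per2: "conj (Suc q) f = conj 1 f"
      by (rule fls_eqI) (simp add: conj_nth zeta_power_q)
    have "(\<Prod>i=1..q. [:- (1 / conj (Suc i mod q) f), 1:]) = (\<Prod>i=1..q. [:- (1 / conj (Suc i) f), 1:])"
      by (simp only: per)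
    also have "\<dots> = (\<Prod>i<q. [:- (1 / conj (Suc i) f), 1:])"
      by (rule prod_periodic_shift[symmetric]) (simp only: per2 One_nat_def)
    also have "\<dots> = (\<Prod>i=1..q. [:- (1 / conj i f), 1:])"
      by (simp only: prod.atLeast1_atMost_eq One_nat_def)
    finally show ?thesis .
  qed
  finally have "map_poly (conj 1) (map_poly fps_to_fls P) = map_poly fps_to_fls P" unfolding map_P .
  then have "coeff (map_poly (conj 1) (map_poly fps_to_fls P)) n = coeff (map_poly fps_to_fls P) n" by simp
  then show ?thesis by (simp add: coeff_map_poly conj_eq_0_iff)
qed

definition Cp :: "'a fps poly" where "Cp = map_poly (residue_part q 0) P"

text \<open>Invariance multiplies the coefficient of \<open>t^k\<close> by \<open>\<zeta>^k\<close>
  without changing it, so only exponents divisible by \<open>q\<close> survive and no information is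
  lost in \<open>Cp\<close>.\<close>

lemma subst_Cp: "subst_poly q Cp = P"
proof (intro poly_eqI fps_ext)
  fix n k
  have "coeff P n $ k = 0" if "\<not> q dvd k"
  proof -
    have "coeff P n $ k * (\<zeta> ^ 1) powi (int k) = coeff P n $ k"
      using arg_cong[OF P_invariant[of n], of "\<lambda>h. h $$ int k"] by (simp add: conj_nth)
    then have "coeff P n $ k * (\<zeta> ^ k - 1) = 0" by (simp add: algebra_simps)
    then show ?thesis using zeta_power_eq_1D[of k] that by auto
  qed
  then show "coeff (subst_poly q Cp) n $ k = coeff P n $ k"
    by (auto simp: Cp_def coeff_map_poly pow_subst_nth residue_part_nth)
qed

text \<open>Uniqueness in the \<open>THE\<close> comes from the injectivity of the substitution
  \<open>x = t^q\<close>.\<close>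

lemma assoc_curve: "assoc_curve \<zeta> f q = fps_of_poly Cp"
  unfolding assoc_curve_def
proof (rule the_equality)
  have *: "fls_compose_power (fps_to_fls c) q = fps_to_fls (pow_subst q c)" for c :: "'a fps"
    using q by (rule fls_compose_power_fps_to_fls)
  have c: "coeff (\<Prod>i=1..q. [:- (1 / conj i f), 1:]) n = fps_to_fls (pow_subst q (coeff Cp n))" for n
  proof -
    have "coeff (\<Prod>i=1..q. [:- (1 / conj i f), 1:]) n = fps_to_fls (coeff P n)"
      unfolding map_P[symmetric] by (simp add: coeff_map_poly)
    also have "coeff P n = pow_subst q (coeff Cp n)"
      unfolding subst_Cp[symmetric] by (simp add: coeff_map_poly)
    finally show ?thesis .
  qed
  show "\<forall>n. fls_compose_power (fps_to_fls (fps_of_poly Cp $ n)) q = coeff (\<Prod>i=1..q. [:- (1 / conj i f), 1:]) n"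
    unfolding c * by simp
  show "C = fps_of_poly Cp"
    if C: "\<forall>n. fls_compose_power (fps_to_fls (C $ n)) q = coeff (\<Prod>i=1..q. [:- (1 / conj i f), 1:]) n" for C
  proof (rule fps_ext)
    fix n
    have "pow_subst q (C $ n) = pow_subst q (coeff Cp n)" using C unfolding c * by simp
    then have "pow_subst q (C $ n - coeff Cp n) = 0" by (simp add: fps_compose_sub_distrib)
    then show "C $ n = fps_of_poly Cp $ n" using q by (simp add: pow_subst_eq_0_iff)
  qed
qed

end

lemma deriv_x_fps_of_poly: "deriv_x (fps_of_poly p) = fps_of_poly (map_poly fps_deriv p)"
  by (rule fps_ext) (simp add: deriv_x_def coeff_map_poly)

lemma deriv_y_fps_of_poly: "deriv_y (fps_of_poly p) = fps_of_poly (pderiv p)"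
  by (simp add: deriv_y_def fps_of_poly_pderiv)

lemma map_poly_fps_deriv_subst:
  fixes p :: "'a::field_char_0 fps poly"
  assumes "0 < M"
  shows "map_poly fps_deriv (subst_poly M p)
    = smult (fps_const (of_nat M) * fps_X ^ (M - 1)) (subst_poly M (map_poly fps_deriv p))"
  by (rule poly_eqI) (simp add: coeff_map_poly fps_deriv_pow_subst[OF assms] mult.assoc)

lemma tcoeff_0_pow_subst: "0 < M \<Longrightarrow> tcoeff 0 (subst_poly M p) = tcoeff 0 p"
  by (rule poly_eqI) (simp add: coeff_map_poly pow_subst_nth)

section \<open>The polar curve and its codimension\<close>

context curve
begin

lemma Cp_coeff_q: "coeff Cp q = 1"
  by (rule fps_ext) (use q in \<open>simp add: Cp_def coeff_map_poly P_lead residue_part_nth\<close>)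

lemma Cp_degree: "degree Cp = q"
proof (rule antisym)
  show "degree Cp \<le> q"
    by (rule degree_le) (use P_degree in \<open>simp add: Cp_def coeff_map_poly coeff_eq_0\<close>)
  show "q \<le> degree Cp" using Cp_coeff_q by (intro le_degree) simp
qed

text \<open>Normalized to be monic, as Newton-Puiseux and Weierstrass division require; the unit
  \<open>q\<close> does not change the ideal.\<close>

definition H :: "'a fps poly" where "H = smult (fps_const (1 / of_nat q)) (pderiv Cp)"

lemma pderiv_Cp: "pderiv Cp = smult (fps_const (of_nat q)) H"
  using q by (simp add: H_def)

lemma coeff_H: "coeff H j = fps_const (1 / of_nat q) * (of_nat (Suc j) * coeff Cp (Suc j))"
  by (simp only: H_def coeff_smult coeff_pderiv)

lemma H_lead: "coeff H (q - 1) = 1"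
proof -
  have "Suc (q - 1) = q" using q by simp
  then have "coeff H (q - 1) = fps_const (1 / of_nat q) * of_nat q"
    unfolding coeff_H by (simp only: Cp_coeff_q mult_1_right)
  also have "\<dots> = (1 :: 'a fps)" using q by (simp add: fps_of_nat[symmetric])
  finally show ?thesis .
qed

lemma H_degree: "degree H = q - 1"
proof (rule antisym)
  show "degree H \<le> q - 1"
    by (rule degree_le) (simp add: coeff_H coeff_eq_0 Cp_degree)
  show "q - 1 \<le> degree H" using H_lead by (intro le_degree) simp
qed

text \<open>For \<open>q > 1\<close> the pole order \<open>p\<close> is positive, so every root
  \<open>1 / \<sigma>_i f\<close> vanishes at \<open>t = 0\<close>.\<close>

lemma tcoeff_0_P: "1 < q \<Longrightarrow> tcoeff 0 P = monom 1 q"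
proof -
  assume q1: "1 < q"
  interpret h: comm_ring_hom_map "\<lambda>c. c $ 0 :: 'a" by (rule tcoeff_0_hom)
  interpret hp: comm_ring_hom_map "map_poly (\<lambda>c. c $ 0 :: 'a)" by (rule h.map_poly_hom)
  have "root i $ 0 = 0" for i
  proof -
    have "fls_subdegree (conj i (inverse f)) = p"
      using subdegree_conj[of i "inverse f"] f_nonzero subdegree_f by simp
    then have "conj i (inverse f) $$ 0 = 0" using p_pos[OF q1] by simp
    then show ?thesis by (simp add: root_def)
  qed
  then have "tcoeff 0 P = (\<Prod>i<q. [:0, 1:])"
    unfolding P_def hp.hom_prod h.map_poly_linear by simp
  then show ?thesis by (simp add: monom_altdef)
qed

text \<open>The curve reduces to \<open>y^q\<close> at \<open>x = 0\<close>, hence its derivative to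
  a multiple of \<open>y^(q-1)\<close>. For \<open>q = 1\<close> the degree is 0 and no condition
  remains.\<close>

lemma H_distinguished: "distinguished H (q - 1)"
proof
  show "degree H = q - 1" by (rule H_degree)
  show "lead_coeff H = 1" unfolding H_degree by (rule H_lead)
  show "coeff H i $ 0 = 0" if "i < q - 1" for i
  proof -
    have q1: "1 < q" "Suc i < q" using that by auto
    have "tcoeff 0 Cp = monom 1 q"
      using tcoeff_0_P[OF q1(1)] tcoeff_0_pow_subst[OF q, of Cp] by (simp add: subst_Cp)
    then have "coeff (tcoeff 0 Cp) (Suc i) = 0" using q1(2) by simp
    then show ?thesis by (simp add: coeff_H)
  qed
qed

text \<open>Newton-Puiseux enters as a hypothesis because the coefficient field of the locale is
  merely of characteristic 0.\<close>

lemma codim_polar: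
  assumes alg_closed: "\<And>R :: 'a fps poly. lead_coeff R = 1 \<Longrightarrow> \<exists>N>0. splits (subst_poly N R)"
  shows "\<exists>d. fpsp.has_codim (ideal2 (map_poly fps_deriv Cp) H) d
    \<and> int d = (2 * p - 1) * int (q - 1) - (\<Sum>m<q. pole_order (dif m))"
proof -
  let ?Gx = "map_poly fps_deriv Cp"
  have "lead_coeff (subst_poly q H) = 1"
  proof -
    have "degree (subst_poly q H) = q - 1"
      using H_degree H_lead q by (subst map_poly_degree_eq) auto
    then show ?thesis using H_lead by (simp add: coeff_map_poly)
  qed
  then obtain N bs where N: "0 < N" and bs: "subst_poly N (subst_poly q H) = (\<Prod>b\<leftarrow>bs. [:- b, 1:])"
    using alg_closed unfolding splits_def by blast
  \<comment> \<open>Here \<open>t = s^N\<close> and \<open>x = s^M\<close>: over K[[s]] both the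
    roots of the curve, which lie in K[[t]], and those of \<open>H\<close> are available.\<close>
  define M where "M = N * q"
  have M: "0 < M" using N q by (simp add: M_def)
  interpret hN: comm_ring_hom_map "pow_subst N :: 'a fps \<Rightarrow> _" by (rule pow_subst_hom[OF N])
  interpret hNp: comm_ring_hom_map "map_poly (pow_subst N :: 'a fps \<Rightarrow> _)" by (rule hN.map_poly_hom)
  interpret hM: comm_ring_hom_map "pow_subst M :: 'a fps \<Rightarrow> _" by (rule pow_subst_hom[OF M])
  have HM: "subst_poly M H = (\<Prod>b\<leftarrow>bs. [:- b, 1:])"
    using bs subst_poly_subst_poly[OF N q, of H] by (simp add: M_def)
  have len: "length bs = q - 1"
  proof -
    have "degree (subst_poly M H) = q - 1"
      using H_degree H_lead M by (subst map_poly_degree_eq) auto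
    then show ?thesis unfolding HM length_linear_factors .
  qed
  define C where "C = subst_poly M Cp"
  have C_P: "C = subst_poly N P"
    using subst_poly_subst_poly[OF N q, of Cp] by (simp add: C_def M_def subst_Cp)
  define g where "g i = pow_subst N (root i)" for i
  have C_prod: "C = (\<Prod>i<q. [:- g i, 1:])"
    unfolding C_P P_def hNp.hom_prod by (simp add: hN.map_poly_linear hN.hom_uminus g_def)
  have dC: "pderiv C = smult (fps_const (of_nat q)) (\<Prod>b\<leftarrow>bs. [:- b, 1:])"
    unfolding C_def hM.map_poly_pderiv[symmetric] pderiv_Cp HM[symmetric]
    by (rule poly_eqI) (simp add: coeff_map_poly hM.hom_mult fps_const_compose)
  have g_diff: "g i - g k \<noteq> 0" "subdegree (g i - g k) = N * subdegree (root i - root k)"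
    if "i < q" "k < q" "k \<noteq> i" for i k
    using root_diff_nonzero[OF that] N
    by (simp_all add: g_def hN.hom_diff[symmetric] pow_subst_eq_0_iff subdegree_pow_subst del: right_minus_eq)
  have dCg: "poly (pderiv C) (g i) = (\<Prod>k\<in>{..<q} - {i}. g i - g k)" if "i < q" for i
    unfolding C_prod using that by (intro poly_pderiv_linear_factors) auto
  have dCg_nz: "poly (pderiv C) (g i) \<noteq> 0" if "i < q" for i
    unfolding dCg[OF that] using g_diff(1)[OF that] by (subst prod_zero_iff) auto
  have dCg_deg: "int (subdegree (poly (pderiv C) (g i))) = int N * (2 * p * int (q - 1) - (\<Sum>m<q. pole_order (dif m)))"
    if "i < q" for i
  proof -
    have "subdegree (poly (pderiv C) (g i)) = (\<Sum>k\<in>{..<q} - {i}. subdegree (g i - g k))"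
      unfolding dCg[OF that] using g_diff(1)[OF that] by (intro subdegree_prod_fps) auto
    also have "\<dots> = (\<Sum>k\<in>{..<q} - {i}. N * subdegree (root i - root k))"
      using g_diff(2)[OF that] by (intro sum.cong) auto
    also have "\<dots> = N * (\<Sum>k\<in>{..<q} - {i}. subdegree (root i - root k))"
      by (simp only: sum_distrib_left)
    finally show ?thesis using sum_subdegree_root_diff[OF that] by simp
  qed
  have cq: "fps_const (of_nat q) \<noteq> (0 :: 'a fps)" "subdegree (fps_const (of_nat q) :: 'a fps) = 0"
    using q by simp_all
  have dCg_nz': "poly (pderiv C) (g i) \<noteq> 0" if "i \<in> {..<q}" for i using dCg_nz that by simp
  have C_nz: "poly C b \<noteq> 0" if "b \<in> set bs" for b
    unfolding C_prod
    by (rule subdegree_resultant(1)[where A = "{..<q}" and g = g, OF finite_lessThan cq dC _ that])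
      (rule dCg_nz')
  have C_deg: "(\<Sum>b\<leftarrow>bs. subdegree (poly C b)) = (\<Sum>i<q. subdegree (poly (pderiv C) (g i)))"
    unfolding C_prod
    by (rule subdegree_resultant(2)[where A = "{..<q}" and g = g, OF finite_lessThan cq dC[unfolded C_prod]])
      (rule dCg_nz'[unfolded C_prod])
  \<comment> \<open>On a root \<open>b\<close> of the y-derivative the chain rule leaves
    \<open>M s^(M-1)\<close> times the x-derivative. Together with the 1 lost by differentiating in
    \<open>s\<close>, the factor \<open>s^(M-1)\<close> accounts for \<open>M\<close>.\<close>
  have Gx: "poly (subst_poly M ?Gx) b \<noteq> 0 \<and> subdegree (poly (subst_poly M ?Gx) b) + M = subdegree (poly C b)"
    if b: "b \<in> set bs" for b
  proof -
    have "1 < q" using b len by (cases bs) auto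
    have "poly (pderiv C) b = 0" using b by (auto simp: dC poly_linear_factors prod_list_zero_iff)
    have C0: "tcoeff 0 C = monom 1 q"
      unfolding C_P tcoeff_0_pow_subst[OF N] by (rule tcoeff_0_P[OF \<open>1 < q\<close>])
    interpret h: comm_ring_hom_map "\<lambda>c. c $ 0 :: 'a" by (rule tcoeff_0_hom)
    \<comment> \<open>Modulo \<open>s\<close> the curve is \<open>y^q\<close>, so \<open>b\<close>
      vanishes at \<open>s = 0\<close>, and so does \<open>poly C b\<close>; only then does
      differentiation lower its order by exactly 1.\<close>
    have "poly (pderiv (monom 1 q)) (b $ 0) = 0"
      unfolding C0[symmetric] h.map_poly_pderiv[symmetric] h.poly_map_poly using \<open>poly (pderiv C) b = 0\<close> by simp
    then have b0: "b $ 0 = 0" using q by (simp add: pderiv_monom poly_monom)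
    have "poly C b $ 0 = poly (tcoeff 0 C) (b $ 0)" by (rule h.poly_map_poly[symmetric])
    then have "poly C b $ 0 = 0" using b0 q by (simp add: C0 poly_monom)
    then have v: "fps_deriv (poly C b) \<noteq> 0" "Suc (subdegree (fps_deriv (poly C b))) = subdegree (poly C b)"
      using subdegree_fps_deriv[OF C_nz[OF b]] by simp_all
    have eq: "fps_deriv (poly C b) = fps_const (of_nat M) * fps_X ^ (M - 1) * poly (subst_poly M ?Gx) b"
      using fps_deriv_poly[of C b] \<open>poly (pderiv C) b = 0\<close>
      by (simp add: C_def map_poly_fps_deriv_subst[OF M])
    then have nz: "poly (subst_poly M ?Gx) b \<noteq> 0" using v(1) by auto
    then have "subdegree (fps_deriv (poly C b)) = (M - 1) + subdegree (poly (subst_poly M ?Gx) b)"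
      unfolding eq using M by simp
    then show ?thesis using nz v(2) M by simp
  qed
  obtain d where d: "fpsp.has_codim (ideal2 ?Gx H) d"
    "d * M = (\<Sum>b\<leftarrow>bs. subdegree (poly (subst_poly M ?Gx) b))"
    using has_codim_split[OF M HM, of ?Gx] Gx by blast
  have "(\<Sum>b\<leftarrow>bs. subdegree (poly C b)) = (\<Sum>b\<leftarrow>bs. subdegree (poly (subst_poly M ?Gx) b) + M)"
    using Gx by (intro arg_cong[where f = sum_list] map_cong) simp_all
  also have "\<dots> = d * M + (q - 1) * M"
    unfolding d(2) len[symmetric] by (induction bs) simp_all
  finally have "int (d * M + (q - 1) * M) = (\<Sum>i<q. int (subdegree (poly (pderiv C) (g i))))"
    unfolding C_deg by (simp only: of_nat_sum[symmetric])
  also have "\<dots> = (\<Sum>i<q. int N * (2 * p * int (q - 1) - (\<Sum>m<q. pole_order (dif m))))"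
    using dCg_deg by (intro sum.cong) auto
  \<comment> \<open>Each of the \<open>q\<close> roots contributes \<open>N\<close> times the same
    amount, and \<open>N * q = M\<close>, so \<open>M\<close> cancels afterwards.\<close>
  also have "\<dots> = int M * (2 * p * int (q - 1) - (\<Sum>m<q. pole_order (dif m)))"
    by (simp only: sum_constant card_lessThan M_def of_nat_mult mult_ac)
  finally have "int M * (int d + int (q - 1)) = int M * (2 * p * int (q - 1) - (\<Sum>m<q. pole_order (dif m)))"
    by (simp only: of_nat_add of_nat_mult distrib_left mult.commute[of "int M"])
  then have "int d + int (q - 1) = 2 * p * int (q - 1) - (\<Sum>m<q. pole_order (dif m))"
    using M by simp
  then show ?thesis using d(1) by (intro exI[of _ d] conjI) (simp_all add: left_diff_distrib)
qed

lemma milnor_number: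
  assumes alg_closed: "\<And>R :: 'a fps poly. lead_coeff R = 1 \<Longrightarrow> \<exists>N>0. splits (subst_poly N R)"
  shows "\<exists>d. milnor_number (assoc_curve \<zeta> f q) = enat d
    \<and> int d = (2 * p - 1) * int (q - 1) - (\<Sum>m<q. pole_order (dif m))"
proof -
  obtain d where d: "fpsp.has_codim (ideal2 (map_poly fps_deriv Cp) H) d"
    "int d = (2 * p - 1) * int (q - 1) - (\<Sum>m<q. pole_order (dif m))"
    using codim_polar[OF alg_closed] by blast
  interpret distinguished H "q - 1" by (rule H_distinguished)
  let ?W = "ideal2 (fps_of_poly (map_poly fps_deriv Cp)) (fps_of_poly H)"
  have "fps2.has_codim ?W d" by (rule has_codim_fps_of_poly[OF d(1)])
  then have "quotient_dim ?W = enat d" by (rule quotient_dim_eqI[OF subspace_ideal2_fps2])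
  moreover have "milnor_number (assoc_curve \<zeta> f q) = quotient_dim ?W"
  proof -
    have "fps_of_poly (pderiv Cp) = fps_const (fps_const (of_nat q)) * fps_of_poly H"
      by (simp only: pderiv_Cp fps_of_poly_smult)
    moreover have "fps_const (fps_const (of_nat q)) * fps_const (fps_const (1 / of_nat q)) = (1 :: 'a fps fps)"
      using q by simp
    ultimately have "ideal2 (fps_of_poly (map_poly fps_deriv Cp)) (fps_of_poly (pderiv Cp)) = ?W"
      by (simp only: ideal2_unit_mult)
    then show ?thesis
      unfolding milnor_number_def intersection_number_def assoc_curve deriv_x_fps_of_poly deriv_y_fps_of_poly
        ideal2_def[symmetric] by simp
  qed
  ultimately show ?thesis using d(2) by auto
qed

end

text \<open>A series of positive order lies in \<open>R_kernel\<close>. Used contrapositively: a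
  nonzero class forces \<open>p \<ge> 0\<close>, so the reciprocals of the conjugates are power
  series.\<close>

lemma R_class_eq_zero_class:
  fixes f :: "'a::field_char_0 fls"
  assumes "0 < fls_subdegree f"
  shows "R_class q f = R_class q 0"
proof -
  have "f = fps_to_fls (fps_X * fps_shift 1 (fls_regpart f))"
  proof (rule fls_eqI)
    fix n
    show "f $$ n = fps_to_fls (fps_X * fps_shift 1 (fls_regpart f)) $$ n"
      using assms by (cases "n \<le> 0") auto
  qed
  then obtain g where f: "f = fps_to_fls (fps_X * g)" by blast
  have *: "h \<in> R_kernel q \<Longrightarrow> h + fps_to_fls (fps_X * g') \<in> R_kernel q" for h g'
  proof -
    assume "h \<in> R_kernel q"
    then obtain g0 k where "h = fps_to_fls (fps_X * g0) + fls_const (of_int k / of_nat q)"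
      unfolding R_kernel_def by blast
    then have "h + fps_to_fls (fps_X * g') = fps_to_fls (fps_X * (g0 + g')) + fls_const (of_int k / of_nat q)"
      by (simp add: distrib_left)
    then show ?thesis unfolding R_kernel_def by blast
  qed
  show ?thesis
  proof (intro equalityI subsetI)
    fix x assume "x \<in> R_class q f"
    then obtain h where h: "h \<in> R_kernel q" "x = f + h" unfolding R_class_def by blast
    then have "x = 0 + (h + fps_to_fls (fps_X * g))" by (simp add: f add.commute)
    then show "x \<in> R_class q 0" unfolding R_class_def using *[OF h(1)] by blast
  next
    fix x :: "'a fls" assume "x \<in> R_class q 0"
    then have x: "x \<in> R_kernel q" unfolding R_class_def by auto
    have "x = f + (x + fps_to_fls (fps_X * (- g)))" by (simp add: f)
    then show "x \<in> R_class q f" unfolding R_class_def using *[OF x] by blast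
  qed
qed

theorem theorem0p2:
  fixes f :: "'a::{alg_closed_field, field_char_0} fls"
    and \<zeta> :: 'a and p :: int and q :: nat
  assumes "0 < q"
    and "irreducible_connection (E_conn f q)"
    and "R_class q f \<in> R_circ q - {R_class q 0}"
    and "puiseux_ord q f = ereal (- real_of_int p / real q)"
    and "primitive_root_of_unity q \<zeta>"
  shows "ereal_of_enat (milnor_number (assoc_curve \<zeta> f q)) =
    ereal ((2 * real_of_int p - 1) * (real q - 1) - irregularity (End_conn (E_conn f q)))"
proof -
  have f: "f \<noteq> 0" using assms(4) by (auto simp: puiseux_ord_def)
  have "real_of_int (fls_subdegree f) / real q = - real_of_int p / real q"
    using assms(4) f by (simp add: puiseux_ord_def)
  then have "real_of_int (fls_subdegree f) = real_of_int (- p)" using assms(1) by (simp add: field_simps)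
  then have sub: "fls_subdegree f = - p" by (simp only: of_int_eq_iff)
  have p: "0 \<le> p"
    using R_class_eq_zero_class[of f q] assms(3) sub by force
  interpret curve \<zeta> q f p
    by unfold_locales (use assms f sub p R_circ_iff_polar_gcd[OF assms(1), of f] in auto)
  obtain d where d: "milnor_number (assoc_curve \<zeta> f q) = enat d"
    "int d = (2 * p - 1) * int (q - 1) - (\<Sum>m<q. pole_order (dif m))"
    using milnor_number[OF puiseux] by blast
  have "real d = real_of_int (int d)" by simp
  also have "\<dots> = (2 * real_of_int p - 1) * (real q - 1) - irregularity (End_conn (E_conn f q))"
    unfolding d(2) irregularity_End using assms(1) by (simp add: of_nat_diff)
  finally show ?thesis unfolding d(1) by simp
qed

end
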